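(* For $0<r<\frac12$ there is a homotopy equivalence $$\check{\mathbf C}_{\le}(S^1;r)\simeq\begin{cases} S^{2l+1} & \text{if } \frac{l}{2(l+1)}<r<\frac{l+1}{2(l+2)},\ l=0,1,\ldots,\\ \bigvee^{\mathfrak c} S^{2l} & \text{if } r=\frac{l}{2(l+1)},\ l=0,1,\ldots,\end{cases}$$ where $\mathfrak c$ is the cardinality of the continuum. Moreover, if $\frac{l}{2(l+1)}<r\le r'<\frac{l+1}{2(l+2)}$ then the inclusion $\check{\mathbf C}_{\le}(S^1;r)\hookrightarrow\check{\mathbf C}_{\le}(S^1;r')$ is a homotopy equivalence.
   Context: $S^1$ denotes the circle of circumference $1$ with the arc-length metric. For $X\subseteq S^1$ and $r>0$, the Čech complex $\check{\mathbf C}_{\le}(X;r)$ is the simplicial complex with vertex set $X$ in which a finite subset $\sigma\subseteq X$ is a face if and only if $\bigcap_{x\in\sigma}B_{\le}(x;r)\neq\emptyset$, where $B_{\le}(x;r)$ is the closed ball of radius $r$ about $x$ in $S^1$; equivalently, $\sigma$ is contained in some closed arc of length $2r$. The geometric realization carries the CW (weak) topology with respect to finite subcomplexes. $\bigvee^{\mathfrak c}S^{2l}$ is a wedge of $\mathfrak c$ copies of $S^{2l}$. *)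

theory Defs
  imports "HOL-Analysis.Analysis"
begin

(* The circle S^1 of circumference 1, modelled as [0,1) with the arc-length metric. *)
definition circle :: "real set" where
  "circle = {0..<1}"

definition circ_dist :: "real \<Rightarrow> real \<Rightarrow> real" where
  "circ_dist x y = min \<bar>x - y\<bar> (1 - \<bar>x - y\<bar>)"

definition circ_cball :: "real \<Rightarrow> real \<Rightarrow> real set" where
  "circ_cball x r = {y \<in> circle. circ_dist x y \<le> r}"

definition cech_le :: "real set \<Rightarrow> real \<Rightarrow> real set set" where
  "cech_le X r = {\<sigma>. \<sigma> \<subseteq> X \<and> finite \<sigma> \<and> \<sigma> \<noteq> {} \<and> (\<Inter>x\<in>\<sigma>. circ_cball x r) \<noteq> {}}"

(* Geometric realization of an (abstract) simplicial complex K, given as a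
   set of finite nonempty faces: points are finitely supported barycentric
   coordinate functions whose support is a face. *)
definition realization_set :: "'a set set \<Rightarrow> ('a \<Rightarrow> real) set" where
  "realization_set K = {\<alpha>. (\<forall>v. 0 \<le> \<alpha> v) \<and> finite {v. \<alpha> v \<noteq> 0}
       \<and> {v. \<alpha> v \<noteq> 0} \<in> K \<and> sum \<alpha> {v. \<alpha> v \<noteq> 0} = 1}"

definition closed_simplex :: "'a set \<Rightarrow> ('a \<Rightarrow> real) set" where
  "closed_simplex \<sigma> = {\<alpha>. (\<forall>v. 0 \<le> \<alpha> v) \<and> (\<forall>v. v \<notin> \<sigma> \<longrightarrow> \<alpha> v = 0) \<and> sum \<alpha> \<sigma> = 1}"

(* Each closed simplex carries its Euclidean topology (= product topology, as
   only finitely many coordinates vary); the realization carries the weak (CW)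
   topology coherent with the closed simplices. *)
definition realization :: "'a set set \<Rightarrow> ('a \<Rightarrow> real) topology" where
  "realization K = topology (\<lambda>U. U \<subseteq> realization_set K \<and>
      (\<forall>\<sigma>\<in>K. openin (subtopology (powertop_real UNIV) (closed_simplex \<sigma>)) (U \<inter> closed_simplex \<sigma>)))"

definition quotient_topology :: "'a topology \<Rightarrow> ('a \<Rightarrow> 'b) \<Rightarrow> 'b topology" where
  "quotient_topology X f = topology (\<lambda>U. U \<subseteq> f ` topspace X \<and>
      openin X {x \<in> topspace X. f x \<in> U})"

definition sphere_base :: "nat \<Rightarrow> real" where
  "sphere_base = (\<lambda>i. if i = 0 then 1 else 0)"

(* Wedge of continuum many (indexed by the reals) copies of S^n:
   disjoint union with all base points identified. *)
definition wedge_collapse :: "real \<times> (nat \<Rightarrow> real) \<Rightarrow> real \<times> (nat \<Rightarrow> real)" where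
  "wedge_collapse p = (if snd p = sphere_base then (0, sphere_base) else p)"

definition continuum_wedge_spheres :: "nat \<Rightarrow> (real \<times> (nat \<Rightarrow> real)) topology" where
  "continuum_wedge_spheres n =
     quotient_topology (sum_topology (\<lambda>_::real. nsphere n) UNIV) wedge_collapse"

definition homotopy_equivalence_map :: "'a topology \<Rightarrow> 'b topology \<Rightarrow> ('a \<Rightarrow> 'b) \<Rightarrow> bool" where
  "homotopy_equivalence_map X Y f \<longleftrightarrow> continuous_map X Y f \<and>
     (\<exists>g. continuous_map Y X g \<and> homotopic_with (\<lambda>x. True) X X (g \<circ> f) id
          \<and> homotopic_with (\<lambda>x. True) Y Y (f \<circ> g) id)"

end

theory Submission
  imports Defs
begin

text \<open>
  Put \<open>d = 1 - 2r\<close>. A finite set of points is a face iff it misses an open arc of length \<open>d\<close>. All homotopy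
  equivalences are obtained from the carrier theorem: a monotone assignment of contractible subcomplexes
  to the simplices of a complex carries a continuous map, and two carried maps are homotopic. In
  particular a subcomplex inclusion is a homotopy equivalence once both the retraction and the
  deformation are carried; the values of the carriers are contractible because removing dominated
  vertices reduces them to simplices or cones.

  For \<open>1/m < d < 1/(m - 1)\<close> the length \<open>d\<close> may be changed slightly, on one short interval of left end points
  \<open>a\<close> at a time: the obstruction to pushing the right end point of a gap upwards travels along
  \<open>a + d, a + 2d, \<dots>, a + (m - 1)d\<close> and ends in the gap itself. This reduces to \<open>d = 2/(2m - 1)\<close>, where rounding
  down to the \<open>(2m - 1)\<close>-gon deforms the complex onto the boundary of a simplex with \<open>2m - 1\<close> vertices. For
  \<open>d = 1/m\<close> rounding down to the \<open>m\<close>-gon \<open>C\<close> is obstructed exactly by the faces containing a full coset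
  \<open>C'\<close> of \<open>C\<close>; each such coset contributes the boundary of the simplex on \<open>C \<union> C'\<close>, and all these
  spheres share the simplex on \<open>C\<close>.
\<close>

section \<open>Simplicial complexes and their realizations\<close>

subsection \<open>Abstract complexes\<close>

definition abstract_complex :: "'a set set \<Rightarrow> bool" where
  "abstract_complex K \<longleftrightarrow> (\<forall>\<sigma>\<in>K. finite \<sigma> \<and> \<sigma> \<noteq> {}) \<and>
     (\<forall>\<sigma>\<in>K. \<forall>\<tau>. \<tau> \<subseteq> \<sigma> \<and> \<tau> \<noteq> {} \<longrightarrow> \<tau> \<in> K)"

definition all_faces :: "'a set \<Rightarrow> 'a set set" where
  "all_faces \<sigma> = {\<tau>. \<tau> \<subseteq> \<sigma> \<and> \<tau> \<noteq> {}}"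

definition simplex_boundary :: "'a set \<Rightarrow> 'a set set" where
  "simplex_boundary V = all_faces V - {V}"

lemma abstract_complexI:
  assumes "\<And>\<sigma>. \<sigma> \<in> K \<Longrightarrow> finite \<sigma>" "\<And>\<sigma>. \<sigma> \<in> K \<Longrightarrow> \<sigma> \<noteq> {}"
    and "\<And>\<sigma> \<tau>. \<sigma> \<in> K \<Longrightarrow> \<tau> \<subseteq> \<sigma> \<Longrightarrow> \<tau> \<noteq> {} \<Longrightarrow> \<tau> \<in> K"
  shows "abstract_complex K"
  using assms unfolding abstract_complex_def by simp

lemma abstract_complexD:
  assumes "abstract_complex K" "\<sigma> \<in> K"
  shows "finite \<sigma>" "\<sigma> \<noteq> {}" "\<And>\<tau>. \<tau> \<subseteq> \<sigma> \<Longrightarrow> \<tau> \<noteq> {} \<Longrightarrow> \<tau> \<in> K"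
  using assms unfolding abstract_complex_def by blast+

lemma mem_all_faces: "\<tau> \<in> all_faces \<sigma> \<longleftrightarrow> \<tau> \<subseteq> \<sigma> \<and> \<tau> \<noteq> {}"
  by (simp add: all_faces_def)

lemma mem_simplex_boundary: "\<tau> \<in> simplex_boundary V \<longleftrightarrow> \<tau> \<subset> V \<and> \<tau> \<noteq> {}"
  by (auto simp: simplex_boundary_def all_faces_def)

lemma all_faces_subset_complex: "abstract_complex K \<Longrightarrow> \<sigma> \<in> K \<Longrightarrow> all_faces \<sigma> \<subseteq> K"
  by (auto simp: mem_all_faces abstract_complexD(3))

lemma all_faces_mono: "\<tau> \<subseteq> \<sigma> \<Longrightarrow> all_faces \<tau> \<subseteq> all_faces \<sigma>"
  by (auto simp: all_faces_def)

lemma abstract_complex_all_faces: "finite \<sigma> \<Longrightarrow> abstract_complex (all_faces \<sigma>)"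
  by (rule abstract_complexI) (auto simp: mem_all_faces finite_subset)

lemma abstract_complex_simplex_boundary: "finite V \<Longrightarrow> abstract_complex (simplex_boundary V)"
  by (rule abstract_complexI) (auto simp: mem_simplex_boundary finite_subset psubset_imp_subset)

lemma abstract_complex_Union:
  assumes "\<And>L. L \<in> \<L> \<Longrightarrow> abstract_complex L"
  shows "abstract_complex (\<Union>\<L>)"
proof (rule abstract_complexI)
  fix \<sigma> assume "\<sigma> \<in> \<Union>\<L>"
  then obtain L where L: "L \<in> \<L>" "\<sigma> \<in> L"
    by blast
  note \<sigma>D = abstract_complexD[OF assms[OF L(1)] L(2)]
  show "finite \<sigma>" "\<sigma> \<noteq> {}"
    using \<sigma>D(1,2) .
  show "\<tau> \<in> \<Union>\<L>" if "\<tau> \<subseteq> \<sigma>" "\<tau> \<noteq> {}" for \<tau>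
    using \<sigma>D(3)[OF that] L(1) by blast
qed

lemma abstract_complex_Un: "abstract_complex A \<Longrightarrow> abstract_complex B \<Longrightarrow> abstract_complex (A \<union> B)"
  using abstract_complex_Union[of "{A, B}"] by auto

lemma abstract_complex_filter:
  assumes "abstract_complex K" "\<And>\<sigma> \<tau>. \<sigma> \<in> K \<Longrightarrow> P \<sigma> \<Longrightarrow> \<tau> \<subseteq> \<sigma> \<Longrightarrow> \<tau> \<noteq> {} \<Longrightarrow> P \<tau>"
  shows "abstract_complex {\<sigma> \<in> K. P \<sigma>}"
proof (rule abstract_complexI)
  fix \<sigma> assume \<sigma>: "\<sigma> \<in> {\<sigma> \<in> K. P \<sigma>}"
  then have "\<sigma> \<in> K"
    by simp
  note \<sigma>D = abstract_complexD[OF assms(1) this]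
  show "finite \<sigma>" "\<sigma> \<noteq> {}"
    using \<sigma>D(1,2) .
  show "\<tau> \<in> {\<sigma> \<in> K. P \<sigma>}" if "\<tau> \<subseteq> \<sigma>" "\<tau> \<noteq> {}" for \<tau>
    using \<sigma>D(3)[OF that] assms(2)[OF _ _ that] \<sigma> by simp
qed

lemma abstract_complex_Int:
  assumes "abstract_complex A" "abstract_complex B"
  shows "abstract_complex (A \<inter> B)"
  using abstract_complex_filter[OF assms(1), of "\<lambda>\<sigma>. \<sigma> \<in> B"] abstract_complexD(3)[OF assms(2)]
  by (simp add: Int_def)

subsection \<open>Closed simplices\<close>

abbreviation simplex_space :: "'a set \<Rightarrow> ('a \<Rightarrow> real) topology" where
  "simplex_space \<sigma> \<equiv> subtopology (powertop_real UNIV) (closed_simplex \<sigma>)"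

abbreviation support :: "('a \<Rightarrow> real) \<Rightarrow> 'a set" where
  "support \<alpha> \<equiv> {v. \<alpha> v \<noteq> 0}"

abbreviation vertex :: "'a \<Rightarrow> 'a \<Rightarrow> real" where
  "vertex v \<equiv> indicator {v}"

lemma closed_simplexD:
  assumes "\<alpha> \<in> closed_simplex \<sigma>"
  shows "0 \<le> \<alpha> v" "v \<notin> \<sigma> \<Longrightarrow> \<alpha> v = 0" "sum \<alpha> \<sigma> = 1"
  using assms by (auto simp: closed_simplex_def)

lemma closed_simplex_mono:
  assumes "finite \<sigma>" "\<tau> \<subseteq> \<sigma>"
  shows "closed_simplex \<tau> \<subseteq> closed_simplex \<sigma>"
proof
  fix \<alpha> assume \<alpha>: "\<alpha> \<in> closed_simplex \<tau>"
  then have "sum \<alpha> \<tau> = sum \<alpha> \<sigma>"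
    using assms by (intro sum.mono_neutral_left) (auto simp: closed_simplex_def)
  then show "\<alpha> \<in> closed_simplex \<sigma>"
    using \<alpha> assms by (auto simp: closed_simplex_def)
qed

lemma closed_simplex_restrict:
  assumes "finite \<sigma>" "\<alpha> \<in> closed_simplex \<sigma>" "support \<alpha> \<subseteq> \<tau>" "\<tau> \<subseteq> \<sigma>"
  shows "\<alpha> \<in> closed_simplex \<tau>"
proof -
  have "sum \<alpha> \<tau> = sum \<alpha> \<sigma>"
    using assms by (intro sum.mono_neutral_left) auto
  then show ?thesis
    using assms by (auto simp: closed_simplex_def)
qed

lemma closed_simplex_support:
  assumes "finite \<sigma>" "\<alpha> \<in> closed_simplex \<sigma>"
  shows "support \<alpha> \<subseteq> \<sigma>" "support \<alpha> \<noteq> {}" "\<alpha> \<in> closed_simplex (support \<alpha>)"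
proof -
  show sub: "support \<alpha> \<subseteq> \<sigma>"
    using closed_simplexD(2)[OF assms(2)] by blast
  show simplex: "\<alpha> \<in> closed_simplex (support \<alpha>)"
    by (rule closed_simplex_restrict[OF assms order_refl sub])
  show "support \<alpha> \<noteq> {}"
    using closed_simplexD(3)[OF simplex] by (metis sum.empty zero_neq_one)
qed

lemma vertex_in_closed_simplex: "finite \<sigma> \<Longrightarrow> v \<in> \<sigma> \<Longrightarrow> vertex v \<in> closed_simplex \<sigma>"
  by (auto simp: closed_simplex_def indicator_def)

lemma closed_simplex_convex:
  assumes "\<alpha> \<in> closed_simplex \<sigma>" "\<beta> \<in> closed_simplex \<sigma>" "0 \<le> t" "t \<le> 1"
  shows "(\<lambda>v. (1 - t) * \<alpha> v + t * \<beta> v) \<in> closed_simplex \<sigma>"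
proof -
  have "(\<Sum>v\<in>\<sigma>. (1 - t) * \<alpha> v + t * \<beta> v) = (1 - t) * sum \<alpha> \<sigma> + t * sum \<beta> \<sigma>"
    by (simp add: sum.distrib sum_distrib_left)
  then show ?thesis
    using assms by (simp add: closed_simplex_def)
qed

lemma continuous_map_simplex_coord:
  assumes "continuous_map X (simplex_space \<sigma>) f"
  shows "continuous_map X euclideanreal (\<lambda>x. f x v)"
proof -
  have "continuous_map (simplex_space \<sigma>) euclideanreal (\<lambda>\<alpha>. \<alpha> v)"
    by (intro continuous_map_from_subtopology continuous_map_product_projection) auto
  then show ?thesis
    using continuous_map_compose[OF assms] by (simp add: o_def)
qed

lemma continuous_map_into_simplex_space:
  "continuous_map X (simplex_space \<sigma>) f \<longleftrightarrow>
     (\<forall>v. continuous_map X euclideanreal (\<lambda>x. f x v)) \<and> f \<in> topspace X \<rightarrow> closed_simplex \<sigma>"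
  by (auto simp: continuous_map_in_subtopology continuous_map_componentwise_UNIV)

lemma closedin_closed_simplex:
  assumes "finite \<sigma>"
  shows "closedin (powertop_real UNIV) (closed_simplex \<sigma>)"
proof -
  have proj: "continuous_map (powertop_real UNIV) euclideanreal (\<lambda>x. x v)" for v :: 'a
    by (rule continuous_map_product_projection) simp
  have coord: "closedin (powertop_real UNIV) {x. x v \<in> C}" if "closed C" for v :: 'a and C
    using closedin_continuous_map_preimage[OF proj] that by fastforce
  have "continuous_map (powertop_real UNIV) euclideanreal (\<lambda>x. sum x \<sigma>)"
    by (intro continuous_map_sum assms proj)
  then have "closedin (powertop_real UNIV) {x. sum x \<sigma> \<in> {1}}"
    using closedin_continuous_map_preimage[of "powertop_real UNIV" euclideanreal "\<lambda>x. sum x \<sigma>" "{1}"] by simp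
  moreover have "closedin (powertop_real UNIV) (\<Inter>v. {x. x v \<in> (if v \<in> \<sigma> then {0..} else {0})})"
    by (intro closedin_INT coord) auto
  moreover have "closed_simplex \<sigma> = (\<Inter>v. {x. x v \<in> (if v \<in> \<sigma> then {0..} else {0})}) \<inter> {x. sum x \<sigma> \<in> {1}}"
    by (fastforce simp: closed_simplex_def split: if_splits)
  ultimately show ?thesis
    by (simp add: closedin_Int)
qed

subsection \<open>The weak topology\<close>

lemma realization_set_eq:
  assumes "abstract_complex K"
  shows "realization_set K = (\<Union>\<sigma>\<in>K. closed_simplex \<sigma>)"
proof
  show "realization_set K \<subseteq> (\<Union>\<sigma>\<in>K. closed_simplex \<sigma>)"
    by (force simp: realization_set_def closed_simplex_def)
  show "(\<Union>\<sigma>\<in>K. closed_simplex \<sigma>) \<subseteq> realization_set K"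
  proof clarify
    fix \<sigma> \<alpha> assume \<sigma>: "\<sigma> \<in> K" and \<alpha>: "\<alpha> \<in> closed_simplex \<sigma>"
    note \<sigma>D = abstract_complexD[OF assms \<sigma>]
    note supp = closed_simplex_support[OF \<sigma>D(1) \<alpha>]
    show "\<alpha> \<in> realization_set K"
      using closed_simplexD(1,3)[OF supp(3)] \<sigma>D(3)[OF supp(1,2)] finite_subset[OF supp(1) \<sigma>D(1)]
      by (simp add: realization_set_def)
  qed
qed

lemma openin_realization:
  "openin (realization K) U \<longleftrightarrow> U \<subseteq> realization_set K \<and>
      (\<forall>\<sigma>\<in>K. openin (simplex_space \<sigma>) (U \<inter> closed_simplex \<sigma>))"
proof -
  have Int: "S \<inter> T \<inter> closed_simplex \<sigma> = (S \<inter> closed_simplex \<sigma>) \<inter> (T \<inter> closed_simplex \<sigma>)" for S T and \<sigma> :: "'a set"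
    by auto
  have Union: "\<Union>\<K> \<inter> closed_simplex \<sigma> = (\<Union>U\<in>\<K>. U \<inter> closed_simplex \<sigma>)" for \<K> and \<sigma> :: "'a set"
    by auto
  have "istopology (\<lambda>U. U \<subseteq> realization_set K \<and>
      (\<forall>\<sigma>\<in>K. openin (simplex_space \<sigma>) (U \<inter> closed_simplex \<sigma>)))"
    unfolding istopology_def Int Union by blast
  then show ?thesis
    by (simp add: realization_def)
qed

lemma topspace_realization:
  assumes "abstract_complex K"
  shows "topspace (realization K) = realization_set K"
proof -
  have "realization_set K \<inter> closed_simplex \<sigma> = topspace (simplex_space \<sigma>)" if "\<sigma> \<in> K" for \<sigma>
    using that realization_set_eq[OF assms] by auto
  then have "openin (realization K) (realization_set K)"
    unfolding openin_realization by (metis openin_topspace order_refl)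
  then show ?thesis
    by (meson openin_realization openin_subset openin_topspace subset_antisym)
qed

lemma simplex_subset_realization:
  assumes "abstract_complex K" "\<sigma> \<in> K"
  shows "closed_simplex \<sigma> \<subseteq> topspace (realization K)"
  using assms topspace_realization realization_set_eq by blast

lemma continuous_map_from_realization:
  assumes K: "abstract_complex K"
  shows "continuous_map (realization K) Y f \<longleftrightarrow> (\<forall>\<sigma>\<in>K. continuous_map (simplex_space \<sigma>) Y f)"
proof -
  have topK: "topspace (realization K) = (\<Union>\<sigma>\<in>K. closed_simplex \<sigma>)"
    using topspace_realization[OF K] realization_set_eq[OF K] by simp
  have "{x \<in> topspace (realization K). f x \<in> U} \<inter> closed_simplex \<sigma> =
      {x \<in> topspace (simplex_space \<sigma>). f x \<in> U}" if "\<sigma> \<in> K" for U \<sigma>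
    using that by (auto simp: topK)
  then have open_iff: "openin (realization K) {x \<in> topspace (realization K). f x \<in> U} \<longleftrightarrow>
      (\<forall>\<sigma>\<in>K. openin (simplex_space \<sigma>) {x \<in> topspace (simplex_space \<sigma>). f x \<in> U})" for U
    unfolding openin_realization using topspace_realization[OF K] by auto
  have range_iff: "f \<in> topspace (realization K) \<rightarrow> topspace Y \<longleftrightarrow>
      (\<forall>\<sigma>\<in>K. f \<in> topspace (simplex_space \<sigma>) \<rightarrow> topspace Y)"
    by (auto simp: topK)
  show ?thesis
    unfolding continuous_map_def range_iff open_iff by auto
qed

lemma continuous_map_simplex_realization:
  assumes "abstract_complex K" "\<sigma> \<in> K"
  shows "continuous_map (simplex_space \<sigma>) (realization K) (\<lambda>x. x)"
  using continuous_map_from_realization[OF assms(1), of "realization K" "\<lambda>x. x"] assms(2)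
  by (simp add: continuous_map_id[unfolded id_def])

lemma continuous_map_realization_mono:
  assumes "abstract_complex L" "abstract_complex K" "L \<subseteq> K" "continuous_map X (realization L) f"
  shows "continuous_map X (realization K) f"
proof -
  have "continuous_map (realization L) (realization K) (\<lambda>x. x)"
    using assms continuous_map_simplex_realization by (auto simp: continuous_map_from_realization)
  then show ?thesis
    using continuous_map_compose[OF assms(4)] by (simp add: o_def)
qed

lemma realization_nonempty:
  assumes "abstract_complex L" "L \<noteq> {}"
  shows "topspace (realization L) \<noteq> {}"
proof -
  obtain \<sigma> v where "\<sigma> \<in> L" "v \<in> \<sigma>" "finite \<sigma>"
    using assms by (metis abstract_complexD(1,2) all_not_in_conv)
  then have "vertex v \<in> topspace (realization L)"
    using vertex_in_closed_simplex simplex_subset_realization[OF assms(1)] by (meson subsetD)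
  then show ?thesis
    by blast
qed

lemma realization_finite:
  assumes K: "abstract_complex K" and fin: "finite K"
  shows "realization K = subtopology (powertop_real UNIV) (realization_set K)"
proof -
  note set_eq = realization_set_eq[OF K]
  have "continuous_map (subtopology (powertop_real UNIV) (realization_set K)) (realization K) (\<lambda>x. x)"
  proof (rule pasting_lemma_closed[OF fin, of _ closed_simplex _ "\<lambda>_ x. x"])
    fix \<sigma> assume \<sigma>: "\<sigma> \<in> K"
    then have sub: "closed_simplex \<sigma> \<subseteq> realization_set K"
      using set_eq by blast
    show "closedin (subtopology (powertop_real UNIV) (realization_set K)) (closed_simplex \<sigma>)"
      using closedin_closed_simplex[OF abstract_complexD(1)[OF K \<sigma>]] sub by (simp add: closedin_subset_topspace)
    show "continuous_map (subtopology (subtopology (powertop_real UNIV) (realization_set K)) (closed_simplex \<sigma>))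
        (realization K) (\<lambda>x. x)"
      using continuous_map_simplex_realization[OF K \<sigma>] sub by (simp add: subtopology_subtopology Int_absorb1)
  qed (auto simp: set_eq)
  moreover have "continuous_map (realization K) (subtopology (powertop_real UNIV) (realization_set K)) (\<lambda>x. x)"
    unfolding continuous_map_from_realization[OF K] using set_eq
    by (auto simp: continuous_map_in_subtopology
      intro: continuous_map_from_subtopology continuous_map_id[unfolded id_def])
  ultimately have "homeomorphic_maps (subtopology (powertop_real UNIV) (realization_set K)) (realization K) id id"
    by (simp add: homeomorphic_maps_def id_def)
  then show ?thesis
    by (simp add: homeomorphic_maps_id)
qed

subsection \<open>Homotopies on realizations\<close>

lemma continuous_map_from_sum_component:
  assumes "i \<in> I"
  shows "continuous_map (subtopology (sum_topology X I) ({i} \<times> UNIV)) (X i) snd"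
  unfolding continuous_map_def
proof (intro conjI allI impI)
  let ?X\<^sub>i = "subtopology (sum_topology X I) ({i} \<times> UNIV)"
  show "snd \<in> topspace ?X\<^sub>i \<rightarrow> topspace (X i)"
    by auto
  fix U assume U: "openin (X i) U"
  have "{x. (j, x) \<in> {i} \<times> U} = (if j = i then U else {})" for j
    by auto
  then have "openin (sum_topology X I) ({i} \<times> U)"
    using openin_subset[OF U] U assms unfolding openin_sum_topology by auto
  moreover have "{x \<in> topspace ?X\<^sub>i. snd x \<in> U} = ({i} \<times> U) \<inter> ({i} \<times> UNIV)"
    using openin_subset[OF U] assms by auto
  ultimately show "openin ?X\<^sub>i {x \<in> topspace ?X\<^sub>i. snd x \<in> U}"
    unfolding openin_subtopology by blast
qed

lemma continuous_map_from_prod_sum: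
  assumes h: "\<And>i. i \<in> I \<Longrightarrow> continuous_map (prod_topology Z (X i)) Y (\<lambda>(z,x). h (z,(i,x)))"
  shows "continuous_map (prod_topology Z (sum_topology X I)) Y h"
proof (rule pasting_lemma[where I = I and T = "\<lambda>i. topspace Z \<times> ({i} \<times> topspace (X i))" and f = "\<lambda>_. h"])
  let ?S = "sum_topology X I"
  fix i assume i: "i \<in> I"
  have "Pair i ` topspace (X i) = {i} \<times> topspace (X i)"
    by auto
  moreover have "openin ?S (Pair i ` topspace (X i))"
    using open_map_component_injection[OF i, of X] by (simp add: open_map_def)
  ultimately show "openin (prod_topology Z ?S) (topspace Z \<times> ({i} \<times> topspace (X i)))"
    by (simp add: openin_prod_Times_iff)
  let ?ZX = "subtopology (prod_topology Z ?S) (topspace Z \<times> ({i} \<times> topspace (X i)))"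
  have "continuous_map ?ZX (subtopology ?S ({i} \<times> UNIV)) snd"
    by (auto simp: continuous_map_in_subtopology continuous_map_from_subtopology continuous_map_snd)
  from continuous_map_compose[OF this continuous_map_from_sum_component[OF i]]
  have "continuous_map ?ZX (prod_topology Z (X i)) (\<lambda>q. (fst q, snd (snd q)))"
    by (simp add: continuous_map_pairedI continuous_map_from_subtopology continuous_map_fst o_def)
  from continuous_map_compose[OF this h[OF i]] show "continuous_map ?ZX Y h"
    by (rule continuous_map_eq) auto
qed auto

lemma continuous_map_from_sum:
  assumes "\<And>i. i \<in> I \<Longrightarrow> continuous_map (X i) Y (\<lambda>x. h (i,x))"
  shows "continuous_map (sum_topology X I) Y h"
proof -
  let ?pt = "discrete_topology {()}"
  have "continuous_map (prod_topology ?pt (X i)) Y ((\<lambda>x. h (i,x)) \<circ> snd)" if "i \<in> I" for i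
    by (rule continuous_map_compose[OF continuous_map_snd assms[OF that]])
  then have "continuous_map (prod_topology ?pt (sum_topology X I)) Y (h \<circ> snd)"
    by (intro continuous_map_from_prod_sum) (simp add: o_def case_prod_unfold)
  moreover have "continuous_map (sum_topology X I) (prod_topology ?pt (sum_topology X I)) (\<lambda>p. ((), p))"
    by (intro continuous_map_pairedI continuous_map_id[unfolded id_def]) simp
  ultimately have "continuous_map (sum_topology X I) Y ((h \<circ> snd) \<circ> (\<lambda>p. ((), p)))"
    using continuous_map_compose by blast
  then show ?thesis
    by (simp add: o_def)
qed

abbreviation unit_interval :: "real topology" where
  "unit_interval \<equiv> top_of_set {0..1}"

abbreviation prism :: "'a set \<Rightarrow> (real \<times> ('a \<Rightarrow> real)) topology" where
  "prism \<sigma> \<equiv> prod_topology unit_interval (simplex_space \<sigma>)"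

lemma quotient_map_prod_unit_interval:
  assumes "quotient_map X Y q"
  shows "quotient_map (prod_topology unit_interval X) (prod_topology unit_interval Y) (\<lambda>(t,x). (t, q x))"
  by (rule quotient_map_prod_right[OF _ _ assms])
    (auto intro!: compact_imp_locally_compact_space simp: compact_space_subtopology Hausdorff_space_subtopology)

lemma quotient_map_realization:
  assumes K: "abstract_complex K"
  shows "quotient_map (sum_topology simplex_space K) (realization K) snd"
  unfolding quotient_map_def
proof (intro conjI allI impI)
  let ?S = "sum_topology simplex_space K"
  show "snd ` topspace ?S = topspace (realization K)"
    by (force simp: topspace_realization[OF K] realization_set_eq[OF K])
  fix U assume U: "U \<subseteq> topspace (realization K)"
  have "{x. (\<sigma>, x) \<in> {x \<in> topspace ?S. snd x \<in> U}} = U \<inter> closed_simplex \<sigma>" if "\<sigma> \<in> K" for \<sigma>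
    using that by auto
  then have "openin ?S {x \<in> topspace ?S. snd x \<in> U} \<longleftrightarrow> (\<forall>\<sigma>\<in>K. openin (simplex_space \<sigma>) (U \<inter> closed_simplex \<sigma>))"
    unfolding openin_sum_topology by auto
  then show "openin ?S {x \<in> topspace ?S. snd x \<in> U} = openin (realization K) U"
    using U by (simp add: openin_realization topspace_realization[OF K])
qed

lemma homotopic_with_realizationI:
  assumes K: "abstract_complex K"
    and h: "\<And>\<sigma>. \<sigma> \<in> K \<Longrightarrow> continuous_map (prism \<sigma>) Y h"
    and h_0: "\<And>x. x \<in> topspace (realization K) \<Longrightarrow> h (0,x) = f x"
    and h_1: "\<And>x. x \<in> topspace (realization K) \<Longrightarrow> h (1,x) = g x"
  shows "homotopic_with (\<lambda>x. True) (realization K) Y f g"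
proof -
  have "continuous_map (prod_topology unit_interval (sum_topology simplex_space K)) Y (h \<circ> (\<lambda>(t,x). (t, snd x)))"
    using h by (intro continuous_map_from_prod_sum) (simp add: o_def case_prod_unfold)
  then have "continuous_map (prod_topology unit_interval (realization K)) Y h"
    by (rule continuous_compose_quotient_map[OF quotient_map_prod_unit_interval[OF quotient_map_realization[OF K]]])
  then have "homotopic_with (\<lambda>x. True) (realization K) Y (\<lambda>x. h (0,x)) (\<lambda>x. h (1,x))"
    unfolding homotopic_with_def by auto
  then show ?thesis
    by (rule homotopic_with_eq) (use h_0 h_1 in auto)
qed

lemma continuous_map_prism_coords:
  shows "continuous_map (prism \<sigma>) euclideanreal fst"
    and "continuous_map (prism \<sigma>) euclideanreal (\<lambda>x. snd x v)"
  using continuous_map_fst[of unit_interval "simplex_space \<sigma>"]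
    continuous_map_simplex_coord[OF continuous_map_snd, of unit_interval \<sigma>]
  by (simp_all add: continuous_map_in_subtopology)

section \<open>The carrier theorem\<close>

subsection \<open>Extension to a contractible space\<close>

text \<open>The part of the definition of a neighbourhood deformation retract that suffices to extend
  maps into contractible spaces.\<close>

definition collared :: "'a topology \<Rightarrow> 'a set \<Rightarrow> bool" where
  "collared T B \<longleftrightarrow> (\<exists>u r. continuous_map T euclideanreal u \<and>
     continuous_map (subtopology T {x. u x < 1}) (subtopology T B) r \<and>
     (\<forall>x \<in> topspace T \<inter> B. u x = 0 \<and> r x = x))"

lemma contractible_space_contraction:
  assumes "contractible_space Z" "topspace Z \<noteq> {}"
  obtains k z where "z \<in> topspace Z" "continuous_map (prod_topology unit_interval Z) Z k"
    "\<And>x. x \<in> topspace Z \<Longrightarrow> k (0,x) = x" "\<And>x. x \<in> topspace Z \<Longrightarrow> k (1,x) = z"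
proof -
  obtain z where z: "z \<in> topspace Z"
    using assms(2) by blast
  then have "homotopic_with (\<lambda>x. True) Z Z id (\<lambda>x. z)"
    using assms(1) by (simp add: contractible_space_alt)
  then show ?thesis
    using that[OF z] by (auto simp: homotopic_with)
qed

lemma continuous_map_extend_by_constant:
  fixes u :: "'a \<Rightarrow> real"
  assumes u: "continuous_map X euclideanreal u"
    and f: "continuous_map (subtopology X {x \<in> topspace X. u x \<le> c}) Y f"
    and y: "y \<in> topspace Y" "\<And>x. x \<in> topspace X \<Longrightarrow> u x = c \<Longrightarrow> f x = y"
  shows "continuous_map X Y (\<lambda>x. if u x \<le> c then f x else y)"
proof -
  have "continuous_map X Y (\<lambda>x. if u x \<in> {..c} then f x else y)"
    using assms by (intro continuous_map_cases_function[OF u]) (auto simp: frontier_def)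
  then show ?thesis
    by simp
qed

lemma extension_to_contractible:
  assumes T: "collared T B" and Z: "contractible_space Z" "topspace Z \<noteq> {}"
    and h: "continuous_map (subtopology T B) Z h"
  obtains H where "continuous_map T Z H" "\<And>x. x \<in> topspace T \<inter> B \<Longrightarrow> H x = h x"
proof -
  obtain u r where u: "continuous_map T euclideanreal u"
    and r: "continuous_map (subtopology T {x. u x < 1}) (subtopology T B) r"
    and ur: "\<And>x. x \<in> topspace T \<inter> B \<Longrightarrow> u x = 0 \<and> r x = x"
    using T unfolding collared_def by blast
  obtain k z where z: "z \<in> topspace Z" and k: "continuous_map (prod_topology unit_interval Z) Z k"
    and k_0: "\<And>x. x \<in> topspace Z \<Longrightarrow> k (0,x) = x" and k_1: "\<And>x. x \<in> topspace Z \<Longrightarrow> k (1,x) = z"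
    using contractible_space_contraction[OF Z] by metis
  define cone where "cone = (\<lambda>x. k (max 0 (2 * u x), h (r x)))"
  define near where "near = subtopology T {x \<in> topspace T. u x \<le> 1/2}"
  have r_near: "continuous_map near (subtopology T B) r"
    unfolding near_def by (rule continuous_map_from_subtopology_mono[OF r]) auto
  have hr: "continuous_map near Z (h \<circ> r)"
    by (rule continuous_map_compose[OF r_near h])
  have "continuous_map near euclideanreal (\<lambda>x. max 0 (2 * u x))"
    unfolding near_def by (intro continuous_intros continuous_map_from_subtopology u)
  then have "continuous_map near unit_interval (\<lambda>x. max 0 (2 * u x))"
    by (auto simp: continuous_map_in_subtopology near_def)
  from continuous_map_compose[OF continuous_map_pairedI[OF this hr] k]
  have cone: "continuous_map near Z cone"
    by (simp add: cone_def o_def)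
  have "cone x = z" if x: "x \<in> topspace T" "u x = 1/2" for x
  proof -
    have "h (r x) \<in> topspace Z"
      using hr x by (auto simp: continuous_map_def near_def)
    moreover have "max 0 (2 * u x) = 1"
      using x by simp
    ultimately show ?thesis
      by (simp only: cone_def k_1)
  qed
  then have "continuous_map T Z (\<lambda>x. if u x \<le> 1/2 then cone x else z)"
    using cone z by (intro continuous_map_extend_by_constant[OF u]) (simp_all add: near_def)
  moreover have "h x \<in> topspace Z" if "x \<in> topspace T \<inter> B" for x
    using h that by (auto simp: continuous_map_def)
  ultimately show ?thesis
    using that[of "\<lambda>x. if u x \<le> 1/2 then cone x else z"] ur k_0 by (simp add: cone_def)
qed

subsection \<open>Collars of simplices and prisms\<close>

text \<open>The depth is \<open>0\<close> on the boundary and \<open>1\<close> at the barycentre; dilating by \<open>1 / (1 - depth)\<close>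
  about the barycentre is the radial projection to the boundary.\<close>

definition depth :: "'a set \<Rightarrow> ('a \<Rightarrow> real) \<Rightarrow> real" where
  "depth \<sigma> \<alpha> = real (card \<sigma>) * Min (\<alpha> ` \<sigma>)"

definition dilate :: "'a set \<Rightarrow> real \<Rightarrow> ('a \<Rightarrow> real) \<Rightarrow> 'a \<Rightarrow> real" where
  "dilate \<sigma> g \<alpha> v = (if v \<in> \<sigma> then 1 / real (card \<sigma>) + (\<alpha> v - 1 / real (card \<sigma>)) / g else 0)"

lemma continuous_map_Min:
  fixes f :: "'a \<Rightarrow> 'b \<Rightarrow> real"
  assumes "finite I" "I \<noteq> {}" "\<And>i. i \<in> I \<Longrightarrow> continuous_map X euclideanreal (\<lambda>x. f x i)"
  shows "continuous_map X euclideanreal (\<lambda>x. Min (f x ` I))"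
  using continuous_map_Inf[OF assms(1,3)] assms(1,2) by (simp add: cInf_eq_Min)

context
  fixes \<sigma> :: "'a set"
  assumes \<sigma>: "finite \<sigma>" "\<sigma> \<noteq> {}"
begin

lemma depth_le: "v \<in> \<sigma> \<Longrightarrow> depth \<sigma> \<alpha> \<le> real (card \<sigma>) * \<alpha> v"
  unfolding depth_def using \<sigma> by (intro mult_left_mono) auto

lemma depth_nonneg: "\<alpha> \<in> closed_simplex \<sigma> \<Longrightarrow> 0 \<le> depth \<sigma> \<alpha>"
  using \<sigma> by (simp add: depth_def closed_simplexD(1))

lemma depth_eq_0:
  assumes "\<alpha> \<in> closed_simplex \<sigma>" "v \<in> \<sigma>" "\<alpha> v = 0"
  shows "depth \<sigma> \<alpha> = 0"
  using depth_le[OF assms(2), of \<alpha>] depth_nonneg[OF assms(1)] assms(3) by simp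

lemma dilate_in_closed_simplex:
  assumes \<alpha>: "\<alpha> \<in> closed_simplex \<sigma>" and g: "0 < g" "1 - depth \<sigma> \<alpha> \<le> g"
  shows "dilate \<sigma> g \<alpha> \<in> closed_simplex \<sigma>"
proof -
  have n: "0 < real (card \<sigma>)"
    using \<sigma> by (simp add: card_gt_0_iff)
  have "0 \<le> dilate \<sigma> g \<alpha> v" for v
  proof (cases "v \<in> \<sigma>")
    case True
    then have "1 - real (card \<sigma>) * \<alpha> v \<le> g"
      using depth_le[OF True, of \<alpha>] g(2) by linarith
    moreover have "dilate \<sigma> g \<alpha> v = (g - (1 - real (card \<sigma>) * \<alpha> v)) / (g * real (card \<sigma>))"
      using True g n by (simp add: dilate_def field_simps)
    ultimately show ?thesis
      using g n by simp
  qed (simp add: dilate_def)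
  moreover have "sum (dilate \<sigma> g \<alpha>) \<sigma> = (\<Sum>v\<in>\<sigma>. 1 / real (card \<sigma>)) + (sum \<alpha> \<sigma> - (\<Sum>v\<in>\<sigma>. 1 / real (card \<sigma>))) / g"
    by (simp add: dilate_def sum.distrib sum_subtractf flip: sum_divide_distrib)
  then have "sum (dilate \<sigma> g \<alpha>) \<sigma> = 1"
    using n closed_simplexD(3)[OF \<alpha>] by simp
  ultimately show ?thesis
    by (simp add: closed_simplex_def dilate_def)
qed

lemma dilate_reaches_boundary:
  assumes "depth \<sigma> \<alpha> < 1"
  shows "\<exists>v\<in>\<sigma>. dilate \<sigma> (1 - depth \<sigma> \<alpha>) \<alpha> v = 0"
proof -
  have "Min (\<alpha> ` \<sigma>) \<in> \<alpha> ` \<sigma>"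
    using \<sigma> by simp
  then obtain v where v: "v \<in> \<sigma>" "Min (\<alpha> ` \<sigma>) = \<alpha> v"
    by auto
  moreover have "0 < card \<sigma>"
    using \<sigma> by (simp add: card_gt_0_iff)
  ultimately have "dilate \<sigma> (1 - depth \<sigma> \<alpha>) \<alpha> v = 0"
    using assms by (simp add: dilate_def depth_def field_simps)
  then show ?thesis
    using v(1) by blast
qed

lemma dilate_1: "\<alpha> \<in> closed_simplex \<sigma> \<Longrightarrow> dilate \<sigma> 1 \<alpha> = \<alpha>"
  by (auto simp: dilate_def closed_simplexD(2))

lemma continuous_map_depth:
  assumes "\<And>v. continuous_map X euclideanreal (\<lambda>x. f x v)"
  shows "continuous_map X euclideanreal (\<lambda>x. depth \<sigma> (f x))"
  unfolding depth_def by (intro continuous_intros continuous_map_Min assms \<sigma>) simp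

lemma continuous_map_dilate:
  assumes "\<And>v. continuous_map X euclideanreal (\<lambda>x. f x v)" "continuous_map X euclideanreal g"
    and "\<And>x. x \<in> topspace X \<Longrightarrow> g x \<noteq> 0"
  shows "continuous_map X euclideanreal (\<lambda>x. dilate \<sigma> (g x) (f x) v)"
proof (cases "v \<in> \<sigma>")
  case True
  then show ?thesis
    using assms by (auto simp: dilate_def intro!: continuous_intros)
qed (simp add: dilate_def)

lemma collared_facets: "collared (prism \<sigma>) {x. \<exists>v\<in>\<sigma>. snd x v = 0}"
  unfolding collared_def
proof (intro exI conjI ballI)
  let ?u = "\<lambda>x::real \<times> ('a \<Rightarrow> real). depth \<sigma> (snd x)"
  let ?r = "\<lambda>x::real \<times> ('a \<Rightarrow> real). (fst x, dilate \<sigma> (1 - ?u x) (snd x))"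
  let ?X = "subtopology (prism \<sigma>) {x. ?u x < 1}"
  show u: "continuous_map (prism \<sigma>) euclideanreal ?u"
    by (intro continuous_map_depth continuous_map_prism_coords)
  have "continuous_map ?X (simplex_space \<sigma>) (\<lambda>x. dilate \<sigma> (1 - ?u x) (snd x))"
    unfolding continuous_map_into_simplex_space
    by (intro conjI allI continuous_map_dilate continuous_intros
        continuous_map_from_subtopology u continuous_map_prism_coords)
      (auto intro!: dilate_in_closed_simplex)
  then have "continuous_map ?X (prism \<sigma>) ?r"
    by (rule continuous_map_pairedI[OF continuous_map_from_subtopology[OF continuous_map_fst]])
  then show "continuous_map ?X (subtopology (prism \<sigma>) {x. \<exists>v\<in>\<sigma>. snd x v = 0}) ?r"
    using dilate_reaches_boundary by (auto simp: continuous_map_in_subtopology)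
  fix x assume "x \<in> topspace (prism \<sigma>) \<inter> {x. \<exists>v\<in>\<sigma>. snd x v = 0}"
  then obtain v where x: "snd x \<in> closed_simplex \<sigma>" "v \<in> \<sigma>" "snd x v = 0"
    by auto
  then show "?u x = 0" "?r x = x"
    using depth_eq_0[OF x] dilate_1[OF x(1)] by simp_all
qed

text \<open>The prism is a cone over its boundary with apex its centre; the parameter is \<open>1\<close> on the boundary.\<close>

definition cone_parameter :: "real \<times> ('a \<Rightarrow> real) \<Rightarrow> real" where
  "cone_parameter x = max \<bar>2 * fst x - 1\<bar> (1 - depth \<sigma> (snd x))"

definition prism_projection :: "real \<times> ('a \<Rightarrow> real) \<Rightarrow> real \<times> ('a \<Rightarrow> real)" where
  "prism_projection x = (1/2 + (fst x - 1/2) / cone_parameter x, dilate \<sigma> (cone_parameter x) (snd x))"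

lemma continuous_map_cone_parameter: "continuous_map (prism \<sigma>) euclideanreal cone_parameter"
  unfolding cone_parameter_def by (intro continuous_intros continuous_map_depth continuous_map_prism_coords)

lemma continuous_map_prism_projection:
  "continuous_map (subtopology (prism \<sigma>) {x. 0 < cone_parameter x}) (prism \<sigma>) prism_projection"
proof -
  let ?X = "subtopology (prism \<sigma>) {x. 0 < cone_parameter x}"
  have "continuous_map ?X euclideanreal (\<lambda>x. fst (prism_projection x))"
    unfolding prism_projection_def fst_conv
    by (intro continuous_intros continuous_map_from_subtopology continuous_map_cone_parameter
        continuous_map_prism_coords) auto
  moreover have "1/2 + (fst x - 1/2) / cone_parameter x \<in> {0..1}" if "0 < cone_parameter x" for x
  proof -
    have "\<bar>2 * fst x - 1\<bar> \<le> cone_parameter x"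
      by (simp add: cone_parameter_def)
    then show ?thesis
      using that by (auto simp: field_simps)
  qed
  ultimately have "continuous_map ?X unit_interval (\<lambda>x. fst (prism_projection x))"
    by (auto simp: continuous_map_in_subtopology prism_projection_def)
  moreover have "continuous_map ?X (simplex_space \<sigma>) (\<lambda>x. snd (prism_projection x))"
    unfolding continuous_map_into_simplex_space prism_projection_def snd_conv
    by (intro conjI allI continuous_map_dilate continuous_map_from_subtopology
        continuous_map_cone_parameter continuous_map_prism_coords)
      (auto simp: cone_parameter_def intro!: dilate_in_closed_simplex)
  ultimately have "continuous_map ?X (prism \<sigma>) (\<lambda>x. (fst (prism_projection x), snd (prism_projection x)))"
    by (rule continuous_map_pairedI)
  then show ?thesis
    by simp
qed

lemma prism_projection_reaches_boundary:
  assumes "0 < cone_parameter x"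
  shows "fst (prism_projection x) \<in> {0, 1} \<or> (\<exists>v\<in>\<sigma>. snd (prism_projection x) v = 0)"
proof -
  consider (ends) "cone_parameter x = \<bar>2 * fst x - 1\<bar>" | (sides) "cone_parameter x = 1 - depth \<sigma> (snd x)"
    unfolding cone_parameter_def by linarith
  then show ?thesis
  proof cases
    case ends
    then show ?thesis
      using assms by (auto simp: prism_projection_def abs_if field_simps)
  next
    case sides
    then show ?thesis
      using assms dilate_reaches_boundary[of "snd x"] by (auto simp: prism_projection_def)
  qed
qed

lemma collared_prism: "collared (prism \<sigma>) {x. fst x \<in> {0, 1} \<or> (\<exists>v\<in>\<sigma>. snd x v = 0)}"
  (is "collared _ ?B")
  unfolding collared_def
proof (intro exI conjI ballI)
  show "continuous_map (prism \<sigma>) euclideanreal (\<lambda>x. 1 - cone_parameter x)"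
    by (intro continuous_intros continuous_map_cone_parameter)
  show "continuous_map (subtopology (prism \<sigma>) {x. 1 - cone_parameter x < 1})
      (subtopology (prism \<sigma>) ?B) prism_projection"
    using continuous_map_prism_projection prism_projection_reaches_boundary
    by (auto simp: continuous_map_in_subtopology)
  fix x assume boundary: "x \<in> topspace (prism \<sigma>) \<inter> ?B"
  then have x: "0 \<le> fst x" "fst x \<le> 1" "snd x \<in> closed_simplex \<sigma>"
    by auto
  have "fst x \<in> {0, 1} \<or> depth \<sigma> (snd x) = 0"
    using boundary depth_eq_0[OF x(3)] by auto
  then have "cone_parameter x = 1"
    using x(1,2) depth_nonneg[OF x(3)] by (auto simp: cone_parameter_def)
  then show "1 - cone_parameter x = 0" "prism_projection x = x"
    using dilate_1[OF x(3)] by (simp_all add: prism_projection_def prod_eq_iff)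
qed

end

subsection \<open>Maps carried by contractible subcomplexes\<close>

definition contractible_complex :: "'a set set \<Rightarrow> bool" where
  "contractible_complex L \<longleftrightarrow> abstract_complex L \<and> L \<noteq> {} \<and> contractible_space (realization L)"

definition carried :: "'a set set \<Rightarrow> ('a set \<Rightarrow> 'b set set) \<Rightarrow> (('a \<Rightarrow> real) \<Rightarrow> ('b \<Rightarrow> real)) \<Rightarrow> bool" where
  "carried K \<Phi> f \<longleftrightarrow> (\<forall>\<sigma>\<in>K. continuous_map (simplex_space \<sigma>) (realization (\<Phi> \<sigma>)) f)"

locale contractible_carrier =
  fixes K :: "'a set set" and \<Phi> :: "'a set \<Rightarrow> 'b set set"
  assumes complex: "abstract_complex K"
    and contractible: "\<And>\<sigma>. \<sigma> \<in> K \<Longrightarrow> contractible_complex (\<Phi> \<sigma>)"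
    and mono: "\<And>\<sigma> \<tau>. \<sigma> \<in> K \<Longrightarrow> \<tau> \<in> K \<Longrightarrow> \<tau> \<subseteq> \<sigma> \<Longrightarrow> \<Phi> \<tau> \<subseteq> \<Phi> \<sigma>"

text \<open>A map prescribed on \<open>Q \<times> K\<close> is extended to the prisms over the simplices of \<open>K\<close>, skeleton by
  skeleton. Existence of carried maps is the case \<open>Q = {}\<close>, uniqueness up to homotopy the case
  \<open>Q = {0, 1}\<close>.\<close>

locale carrier_extension = contractible_carrier K \<Phi>
  for K :: "'a set set" and \<Phi> :: "'a set \<Rightarrow> 'b set set" +
  fixes Q :: "real set" and h :: "real \<times> ('a \<Rightarrow> real) \<Rightarrow> ('b \<Rightarrow> real)"
  assumes Q: "Q = {} \<or> Q = {0, 1}"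
    and carried: "\<And>t. t \<in> Q \<Longrightarrow> carried K \<Phi> (\<lambda>\<alpha>. h (t,\<alpha>))"
begin

definition prism_boundary :: "'a set \<Rightarrow> (real \<times> ('a \<Rightarrow> real)) set" where
  "prism_boundary \<sigma> = {x. fst x \<in> Q \<or> (\<exists>v\<in>\<sigma>. snd x v = 0)}"

definition extends_to_skeleton :: "nat \<Rightarrow> (real \<times> ('a \<Rightarrow> real) \<Rightarrow> ('b \<Rightarrow> real)) \<Rightarrow> bool" where
  "extends_to_skeleton n H \<longleftrightarrow> (\<forall>t\<in>Q. \<forall>\<alpha>. H (t,\<alpha>) = h (t,\<alpha>)) \<and>
     (\<forall>\<sigma>\<in>K. card \<sigma> \<le> n \<longrightarrow> continuous_map (prism \<sigma>) (realization (\<Phi> \<sigma>)) H)"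

lemma carrier_complex: "\<sigma> \<in> K \<Longrightarrow> abstract_complex (\<Phi> \<sigma>)"
  using contractible by (simp add: contractible_complex_def)

lemma collared_prism_boundary:
  assumes "\<sigma> \<in> K"
  shows "collared (prism \<sigma>) (prism_boundary \<sigma>)"
proof -
  note \<sigma> = abstract_complexD(1,2)[OF complex assms]
  show ?thesis
    using Q collared_facets[OF \<sigma>] collared_prism[OF \<sigma>] by (auto simp: prism_boundary_def)
qed

lemma continuous_on_base:
  assumes H: "extends_to_skeleton n H" and \<sigma>: "\<sigma> \<in> K" and t: "t \<in> Q"
  shows "continuous_map (subtopology (prism \<sigma>) {x. fst x = t}) (realization (\<Phi> \<sigma>)) H"
proof -
  have "continuous_map (prism \<sigma>) (realization (\<Phi> \<sigma>)) ((\<lambda>\<alpha>. h (t,\<alpha>)) \<circ> snd)"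
    using carried[OF t] \<sigma> by (intro continuous_map_compose[OF continuous_map_snd]) (simp add: carried_def)
  then have "continuous_map (subtopology (prism \<sigma>) {x. fst x = t}) (realization (\<Phi> \<sigma>)) ((\<lambda>\<alpha>. h (t,\<alpha>)) \<circ> snd)"
    by (rule continuous_map_from_subtopology)
  then show ?thesis
    by (rule continuous_map_eq) (use H t in \<open>auto simp: extends_to_skeleton_def\<close>)
qed

lemma continuous_on_facet:
  assumes H: "extends_to_skeleton n H" and \<sigma>: "\<sigma> \<in> K" "card \<sigma> = Suc n" and v: "v \<in> \<sigma>"
  shows "continuous_map (subtopology (prism \<sigma>) {x. snd x v = 0}) (realization (\<Phi> \<sigma>)) H"
proof -
  let ?X = "subtopology (prism \<sigma>) {x. snd x v = 0}"
  note \<sigma>D = abstract_complexD[OF complex \<sigma>(1)]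
  have facet: "snd x \<in> closed_simplex (\<sigma> - {v})" if "x \<in> topspace ?X" for x
  proof (rule closed_simplex_restrict[OF \<sigma>D(1)])
    show x: "snd x \<in> closed_simplex \<sigma>"
      using that by auto
    show "support (snd x) \<subseteq> \<sigma> - {v}"
      using closed_simplex_support(1)[OF \<sigma>D(1) x] that by auto
  qed auto
  show ?thesis
  proof (cases "\<sigma> - {v} = {}")
    case True
    have "x \<notin> topspace ?X" for x
    proof
      assume "x \<in> topspace ?X"
      from closed_simplexD(3)[OF facet[OF this]] show False
        by (simp add: True)
    qed
    then have "topspace ?X = {}"
      by blast
    then show ?thesis
      by (simp add: continuous_map_def)
  next
    case False
    then have face: "\<sigma> - {v} \<in> K"
      by (intro \<sigma>D(3)) auto
    have "continuous_map ?X (simplex_space (\<sigma> - {v})) snd"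
      unfolding continuous_map_into_simplex_space
      by (intro conjI allI continuous_map_from_subtopology continuous_map_prism_coords(2) Pi_I facet)
    then have "continuous_map ?X (prism (\<sigma> - {v})) (\<lambda>x. (fst x, snd x))"
      by (rule continuous_map_pairedI[OF continuous_map_from_subtopology[OF continuous_map_fst]])
    moreover have "continuous_map (prism (\<sigma> - {v})) (realization (\<Phi> (\<sigma> - {v}))) H"
      using H face v \<sigma> \<sigma>D(1) by (auto simp: extends_to_skeleton_def)
    ultimately have "continuous_map ?X (realization (\<Phi> (\<sigma> - {v}))) (H \<circ> (\<lambda>x. (fst x, snd x)))"
      by (rule continuous_map_compose)
    then show ?thesis
      using continuous_map_realization_mono[OF carrier_complex[OF face] carrier_complex[OF \<sigma>(1)] mono[OF \<sigma>(1) face]]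
      by (simp add: o_def)
  qed
qed

lemma continuous_on_prism_boundary:
  assumes H: "extends_to_skeleton n H" and \<sigma>: "\<sigma> \<in> K" "card \<sigma> = Suc n"
  shows "continuous_map (subtopology (prism \<sigma>) (prism_boundary \<sigma>)) (realization (\<Phi> \<sigma>)) H"
proof -
  let ?X = "subtopology (prism \<sigma>) (prism_boundary \<sigma>)"
  define pieces where "pieces = (\<lambda>t. {x :: real \<times> ('a \<Rightarrow> real). fst x = t}) ` Q \<union> (\<lambda>v. {x. snd x v = 0}) ` \<sigma>"
  have cont: "continuous_map (subtopology (prism \<sigma>) S) (realization (\<Phi> \<sigma>)) H" if "S \<in> pieces" for S
    using that continuous_on_base[OF H \<sigma>(1)] continuous_on_facet[OF H \<sigma>] by (auto simp: pieces_def)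
  have closed: "closedin (prism \<sigma>) (topspace (prism \<sigma>) \<inter> S)" if "S \<in> pieces" for S
  proof -
    have preimage: "closedin (prism \<sigma>) {x \<in> topspace (prism \<sigma>). f x \<in> {c}}"
      if "continuous_map (prism \<sigma>) euclideanreal f" for f c
      by (rule closedin_continuous_map_preimage[OF that]) simp
    show ?thesis
      using that preimage[OF continuous_map_prism_coords(1)] preimage[OF continuous_map_prism_coords(2)]
      by (auto simp: pieces_def Int_def)
  qed
  show ?thesis
  proof (rule pasting_lemma_closed[where I = pieces and T = "\<lambda>S. topspace ?X \<inter> S" and f = "\<lambda>_. H"])
    show "finite pieces"
      using Q abstract_complexD(1)[OF complex \<sigma>(1)] by (auto simp: pieces_def)
    fix S assume S: "S \<in> pieces"
    have "topspace ?X \<inter> S = prism_boundary \<sigma> \<inter> (topspace (prism \<sigma>) \<inter> S)"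
      by auto
    then show "closedin ?X (topspace ?X \<inter> S)"
      using closedin_subtopology_Int_closed[OF closed[OF S]] by simp
    show "continuous_map (subtopology ?X (topspace ?X \<inter> S)) (realization (\<Phi> \<sigma>)) H"
      unfolding subtopology_subtopology by (rule continuous_map_from_subtopology_mono[OF cont[OF S]]) auto
  qed (auto simp: pieces_def prism_boundary_def)
qed

lemma extension_over_prism:
  assumes H: "extends_to_skeleton n H" and \<sigma>: "\<sigma> \<in> K" "card \<sigma> = Suc n"
  obtains E where "continuous_map (prism \<sigma>) (realization (\<Phi> \<sigma>)) E"
    "\<And>x. x \<in> topspace (prism \<sigma>) \<inter> prism_boundary \<sigma> \<Longrightarrow> E x = H x"
proof (rule extension_to_contractible[OF collared_prism_boundary[OF \<sigma>(1)]])
  show "contractible_space (realization (\<Phi> \<sigma>))" "topspace (realization (\<Phi> \<sigma>)) \<noteq> {}"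
    using contractible[OF \<sigma>(1)] realization_nonempty[of "\<Phi> \<sigma>"] by (auto simp: contractible_complex_def)
  show "continuous_map (subtopology (prism \<sigma>) (prism_boundary \<sigma>)) (realization (\<Phi> \<sigma>)) H"
    by (rule continuous_on_prism_boundary[OF H \<sigma>])
qed (rule that)

lemma support_card_le:
  assumes "\<sigma> \<in> K" "\<alpha> \<in> closed_simplex \<sigma>"
  shows "card (support \<alpha>) \<le> card \<sigma>"
  using abstract_complexD(1)[OF complex assms(1)] closed_simplex_support(1)[OF _ assms(2)] by (simp add: card_mono)

lemma extension_to_next_skeleton:
  assumes H: "extends_to_skeleton n H"
  shows "\<exists>H'. extends_to_skeleton (Suc n) H' \<and> (\<forall>t \<alpha>. card (support \<alpha>) \<le> n \<longrightarrow> H' (t,\<alpha>) = H (t,\<alpha>))"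
proof -
  have "\<exists>E. \<forall>\<sigma>. \<sigma> \<in> K \<and> card \<sigma> = Suc n \<longrightarrow> continuous_map (prism \<sigma>) (realization (\<Phi> \<sigma>)) (E \<sigma>) \<and>
      (\<forall>x \<in> topspace (prism \<sigma>) \<inter> prism_boundary \<sigma>. E \<sigma> x = H x)"
    by (rule choice) (use extension_over_prism[OF H] in metis)
  then obtain E where E: "\<And>\<sigma>. \<sigma> \<in> K \<Longrightarrow> card \<sigma> = Suc n \<Longrightarrow> continuous_map (prism \<sigma>) (realization (\<Phi> \<sigma>)) (E \<sigma>)"
    and EH: "\<And>\<sigma> x. \<sigma> \<in> K \<Longrightarrow> card \<sigma> = Suc n \<Longrightarrow> x \<in> topspace (prism \<sigma>) \<inter> prism_boundary \<sigma> \<Longrightarrow> E \<sigma> x = H x"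
    by blast
  define H' where "H' = (\<lambda>(t,\<alpha>). if t \<in> Q \<or> card (support \<alpha>) \<le> n then H (t,\<alpha>) else E (support \<alpha>) (t,\<alpha>))"
  have "continuous_map (prism \<sigma>) (realization (\<Phi> \<sigma>)) H'" if \<sigma>: "\<sigma> \<in> K" "card \<sigma> \<le> Suc n" for \<sigma>
  proof (cases "card \<sigma> \<le> n")
    case True
    then have "continuous_map (prism \<sigma>) (realization (\<Phi> \<sigma>)) H"
      using H \<sigma>(1) by (simp add: extends_to_skeleton_def)
    then show ?thesis
      by (rule continuous_map_eq) (use support_card_le[OF \<sigma>(1)] True in \<open>force simp: H'_def\<close>)
  next
    case False
    then have card: "card \<sigma> = Suc n"
      using \<sigma>(2) by simp
    note fin = abstract_complexD(1)[OF complex \<sigma>(1)]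
    have "E \<sigma> (t,\<alpha>) = H' (t,\<alpha>)" if "t \<in> {0..1}" "\<alpha> \<in> closed_simplex \<sigma>" for t \<alpha>
    proof (cases "t \<in> Q \<or> card (support \<alpha>) \<le> n")
      case True
      then have "t \<in> Q \<or> \<not> \<sigma> \<subseteq> support \<alpha>"
        using card card_mono[of "support \<alpha>" \<sigma>] finite_subset[OF closed_simplex_support(1)[OF fin that(2)] fin] by auto
      then show ?thesis
        using True EH[OF \<sigma>(1) card, of "(t,\<alpha>)"] that by (auto simp: H'_def prism_boundary_def)
    next
      case False
      then have "support \<alpha> = \<sigma>"
        using closed_simplex_support(1)[OF fin that(2)] card fin by (intro card_seteq) auto
      then show ?thesis
        using False by (simp add: H'_def)
    qed
    then show ?thesis
      using continuous_map_eq[OF E[OF \<sigma>(1) card]] by auto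
  qed
  then have "extends_to_skeleton (Suc n) H'"
    using H by (simp add: extends_to_skeleton_def H'_def)
  then show ?thesis
    by (auto simp: H'_def)
qed

lemma extension_exists:
  obtains H where "\<And>\<sigma>. \<sigma> \<in> K \<Longrightarrow> continuous_map (prism \<sigma>) (realization (\<Phi> \<sigma>)) H"
    "\<And>t \<alpha>. t \<in> Q \<Longrightarrow> H (t,\<alpha>) = h (t,\<alpha>)"
proof -
  have "extends_to_skeleton 0 h"
    using abstract_complexD(1,2)[OF complex] by (auto simp: extends_to_skeleton_def)
  then have "\<exists>F. \<forall>n. extends_to_skeleton n (F n) \<and> (\<forall>t \<alpha>. card (support \<alpha>) \<le> n \<longrightarrow> F (Suc n) (t,\<alpha>) = F n (t,\<alpha>))"
    by (intro dependent_nat_choice) (use extension_to_next_skeleton in blast)+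
  then obtain F where F: "\<And>n. extends_to_skeleton n (F n)"
    and F_Suc: "\<And>n t \<alpha>. card (support \<alpha>) \<le> n \<Longrightarrow> F (Suc n) (t,\<alpha>) = F n (t,\<alpha>)"
    by blast
  define H where "H = (\<lambda>(t,\<alpha>). F (card (support \<alpha>)) (t,\<alpha>))"
  have F_eq_H: "F n (t,\<alpha>) = H (t,\<alpha>)" if "card (support \<alpha>) \<le> n" for n t \<alpha>
    using that by (induction rule: dec_induct) (simp_all add: F_Suc H_def)
  show ?thesis
  proof (rule that)
    fix \<sigma> assume \<sigma>: "\<sigma> \<in> K"
    then have "continuous_map (prism \<sigma>) (realization (\<Phi> \<sigma>)) (F (card \<sigma>))"
      using F by (simp add: extends_to_skeleton_def)
    then show "continuous_map (prism \<sigma>) (realization (\<Phi> \<sigma>)) H"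
      by (rule continuous_map_eq) (auto simp: F_eq_H support_card_le[OF \<sigma>])
  next
    show "H (t,\<alpha>) = h (t,\<alpha>)" if "t \<in> Q" for t \<alpha>
      using F[of "card (support \<alpha>)"] that by (simp add: H_def extends_to_skeleton_def)
  qed
qed

end

context contractible_carrier
begin

lemma carried_map_exists:
  obtains f where "carried K \<Phi> f"
proof -
  interpret carrier_extension K \<Phi> "{}" undefined
    by unfold_locales auto
  obtain H where H: "\<And>\<sigma>. \<sigma> \<in> K \<Longrightarrow> continuous_map (prism \<sigma>) (realization (\<Phi> \<sigma>)) H"
    using extension_exists by metis
  have "continuous_map (simplex_space \<sigma>) (prism \<sigma>) (\<lambda>\<alpha>. (0,\<alpha>))" for \<sigma> :: "'a set"
    by (intro continuous_map_pairedI continuous_map_id[unfolded id_def]) auto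
  from continuous_map_compose[OF this H] have "carried K \<Phi> (\<lambda>\<alpha>. H (0,\<alpha>))"
    by (simp add: carried_def o_def)
  then show ?thesis
    using that by blast
qed

lemma carried_maps_homotopic:
  assumes M: "abstract_complex M" "\<And>\<sigma>. \<sigma> \<in> K \<Longrightarrow> \<Phi> \<sigma> \<subseteq> M"
    and f: "carried K \<Phi> f" and g: "carried K \<Phi> g"
  shows "homotopic_with (\<lambda>x. True) (realization K) (realization M) f g"
proof -
  interpret carrier_extension K \<Phi> "{0, 1}" "\<lambda>(t,\<alpha>). if t = 0 then f \<alpha> else g \<alpha>"
    by unfold_locales (use f g in auto)
  obtain H where H: "\<And>\<sigma>. \<sigma> \<in> K \<Longrightarrow> continuous_map (prism \<sigma>) (realization (\<Phi> \<sigma>)) H"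
    and H_ends: "\<And>t \<alpha>. t \<in> {0, 1} \<Longrightarrow> H (t,\<alpha>) = (if t = 0 then f \<alpha> else g \<alpha>)"
    using extension_exists by auto
  show ?thesis
    by (rule homotopic_with_realizationI[OF complex continuous_map_realization_mono[OF carrier_complex M H]])
      (auto simp: H_ends)
qed

end

lemma carried_id:
  assumes "\<And>\<sigma>. \<sigma> \<in> K \<Longrightarrow> abstract_complex (\<Phi> \<sigma>)" "\<And>\<sigma>. \<sigma> \<in> K \<Longrightarrow> \<sigma> \<in> \<Phi> \<sigma>"
  shows "carried K \<Phi> (\<lambda>x. x)"
  using assms by (auto simp: carried_def intro: continuous_map_simplex_realization)

lemma carried_const:
  assumes "\<And>\<sigma>. \<sigma> \<in> K \<Longrightarrow> abstract_complex (\<Phi> \<sigma>)" "\<And>\<sigma>. \<sigma> \<in> K \<Longrightarrow> {v} \<in> \<Phi> \<sigma>"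
  shows "carried K \<Phi> (\<lambda>x. vertex v)"
  unfolding carried_def
proof
  fix \<sigma> assume \<sigma>: "\<sigma> \<in> K"
  have "vertex v \<in> topspace (realization (\<Phi> \<sigma>))"
    using simplex_subset_realization[OF assms[OF \<sigma>]] vertex_in_closed_simplex[of "{v}" v] by blast
  then show "continuous_map (simplex_space \<sigma>) (realization (\<Phi> \<sigma>)) (\<lambda>x. vertex v)"
    by simp
qed

lemma carried_mono:
  assumes "carried K \<Phi> f" "K' \<subseteq> K"
    and "\<And>\<sigma>. \<sigma> \<in> K' \<Longrightarrow> abstract_complex (\<Phi> \<sigma>) \<and> abstract_complex (\<Phi>' \<sigma>) \<and> \<Phi> \<sigma> \<subseteq> \<Phi>' \<sigma>"
  shows "carried K' \<Phi>' f"
  using assms continuous_map_realization_mono unfolding carried_def by blast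

lemma carried_imp_continuous_map:
  assumes "abstract_complex K" "abstract_complex M" "carried K \<Phi> f"
    and "\<And>\<sigma>. \<sigma> \<in> K \<Longrightarrow> abstract_complex (\<Phi> \<sigma>) \<and> \<Phi> \<sigma> \<subseteq> M"
  shows "continuous_map (realization K) (realization M) f"
  using carried_mono[OF assms(3) order_refl, of "\<lambda>_. M"] assms(2,4)
  by (simp add: continuous_map_from_realization[OF assms(1)] carried_def)

subsection \<open>Recognizing contractible complexes\<close>

lemma contractible_cone:
  assumes L: "abstract_complex L" "L \<noteq> {}" and cone: "\<And>\<sigma>. \<sigma> \<in> L \<Longrightarrow> insert v \<sigma> \<in> L"
  shows "contractible_complex L"
proof -
  define h where "h = (\<lambda>(t::real, \<alpha>) u. (1 - t) * \<alpha> u + t * vertex v u)"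
  have "homotopic_with (\<lambda>x. True) (realization L) (realization L) id (\<lambda>x. vertex v)"
  proof (rule homotopic_with_realizationI[OF L(1), of _ h])
    fix \<sigma> assume \<sigma>: "\<sigma> \<in> L"
    note coned = abstract_complexD(1)[OF L(1) cone[OF \<sigma>]]
    have "h x \<in> closed_simplex (insert v \<sigma>)" if "x \<in> topspace (prism \<sigma>)" for x
    proof -
      have "snd x \<in> closed_simplex (insert v \<sigma>)"
        using that subsetD[OF closed_simplex_mono[OF coned subset_insertI]] by auto
      then show ?thesis
        using that closed_simplex_convex[OF _ vertex_in_closed_simplex[OF coned, of v]]
        by (auto simp: h_def case_prod_unfold)
    qed
    moreover have "continuous_map (prism \<sigma>) euclideanreal (\<lambda>x. h x u)" for u
      unfolding h_def case_prod_unfold by (intro continuous_intros continuous_map_prism_coords)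
    ultimately have "continuous_map (prism \<sigma>) (simplex_space (insert v \<sigma>)) h"
      by (auto simp: continuous_map_into_simplex_space)
    from continuous_map_compose[OF this continuous_map_simplex_realization[OF L(1) cone[OF \<sigma>]]]
    show "continuous_map (prism \<sigma>) (realization L) h"
      by (simp add: o_def)
  qed (auto simp: h_def)
  then show ?thesis
    using L by (auto simp: contractible_complex_def contractible_space_def)
qed

lemma contractible_all_faces:
  assumes "finite \<sigma>" "\<sigma> \<noteq> {}"
  shows "contractible_complex (all_faces \<sigma>)"
proof -
  obtain v where "v \<in> \<sigma>"
    using assms by blast
  then show ?thesis
    using assms by (intro contractible_cone[of _ v] abstract_complex_all_faces) (auto simp: all_faces_def)
qed

lemma contractible_complex_if_self_carried:
  assumes "contractible_carrier K \<Phi>" "K \<noteq> {}"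
    and \<Phi>: "\<And>\<sigma>. \<sigma> \<in> K \<Longrightarrow> \<Phi> \<sigma> \<subseteq> K" "\<And>\<sigma>. \<sigma> \<in> K \<Longrightarrow> \<sigma> \<in> \<Phi> \<sigma>" "\<And>\<sigma>. \<sigma> \<in> K \<Longrightarrow> {v} \<in> \<Phi> \<sigma>"
  shows "contractible_complex K"
proof -
  interpret contractible_carrier K \<Phi>
    by fact
  have carrier_complex: "abstract_complex (\<Phi> \<sigma>)" if "\<sigma> \<in> K" for \<sigma>
    using contractible[OF that] by (simp add: contractible_complex_def)
  have "homotopic_with (\<lambda>x. True) (realization K) (realization K) (\<lambda>x. x) (\<lambda>x. vertex v)"
    by (intro carried_maps_homotopic carried_id carried_const carrier_complex \<Phi> complex)
  then show ?thesis
    using complex assms(2) by (auto simp: contractible_complex_def contractible_space_def id_def)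
qed

lemma contractible_union:
  assumes A: "contractible_complex A" and B: "contractible_complex B" and AB: "contractible_complex (A \<inter> B)"
  shows "contractible_complex (A \<union> B)"
proof -
  have complexes: "abstract_complex A" "abstract_complex B" "abstract_complex (A \<inter> B)" and "A \<inter> B \<noteq> {}"
    using A B AB by (simp_all add: contractible_complex_def)
  then obtain \<sigma> where \<sigma>: "\<sigma> \<in> A \<inter> B"
    by blast
  then obtain v where "v \<in> \<sigma>"
    using abstract_complexD(2)[OF complexes(3)] by blast
  then have v: "{v} \<in> A \<inter> B"
    by (intro abstract_complexD(3)[OF complexes(3) \<sigma>]) auto
  define \<Phi> where "\<Phi> \<sigma> = (if \<sigma> \<in> A \<inter> B then A \<inter> B else if \<sigma> \<in> A then A else B)" for \<sigma>
  have "contractible_carrier (A \<union> B) \<Phi>"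
  proof unfold_locales
    show "abstract_complex (A \<union> B)"
      by (rule abstract_complex_Un[OF complexes(1,2)])
    fix \<sigma> \<tau> assume \<sigma>: "\<sigma> \<in> A \<union> B" and \<tau>: "\<tau> \<in> A \<union> B" "\<tau> \<subseteq> \<sigma>"
    have "\<tau> \<noteq> {}"
      using \<tau>(1) abstract_complexD(2)[OF complexes(1)] abstract_complexD(2)[OF complexes(2)] by blast
    then show "\<Phi> \<tau> \<subseteq> \<Phi> \<sigma>"
      using \<sigma> \<tau> abstract_complexD(3)[OF complexes(1), of \<sigma> \<tau>] abstract_complexD(3)[OF complexes(2), of \<sigma> \<tau>]
      by (auto simp: \<Phi>_def)
  qed (use assms in \<open>simp add: \<Phi>_def\<close>)
  then show ?thesis
    by (rule contractible_complex_if_self_carried[where v = v]) (use v in \<open>auto simp: \<Phi>_def\<close>)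
qed

lemma contractible_union_all_faces:
  assumes L: "contractible_complex L" and F: "finite F" and z: "z \<in> F" "{z} \<in> L"
    and cone: "\<And>\<sigma>. \<sigma> \<in> L \<Longrightarrow> \<sigma> \<subseteq> F \<Longrightarrow> insert z \<sigma> \<in> L"
  shows "contractible_complex (L \<union> all_faces F)"
proof (rule contractible_union[OF L contractible_all_faces])
  show "contractible_complex (L \<inter> all_faces F)"
  proof (rule contractible_cone)
    show "abstract_complex (L \<inter> all_faces F)"
      using L F by (intro abstract_complex_Int abstract_complex_all_faces) (auto simp: contractible_complex_def)
  qed (use z cone in \<open>auto simp: mem_all_faces\<close>)
qed (use F z in auto)

lemma contractible_star:
  assumes K: "abstract_complex K" and y: "{y} \<in> K"
  shows "contractible_complex {\<sigma> \<in> K. insert y \<sigma> \<in> K}"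
proof (rule contractible_cone[of _ y])
  show "abstract_complex {\<sigma> \<in> K. insert y \<sigma> \<in> K}"
  proof (rule abstract_complex_filter[OF K])
    fix \<sigma> \<tau> assume "insert y \<sigma> \<in> K" "\<tau> \<subseteq> \<sigma>"
    then show "insert y \<tau> \<in> K"
      using abstract_complexD(3)[OF K, of "insert y \<sigma>" "insert y \<tau>"] by blast
  qed
qed (use y in auto)

lemma contractible_remove_dominated:
  assumes K: "abstract_complex K" and dom: "\<And>\<sigma>. \<sigma> \<in> K \<Longrightarrow> y \<in> \<sigma> \<Longrightarrow> insert g \<sigma> \<in> K" and "g \<noteq> y"
    and del: "contractible_complex {\<sigma> \<in> K. y \<notin> \<sigma>}"
  shows "contractible_complex K"
proof (cases "\<exists>\<sigma>\<in>K. y \<in> \<sigma>")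
  case False
  then have "{\<sigma> \<in> K. y \<notin> \<sigma>} = K"
    by auto
  then show ?thesis
    using del by simp
next
  case True
  define star where "star = {\<sigma> \<in> K. insert y \<sigma> \<in> K}"
  have face: "\<tau> \<in> K" if "\<sigma> \<in> K" "\<tau> \<subseteq> \<sigma>" "\<tau> \<noteq> {}" for \<sigma> \<tau>
    using abstract_complexD(3)[OF K that(1)] that(2,3) .
  have y: "{y} \<in> K" "{g, y} \<in> K"
    using True face dom[of "{y}"] by auto
  have "contractible_complex star"
    unfolding star_def by (rule contractible_star[OF K y(1)])
  then have star: "abstract_complex star"
    by (simp add: contractible_complex_def)
  have "contractible_complex ({\<sigma> \<in> K. y \<notin> \<sigma>} \<inter> star)"
  proof (rule contractible_cone[of _ g])
    show "abstract_complex ({\<sigma> \<in> K. y \<notin> \<sigma>} \<inter> star)"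
      by (intro abstract_complex_Int star abstract_complex_filter[OF K]) auto
    have "{g} \<in> {\<sigma> \<in> K. y \<notin> \<sigma>} \<inter> star"
      using y \<open>g \<noteq> y\<close> face[of "{g, y}" "{g}"] by (auto simp: star_def insert_commute)
    then show "{\<sigma> \<in> K. y \<notin> \<sigma>} \<inter> star \<noteq> {}"
      by blast
    fix \<sigma> assume \<sigma>: "\<sigma> \<in> {\<sigma> \<in> K. y \<notin> \<sigma>} \<inter> star"
    then have "insert g (insert y \<sigma>) \<in> K"
      using dom[of "insert y \<sigma>"] by (auto simp: star_def)
    moreover from this have "insert g \<sigma> \<in> K"
      by (rule face) auto
    ultimately show "insert g \<sigma> \<in> {\<sigma> \<in> K. y \<notin> \<sigma>} \<inter> star"
      using \<sigma> \<open>g \<noteq> y\<close> by (auto simp: star_def insert_commute)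
  qed
  then have "contractible_complex ({\<sigma> \<in> K. y \<notin> \<sigma>} \<union> star)"
    by (rule contractible_union[OF del \<open>contractible_complex star\<close>])
  moreover have "{\<sigma> \<in> K. y \<notin> \<sigma>} \<union> star = K"
    by (auto simp: star_def insert_absorb)
  ultimately show ?thesis
    by simp
qed

lemma contractible_dismantling:
  assumes K: "abstract_complex K" and "finite N" and base: "contractible_complex {\<sigma> \<in> K. \<sigma> \<inter> N = {}}"
    and dom: "\<And>M. M \<subseteq> N \<Longrightarrow> M \<noteq> {} \<Longrightarrow> \<exists>y\<in>M. \<exists>g. g \<noteq> y \<and> g \<notin> N - M \<and>
      (\<forall>\<sigma>\<in>K. \<sigma> \<inter> (N - M) = {} \<longrightarrow> y \<in> \<sigma> \<longrightarrow> insert g \<sigma> \<in> K)"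
  shows "contractible_complex K"
proof -
  have "contractible_complex {\<sigma> \<in> K. \<sigma> \<inter> (N - M) = {}}" if "finite M" "M \<subseteq> N" for M
    using that
  proof (induction M rule: finite_psubset_induct)
    case (psubset M)
    show ?case
    proof (cases "M = {}")
      case True
      then show ?thesis
        using base by simp
    next
      case False
      then obtain y g where y: "y \<in> M" and g: "g \<noteq> y" "g \<notin> N - M"
        and dom: "\<And>\<sigma>. \<sigma> \<in> K \<Longrightarrow> \<sigma> \<inter> (N - M) = {} \<Longrightarrow> y \<in> \<sigma> \<Longrightarrow> insert g \<sigma> \<in> K"
        using dom[OF psubset.prems] by blast
      show ?thesis
      proof (rule contractible_remove_dominated[OF abstract_complex_filter[OF K] _ g(1)])
        have "contractible_complex {\<sigma> \<in> K. \<sigma> \<inter> (N - (M - {y})) = {}}"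
          using y psubset.prems by (intro psubset.IH) auto
        moreover have "{\<sigma> \<in> {\<sigma> \<in> K. \<sigma> \<inter> (N - M) = {}}. y \<notin> \<sigma>} = {\<sigma> \<in> K. \<sigma> \<inter> (N - (M - {y})) = {}}"
          using y psubset.prems by blast
        ultimately show "contractible_complex {\<sigma> \<in> {\<sigma> \<in> K. \<sigma> \<inter> (N - M) = {}}. y \<notin> \<sigma>}"
          by simp
      qed (use dom g(2) in auto)
    qed
  qed
  from this[of N] show ?thesis
    using \<open>finite N\<close> by simp
qed

subsection \<open>Inclusions of subcomplexes\<close>

lemma (in contractible_carrier) restrict_to_subcomplex:
  assumes "abstract_complex M" "M \<subseteq> K"
  shows "contractible_carrier M \<Phi>"
  using assms contractible mono by unfold_locales blast+

lemma contractible_carrier_extend_by_faces: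
  assumes K: "abstract_complex K" and M: "abstract_complex M"
    and contractible: "\<And>\<sigma>. \<sigma> \<in> K - M \<Longrightarrow> contractible_complex (\<Phi> \<sigma>)"
    and mono: "\<And>\<sigma> \<tau>. \<sigma> \<in> K - M \<Longrightarrow> \<tau> \<in> K - M \<Longrightarrow> \<tau> \<subseteq> \<sigma> \<Longrightarrow> \<Phi> \<tau> \<subseteq> \<Phi> \<sigma>"
    and faces: "\<And>\<sigma> \<tau>. \<sigma> \<in> K - M \<Longrightarrow> \<tau> \<in> M \<Longrightarrow> \<tau> \<subseteq> \<sigma> \<Longrightarrow> \<tau> \<in> \<Phi> \<sigma>"
  shows "contractible_carrier K (\<lambda>\<sigma>. if \<sigma> \<in> M then all_faces \<sigma> else \<Phi> \<sigma>)"
proof unfold_locales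
  fix \<sigma> assume \<sigma>: "\<sigma> \<in> K"
  note \<sigma>D = abstract_complexD[OF K \<sigma>]
  show "contractible_complex (if \<sigma> \<in> M then all_faces \<sigma> else \<Phi> \<sigma>)"
    using contractible \<sigma> contractible_all_faces[OF \<sigma>D(1,2)] by simp
  fix \<tau> assume \<tau>: "\<tau> \<in> K" "\<tau> \<subseteq> \<sigma>"
  consider "\<sigma> \<in> M" | "\<sigma> \<notin> M" "\<tau> \<in> M" | "\<sigma> \<notin> M" "\<tau> \<notin> M"
    by blast
  then show "(if \<tau> \<in> M then all_faces \<tau> else \<Phi> \<tau>) \<subseteq> (if \<sigma> \<in> M then all_faces \<sigma> else \<Phi> \<sigma>)"
  proof cases
    case 1
    then have "\<tau> \<in> M"
      using abstract_complexD(3)[OF M _ \<tau>(2)] abstract_complexD(2)[OF K \<tau>(1)] by blast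
    then show ?thesis
      using 1 all_faces_mono[OF \<tau>(2)] by simp
  next
    case 2
    then have "abstract_complex (\<Phi> \<sigma>)" "\<tau> \<in> \<Phi> \<sigma>"
      using contractible faces \<sigma> \<tau> by (simp_all add: contractible_complex_def)
    then show ?thesis
      using 2 all_faces_subset_complex by simp
  qed (use mono \<sigma> \<tau> in simp)
qed (rule K)

theorem inclusion_homotopy_equivalence:
  assumes K: "abstract_complex K" and M: "abstract_complex M" and MK: "M \<subseteq> K"
    and \<Psi>: "\<And>\<sigma>. \<sigma> \<in> K - M \<Longrightarrow> contractible_complex (\<Psi> \<sigma>)" "\<And>\<sigma>. \<sigma> \<in> K - M \<Longrightarrow> \<Psi> \<sigma> \<subseteq> M"
      "\<And>\<sigma> \<tau>. \<sigma> \<in> K - M \<Longrightarrow> \<tau> \<in> K - M \<Longrightarrow> \<tau> \<subseteq> \<sigma> \<Longrightarrow> \<Psi> \<tau> \<subseteq> \<Psi> \<sigma>"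
      "\<And>\<sigma> \<tau>. \<sigma> \<in> K - M \<Longrightarrow> \<tau> \<in> M \<Longrightarrow> \<tau> \<subseteq> \<sigma> \<Longrightarrow> \<tau> \<in> \<Psi> \<sigma>"
    and \<Theta>: "\<And>\<sigma>. \<sigma> \<in> K - M \<Longrightarrow> contractible_complex (\<Theta> \<sigma>)" "\<And>\<sigma>. \<sigma> \<in> K - M \<Longrightarrow> \<Theta> \<sigma> \<subseteq> K"
      "\<And>\<sigma> \<tau>. \<sigma> \<in> K - M \<Longrightarrow> \<tau> \<in> K - M \<Longrightarrow> \<tau> \<subseteq> \<sigma> \<Longrightarrow> \<Theta> \<tau> \<subseteq> \<Theta> \<sigma>"
      "\<And>\<sigma>. \<sigma> \<in> K - M \<Longrightarrow> \<sigma> \<in> \<Theta> \<sigma>"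
    and \<Psi>\<Theta>: "\<And>\<sigma>. \<sigma> \<in> K - M \<Longrightarrow> \<Psi> \<sigma> \<subseteq> \<Theta> \<sigma>"
  shows "homotopy_equivalence_map (realization M) (realization K) id"
proof -
  define R where "R \<sigma> = (if \<sigma> \<in> M then all_faces \<sigma> else \<Psi> \<sigma>)" for \<sigma>
  define D where "D \<sigma> = (if \<sigma> \<in> M then all_faces \<sigma> else \<Theta> \<sigma>)" for \<sigma>
  interpret R: contractible_carrier K R
    unfolding R_def by (rule contractible_carrier_extend_by_faces[OF K M \<Psi>(1,3,4)])
  interpret D: contractible_carrier K D
    unfolding D_def using \<Psi>\<Theta> \<Psi>(4) by (intro contractible_carrier_extend_by_faces[OF K M \<Theta>(1,3)]) blast+
  interpret RM: contractible_carrier M R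
    by (rule R.restrict_to_subcomplex[OF M MK])
  have complexes: "abstract_complex (R \<sigma>)" "abstract_complex (D \<sigma>)" if "\<sigma> \<in> K" for \<sigma>
    using R.contractible[OF that] D.contractible[OF that] by (simp_all add: contractible_complex_def)
  have R_M: "R \<sigma> \<subseteq> M" and D_K: "D \<sigma> \<subseteq> K" and RD: "R \<sigma> \<subseteq> D \<sigma>" and self_D: "\<sigma> \<in> D \<sigma>" if "\<sigma> \<in> K" for \<sigma>
    using that \<Psi>(2) \<Theta>(2,4) \<Psi>\<Theta> all_faces_subset_complex[OF M, of \<sigma>] all_faces_subset_complex[OF K that]
      abstract_complexD(2)[OF K that]
    by (auto simp: R_def D_def mem_all_faces[of \<sigma>])
  have self_R: "\<sigma> \<in> R \<sigma>" if "\<sigma> \<in> M" for \<sigma>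
    using that abstract_complexD(2)[OF M] by (simp add: R_def mem_all_faces)
  obtain g where g: "carried K R g"
    using R.carried_map_exists by blast
  have "continuous_map (realization K) (realization M) g"
    using carried_imp_continuous_map[OF K M g] R_M complexes by blast
  moreover have "homotopic_with (\<lambda>x. True) (realization M) (realization M) g (\<lambda>x. x)"
    using carried_mono[OF g MK, of R] carried_id[of M R] R_M self_R complexes MK
    by (intro RM.carried_maps_homotopic[OF M]) blast+
  moreover have "homotopic_with (\<lambda>x. True) (realization K) (realization K) g (\<lambda>x. x)"
    using carried_mono[OF g order_refl, of D] carried_id[of K D] D_K RD self_D complexes
    by (intro D.carried_maps_homotopic[OF K]) blast+
  moreover have "continuous_map (realization M) (realization K) id"
    by (rule continuous_map_realization_mono[OF M K MK continuous_map_id])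
  ultimately show ?thesis
    unfolding homotopy_equivalence_map_def by (auto simp: id_def o_def)
qed

lemma homotopy_equivalence_map_id: "homotopy_equivalence_map X X id"
  unfolding homotopy_equivalence_map_def by (intro conjI exI[of _ id]) auto

lemma homotopy_inverse_compose:
  assumes "continuous_map X Y f" "continuous_map Y X g" "homotopic_with (\<lambda>x. True) X X (g \<circ> f) id"
    and "homotopic_with (\<lambda>x. True) Y Y (k \<circ> j) id"
  shows "homotopic_with (\<lambda>x. True) X X ((g \<circ> k) \<circ> (j \<circ> f)) id"
proof -
  have "homotopic_with (\<lambda>x. True) X X (g \<circ> ((k \<circ> j) \<circ> f)) (g \<circ> (id \<circ> f))"
    by (intro homotopic_with_compose_continuous_map_left[OF _ assms(2)]
        homotopic_with_compose_continuous_map_right[OF assms(4,1)]) simp_all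
  then show ?thesis
    using homotopic_with_trans[OF _ assms(3)] by (simp add: comp_assoc)
qed

lemma homotopy_equivalence_map_compose:
  assumes "homotopy_equivalence_map X Y f" "homotopy_equivalence_map Y Z j"
  shows "homotopy_equivalence_map X Z (j \<circ> f)"
proof -
  obtain g where f: "continuous_map X Y f" and g: "continuous_map Y X g"
    and gf: "homotopic_with (\<lambda>x. True) X X (g \<circ> f) id" and fg: "homotopic_with (\<lambda>x. True) Y Y (f \<circ> g) id"
    using assms(1) unfolding homotopy_equivalence_map_def by blast
  obtain k where j: "continuous_map Y Z j" and k: "continuous_map Z Y k"
    and kj: "homotopic_with (\<lambda>x. True) Y Y (k \<circ> j) id" and jk: "homotopic_with (\<lambda>x. True) Z Z (j \<circ> k) id"
    using assms(2) unfolding homotopy_equivalence_map_def by blast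
  show ?thesis
    unfolding homotopy_equivalence_map_def
    using homotopy_inverse_compose[OF f g gf kj] homotopy_inverse_compose[OF k j jk fg]
      continuous_map_compose[OF f j] continuous_map_compose[OF k g] by blast
qed

lemma homotopy_equivalence_map_imp_equivalent:
  assumes "homotopy_equivalence_map X Y f"
  shows "X homotopy_equivalent_space Y"
  using assms unfolding homotopy_equivalence_map_def homotopy_equivalent_space_def by blast

section \<open>Gap complexes on the circle\<close>

declare frac_eq_0_iff [simp del] frac_gt_0_iff [simp del]

lemma frac_diff_relative:
  fixes u v a :: real
  shows "frac (u - v) = (if frac (v - a) \<le> frac (u - a) then frac (u - a) - frac (v - a)
           else frac (u - a) - frac (v - a) + 1)"
  using frac_diff_pos[of "v - a" "u - a"] frac_diff_neg[of "u - a" "v - a"] by auto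

lemma frac_diff_add:
  fixes u v a :: real
  assumes "frac (u - v) + frac (v - a) < 1"
  shows "frac (u - a) = frac (u - v) + frac (v - a)"
  using assms frac_add[of "u - v" "v - a"] by simp

lemma frac_in_circle: "frac x \<in> circle"
  by (simp add: circle_def frac_lt_1)

lemma frac_circle: "x \<in> circle \<Longrightarrow> frac x = x"
  by (simp add: circle_def)

lemma circle_eqI: "x \<in> circle \<Longrightarrow> y \<in> circle \<Longrightarrow> frac (x - y) = 0 \<Longrightarrow> x = y"
  using frac_diff_zero[of x y] frac_circle by simp

subsection \<open>Faces and their gaps\<close>

definition open_arc :: "real \<Rightarrow> real \<Rightarrow> real set" where
  "open_arc a l = {x. 0 < frac (x - a) \<and> frac (x - a) < l}"

text \<open>A finite set lies in a closed arc of length \<open>1 - d\<close> iff it misses an open arc of length \<open>d\<close>. The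
  length of the missed arc is allowed to depend on its left end point \<open>a\<close>, which need not belong to
  the set.\<close>

definition gap_complex :: "(real \<Rightarrow> real) \<Rightarrow> real set \<Rightarrow> real set set" where
  "gap_complex e X = {\<sigma>. \<sigma> \<subseteq> X \<and> finite \<sigma> \<and> \<sigma> \<noteq> {} \<and> (\<exists>a\<in>circle. \<sigma> \<inter> open_arc a (e a) = {})}"

lemma open_arc_frac: "open_arc (frac a) l = open_arc a l"
  by (simp add: open_arc_def frac_diff_simp)

lemma open_arc_mono: "l \<le> l' \<Longrightarrow> open_arc a l \<subseteq> open_arc a l'"
  by (auto simp: open_arc_def)

lemma gap_complexI:
  assumes "\<sigma> \<subseteq> X" "finite \<sigma>" "\<sigma> \<noteq> {}" "a \<in> circle" "\<sigma> \<inter> open_arc a (e a) = {}"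
  shows "\<sigma> \<in> gap_complex e X"
  using assms unfolding gap_complex_def by blast

lemma gap_complexD:
  assumes "\<sigma> \<in> gap_complex e X"
  shows "\<sigma> \<subseteq> X" "finite \<sigma>" "\<sigma> \<noteq> {}"
  using assms by (simp_all add: gap_complex_def)

lemma abstract_complex_gap: "abstract_complex (gap_complex e X)"
proof (rule abstract_complexI)
  fix \<sigma> \<tau> assume "\<sigma> \<in> gap_complex e X" "\<tau> \<subseteq> \<sigma>" "\<tau> \<noteq> {}"
  then show "\<tau> \<in> gap_complex e X"
    unfolding gap_complex_def by (auto intro: finite_subset)
qed (auto simp: gap_complex_def)

lemma gap_complex_mono: "X \<subseteq> Y \<Longrightarrow> gap_complex e X \<subseteq> gap_complex e Y"
  by (auto simp: gap_complex_def)

lemma gap_complex_restrict: "\<sigma> \<in> gap_complex e Y \<Longrightarrow> \<sigma> \<subseteq> X \<Longrightarrow> \<sigma> \<in> gap_complex e X"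
  by (simp add: gap_complex_def)

lemma gap_complex_delete: "{\<sigma> \<in> gap_complex e X. \<sigma> \<inter> N = {}} = gap_complex e (X - N)"
  by (auto simp: gap_complex_def)

lemma gap_complex_antimono:
  assumes "\<And>a. a \<in> circle \<Longrightarrow> e a \<le> e' a"
  shows "gap_complex e' X \<subseteq> gap_complex e X"
proof
  fix \<sigma> assume "\<sigma> \<in> gap_complex e' X"
  then obtain a where \<sigma>: "\<sigma> \<subseteq> X" "finite \<sigma>" "\<sigma> \<noteq> {}" and a: "a \<in> circle" "\<sigma> \<inter> open_arc a (e' a) = {}"
    unfolding gap_complex_def by blast
  then show "\<sigma> \<in> gap_complex e X"
    using open_arc_mono[OF assms[OF a(1)], of a] by (intro gap_complexI[OF \<sigma> a(1)]) blast
qed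

lemma gap_complex_of_face:
  assumes "X \<in> gap_complex e Y"
  shows "gap_complex e X = all_faces X"
proof
  show "gap_complex e X \<subseteq> all_faces X"
    by (auto simp: gap_complex_def mem_all_faces)
  have "X \<in> gap_complex e X"
    by (rule gap_complex_restrict[OF assms order_refl])
  then show "all_faces X \<subseteq> gap_complex e X"
    by (rule all_faces_subset_complex[OF abstract_complex_gap])
qed

lemma circ_dist_le_iff:
  assumes r: "0 < r" "r < 1/2" and xy: "x \<in> circle" "y \<in> circle"
  shows "circ_dist x y \<le> r \<longleftrightarrow> x \<notin> open_arc (y + r) (1 - 2 * r)"
proof -
  have xy_diff: "frac (x - y) = (if y \<le> x then x - y else x - y + 1)"
    using frac_diff_relative[of x y 0] xy by (simp add: frac_circle)
  have "frac (x - (y + r)) = (if r \<le> frac (x - y) then frac (x - y) - r else frac (x - y) - r + 1)"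
    using frac_diff_relative[of x "y + r" y] r by simp
  then show ?thesis
    using xy r unfolding xy_diff circ_dist_def circle_def open_arc_def
    by (auto simp: min_def abs_if split: if_splits)
qed

lemma cech_le_eq_gap_complex:
  assumes r: "0 < r" "r < 1/2"
  shows "cech_le circle r = gap_complex (\<lambda>_. 1 - 2 * r) circle"
proof -
  have ball_iff_gap: "(\<Inter>x\<in>\<sigma>. circ_cball x r) \<noteq> {} \<longleftrightarrow> (\<exists>a\<in>circle. \<sigma> \<inter> open_arc a (1 - 2 * r) = {})"
    if \<sigma>: "\<sigma> \<subseteq> circle" "\<sigma> \<noteq> {}" for \<sigma>
  proof
    assume "(\<Inter>x\<in>\<sigma>. circ_cball x r) \<noteq> {}"
    then obtain y where y: "\<And>x. x \<in> \<sigma> \<Longrightarrow> y \<in> circle \<and> circ_dist x y \<le> r"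
      by (auto simp: circ_cball_def)
    then have "\<sigma> \<inter> open_arc (frac (y + r)) (1 - 2 * r) = {}"
      using circ_dist_le_iff[OF r] \<sigma>(1) unfolding open_arc_frac by blast
    then show "\<exists>a\<in>circle. \<sigma> \<inter> open_arc a (1 - 2 * r) = {}"
      using frac_in_circle by blast
  next
    assume "\<exists>a\<in>circle. \<sigma> \<inter> open_arc a (1 - 2 * r) = {}"
    then obtain a where a: "a \<in> circle" "\<sigma> \<inter> open_arc a (1 - 2 * r) = {}"
      by blast
    have "open_arc (frac (a - r) + r) (1 - 2 * r) = open_arc a (1 - 2 * r)"
      by (metis open_arc_frac frac_add_simps(1) diff_add_cancel)
    then have "circ_dist x (frac (a - r)) \<le> r" if "x \<in> \<sigma>" for x
      using that a(2) circ_dist_le_iff[OF r _ frac_in_circle, of x "a - r"] \<sigma>(1) by auto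
    then have "frac (a - r) \<in> (\<Inter>x\<in>\<sigma>. circ_cball x r)"
      by (simp add: circ_cball_def frac_in_circle)
    then show "(\<Inter>x\<in>\<sigma>. circ_cball x r) \<noteq> {}"
      by blast
  qed
  show ?thesis
    unfolding cech_le_def gap_complex_def by (intro Collect_cong conj_cong refl ball_iff_gap)
qed

lemma last_point_before:
  fixes v :: real
  assumes "finite \<rho>" "\<rho> \<noteq> {}"
  obtains a where "a \<in> \<rho>" "\<And>x. x \<in> \<rho> \<Longrightarrow> 0 < frac (x - a) \<Longrightarrow> frac (v - a) < frac (x - a)"
proof -
  let ?before = "(\<lambda>x. frac (v - x)) ` \<rho>"
  have "Min ?before \<in> ?before"
    using assms by simp
  then obtain a where a: "a \<in> \<rho>" "Min ?before = frac (v - a)"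
    by blast
  then have closest: "frac (v - a) \<le> frac (v - x)" if "x \<in> \<rho>" for x
    using Min_le[OF finite_imageI[OF assms(1)] imageI[OF that]] by metis
  have "frac (v - a) < frac (x - a)" if "x \<in> \<rho>" "0 < frac (x - a)" for x
  proof (rule ccontr)
    assume "\<not> frac (v - a) < frac (x - a)"
    then have "frac (v - x) = frac (v - a) - frac (x - a)"
      using frac_diff_relative[of v x a] by simp
    then show False
      using closest[OF that(1)] that(2) by linarith
  qed
  then show ?thesis
    using that a(1) by blast
qed

lemma gap_after_vertex:
  assumes "\<sigma> \<in> gap_complex (\<lambda>_. d) X"
  obtains a where "a \<in> \<sigma>" "\<sigma> \<inter> open_arc a d = {}"
proof -
  obtain b where \<sigma>: "finite \<sigma>" "\<sigma> \<noteq> {}" and b: "\<sigma> \<inter> open_arc b d = {}"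
    using assms unfolding gap_complex_def by blast
  obtain a where a: "a \<in> \<sigma>" and beyond: "\<And>x. x \<in> \<sigma> \<Longrightarrow> 0 < frac (x - a) \<Longrightarrow> frac (b - a) < frac (x - a)"
    using last_point_before[OF \<sigma>, of b] by blast
  have "x \<notin> open_arc a d" if x: "x \<in> \<sigma>" for x
  proof
    assume arc: "x \<in> open_arc a d"
    then have "frac (b - a) < frac (x - a)"
      using beyond[OF x] by (simp add: open_arc_def)
    then have "frac (x - b) = frac (x - a) - frac (b - a)"
      using frac_diff_relative[of x b a] by simp
    then have "x \<in> open_arc b d"
      using arc \<open>frac (b - a) < frac (x - a)\<close> frac_ge_0[of "b - a"] unfolding open_arc_def mem_Collect_eq by linarith
    then show False
      using b x by blast
  qed
  then show ?thesis
    using that[OF a] by blast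
qed

lemma proper_subset_in_gap_complex:
  assumes V: "finite V" "V \<subseteq> circle" and \<rho>: "\<rho> \<subset> V" "\<rho> \<noteq> {}"
    and unique: "\<And>a x y. a \<in> V \<Longrightarrow> x \<in> V \<inter> open_arc a d \<Longrightarrow> y \<in> V \<inter> open_arc a d \<Longrightarrow> x = y"
  shows "\<rho> \<in> gap_complex (\<lambda>_. d) circle"
proof -
  obtain v where v: "v \<in> V" "v \<notin> \<rho>"
    using \<rho>(1) by blast
  have fin: "finite \<rho>"
    using finite_subset[OF psubset_imp_subset[OF \<rho>(1)] V(1)] .
  obtain a where a: "a \<in> \<rho>" and beyond: "\<And>x. x \<in> \<rho> \<Longrightarrow> 0 < frac (x - a) \<Longrightarrow> frac (v - a) < frac (x - a)"
    using last_point_before[OF fin \<rho>(2), of v] by blast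
  have aV: "a \<in> V" "a \<in> circle"
    using a \<rho>(1) V(2) by blast+
  have "frac (v - a) \<noteq> 0"
    using circle_eqI[of v a] v a aV V(2) by blast
  then have pos: "0 < frac (v - a)"
    by (simp add: less_le)
  have "\<rho> \<inter> open_arc a d = {}"
  proof (intro equals0I)
    fix x assume x: "x \<in> \<rho> \<inter> open_arc a d"
    then have "v \<in> open_arc a d"
      using beyond[of x] pos by (simp add: open_arc_def)
    then have "x = v"
      using unique[OF aV(1), of x v] x v(1) \<rho>(1) by blast
    then show False
      using x v(2) by blast
  qed
  then show ?thesis
    using \<rho> V aV(2) fin by (intro gap_complexI) auto
qed

subsection \<open>Adding a vertex to a face\<close>

lemma insert_gap_face_up:
  assumes e: "\<And>a. a \<in> circle \<Longrightarrow> \<delta> \<le> e a \<and> e a \<le> \<delta>'"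
    and \<rho>: "\<rho> \<in> gap_complex e X" and y: "y \<in> \<rho>" and t: "t \<in> X" "t \<in> circle"
    and room: "frac (t - y) \<le> 1 - \<delta>'"
    and clear: "\<And>x. x \<in> \<rho> \<Longrightarrow> frac (x - y) \<notin> {\<delta>..<frac (t - y) + \<delta>'}"
  shows "insert t \<rho> \<in> gap_complex e X"
proof -
  note \<rho>D = gap_complexD[OF \<rho>]
  obtain a where a: "a \<in> circle" "\<rho> \<inter> open_arc a (e a) = {}"
    using \<rho> unfolding gap_complex_def by blast
  show ?thesis
  proof (cases "t \<in> open_arc a (e a)")
    case False
    then show ?thesis
      using \<rho>D t a by (intro gap_complexI[of _ _ a]) auto
  next
    case True
    then have ta: "0 < frac (t - a)" "frac (t - a) < e a"
      by (simp_all add: open_arc_def)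
    have "y \<notin> open_arc a (e a)"
      using a(2) y by blast
    then have ta_le: "frac (t - a) \<le> frac (t - y)"
      using frac_diff_relative[of t y a] ta frac_lt_1[of "y - a"] by (auto simp: open_arc_def split: if_splits)
    have "x \<notin> open_arc t (e t)" if x: "x \<in> \<rho>" for x
    proof
      assume "x \<in> open_arc t (e t)"
      then have xt: "0 < frac (x - t)" "frac (x - t) < \<delta>'"
        using e[OF t(2)] by (auto simp: open_arc_def)
      then have "frac (x - y) = frac (x - t) + frac (t - y)"
        using room by (intro frac_diff_add) simp
      then have "frac (x - t) + frac (t - y) < \<delta>" "frac (x - t) + frac (t - y) < 1"
        using clear[OF x] xt(2) frac_lt_1[of "x - y"] by auto
      then have "frac (x - a) = frac (x - t) + frac (t - a)" "frac (x - a) < e a"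
        using frac_diff_add[of x t a] ta_le e[OF a(1)] by auto
      then have "x \<in> open_arc a (e a)"
        using xt(1) ta(1) by (simp add: open_arc_def)
      then show False
        using a(2) x by blast
    qed
    then show ?thesis
      using \<rho>D t by (intro gap_complexI[of _ _ t]) (auto simp: open_arc_def)
  qed
qed

lemma insert_gap_face_down:
  assumes d: "d \<le> 1" and \<rho>: "\<rho> \<in> gap_complex (\<lambda>_. d) X" "X \<subseteq> circle" and y: "y \<in> \<rho>" and g: "g \<in> X"
    and clear: "\<And>a. a \<in> \<rho> \<Longrightarrow> frac (g - a) \<notin> {d - frac (y - g)..<d}"
  shows "insert g \<rho> \<in> gap_complex (\<lambda>_. d) X"
proof -
  note \<rho>D = gap_complexD[OF \<rho>(1)]
  obtain a where a: "a \<in> \<rho>" "\<rho> \<inter> open_arc a d = {}"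
    using gap_after_vertex[OF \<rho>(1)] by blast
  have "g \<notin> open_arc a d"
  proof
    assume arc: "g \<in> open_arc a d"
    then have "frac (y - g) + frac (g - a) < d"
      using clear[OF a(1)] by (auto simp: open_arc_def)
    moreover from this have "frac (y - a) = frac (y - g) + frac (g - a)"
      using d by (intro frac_diff_add) simp
    ultimately have "y \<in> open_arc a d"
      using arc frac_ge_0[of "y - g"] unfolding open_arc_def mem_Collect_eq by linarith
    then show False
      using a(2) y by blast
  qed
  then show ?thesis
    using \<rho>D g a \<rho>(2) by (intro gap_complexI[of _ _ a]) auto
qed

subsection \<open>Regular polygons and their cosets\<close>

definition phase :: "nat \<Rightarrow> real \<Rightarrow> real" where
  "phase q x = frac (real q * x)"

definition coset :: "nat \<Rightarrow> real \<Rightarrow> real set" where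
  "coset q s = {x \<in> circle. phase q x = s}"

abbreviation polygon :: "nat \<Rightarrow> real set" where
  "polygon q \<equiv> coset q 0"

definition polygon_floor :: "nat \<Rightarrow> real \<Rightarrow> real" where
  "polygon_floor q x = of_int \<lfloor>real q * x\<rfloor> / real q"

lemma phase_nonneg: "0 \<le> phase q x"
  by (simp add: phase_def)

lemma phase_less_1: "phase q x < 1"
  by (simp add: phase_def frac_lt_1)

lemma phase_frac: "phase q (frac x) = phase q x"
proof -
  have "real q * frac x = real q * x + of_int (- int q * \<lfloor>x\<rfloor>)"
    by (simp add: frac_def algebra_simps)
  then show ?thesis
    unfolding phase_def by (metis frac_add_of_int_right)
qed

lemma phase_add: "phase q (x + y) = frac (phase q x + phase q y)"
  by (simp add: phase_def distrib_left)

lemma phase_diff: "phase q (x - y) = frac (phase q x - phase q y)"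
  by (simp add: phase_def right_diff_distrib frac_diff_simp) (metis frac_add_simps(1) diff_conv_add_uminus)

lemma phase_divide: "0 < q \<Longrightarrow> phase q (u / real q) = frac u"
  by (simp add: phase_def)

lemma phase_of_short_arc:
  assumes "0 < q" "frac y < 1 / real q"
  shows "phase q y = real q * frac y"
proof -
  have "real q * frac y \<in> {0..<1}"
    using assms by (simp add: field_simps)
  then have "frac (real q * frac y) = real q * frac y"
    by (rule frac_eq_id)
  then show ?thesis
    using phase_frac[of q y] by (simp add: phase_def)
qed

lemma phase_0_imp_steps:
  assumes "0 < q" "phase q y = 0"
  obtains k :: nat where "frac y = real k / real q"
proof -
  have "frac (real q * frac y) = 0"
    using assms(2) phase_frac[of q y] by (simp add: phase_def)
  then have "real q * frac y = of_int \<lfloor>real q * frac y\<rfloor>"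
    by (simp add: frac_def)
  moreover have "0 \<le> \<lfloor>real q * frac y\<rfloor>"
    by simp
  ultimately have "frac y = real (nat \<lfloor>real q * frac y\<rfloor>) / real q"
    using assms(1) by (simp add: field_simps)
  then show ?thesis
    by (rule that)
qed

lemma mem_coset: "x \<in> coset q s \<longleftrightarrow> x \<in> circle \<and> phase q x = s"
  by (simp add: coset_def)

lemma coset_subset_circle: "coset q s \<subseteq> circle"
  by (auto simp: mem_coset)

lemma coset_disjoint: "s \<noteq> s' \<Longrightarrow> coset q s \<inter> coset q s' = {}"
  by (auto simp: mem_coset)

lemma coset_eq_image:
  assumes "0 < q" "0 \<le> s" "s < 1"
  shows "coset q s = (\<lambda>k. (real k + s) / real q) ` {..<q}"
proof (intro subset_antisym subsetI)
  fix x assume "x \<in> coset q s"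
  then have x: "0 \<le> x" "x < 1" "real q * x = of_int \<lfloor>real q * x\<rfloor> + s"
    by (auto simp: mem_coset circle_def phase_def frac_def)
  define k where "k = nat \<lfloor>real q * x\<rfloor>"
  have k: "real q * x = real k + s"
    using x assms(1) by (simp add: k_def)
  moreover have "real q * x < real q"
    using x assms(1) by simp
  ultimately have "k < q" "x = (real k + s) / real q"
    using assms by (simp_all add: field_simps)
  then show "x \<in> (\<lambda>k. (real k + s) / real q) ` {..<q}"
    by blast
next
  fix x assume "x \<in> (\<lambda>k. (real k + s) / real q) ` {..<q}"
  then obtain k where k: "k < q" "x = (real k + s) / real q"
    by blast
  then have "real k + 1 \<le> real q"
    by linarith
  then have "x \<in> circle"
    using k(2) assms by (simp add: circle_def)
  moreover have "phase q x = s"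
    using assms frac_add_of_int_left[of "int k" s] by (simp add: k(2) phase_divide)
  ultimately show "x \<in> coset q s"
    by (simp add: mem_coset)
qed

lemma finite_coset: "0 < q \<Longrightarrow> finite (coset q s)"
proof (cases "0 \<le> s \<and> s < 1")
  case False
  then have "coset q s = {}"
    using phase_nonneg phase_less_1 by (auto simp: mem_coset)
  then show ?thesis
    by simp
qed (simp add: coset_eq_image)

lemma card_coset:
  assumes "0 < q" "0 \<le> s" "s < 1"
  shows "card (coset q s) = q"
proof -
  have "inj_on (\<lambda>k. (real k + s) / real q) {..<q}"
    using assms(1) by (auto simp: inj_on_def)
  then show ?thesis
    by (simp add: coset_eq_image[OF assms] card_image)
qed

lemma coset_nonempty: "0 < q \<Longrightarrow> 0 \<le> s \<Longrightarrow> s < 1 \<Longrightarrow> coset q s \<noteq> {}"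
  using card_coset[of q s] by auto

lemma zero_in_polygon: "0 \<in> polygon q"
  by (simp add: mem_coset circle_def phase_def)

lemma coset_eq_orbit:
  assumes q: "0 < q" and x: "x \<in> coset q s" and y: "y \<in> coset q s"
  obtains k :: nat where "y = frac (x + real k / real q)"
proof -
  have "phase q (y - x) = 0"
    using x y by (simp add: phase_diff mem_coset)
  then obtain k :: nat where "frac (y - x) = real k / real q"
    using phase_0_imp_steps[OF q] by blast
  moreover have "frac (x + frac (y - x)) = y"
    using y by (simp add: mem_coset frac_circle)
  ultimately show ?thesis
    using that by metis
qed

lemma polygon_floor_add_phase: "0 < q \<Longrightarrow> polygon_floor q x + phase q x / real q = x"
  by (simp add: polygon_floor_def phase_def frac_def field_simps)

lemma polygon_floor_eq: "0 < q \<Longrightarrow> polygon_floor q x = x - phase q x / real q"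
  using polygon_floor_add_phase[of q x] by simp

lemma polygon_floor_in_polygon:
  assumes "0 < q" "x \<in> circle"
  shows "polygon_floor q x \<in> polygon q"
proof -
  have x: "0 \<le> x" "x < 1"
    using assms(2) by (simp_all add: circle_def)
  have "0 \<le> polygon_floor q x"
    using x by (simp add: polygon_floor_def)
  moreover have "polygon_floor q x \<le> x"
    using assms(1) phase_nonneg[of q x] by (simp add: polygon_floor_eq)
  moreover have "phase q (polygon_floor q x) = 0"
    using assms(1) by (simp add: polygon_floor_def phase_divide)
  ultimately show ?thesis
    using x by (simp add: mem_coset circle_def)
qed

lemma polygon_floor_polygon: "0 < q \<Longrightarrow> x \<in> polygon q \<Longrightarrow> polygon_floor q x = x"
  by (simp add: polygon_floor_eq mem_coset)

lemma frac_diff_polygon_floor: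
  assumes "0 < q"
  shows "frac (x - polygon_floor q x) = phase q x / real q"
proof -
  have "phase q x < real q"
    using assms phase_less_1[of q x] by linarith
  then show ?thesis
    using assms phase_nonneg[of q x] by (simp add: polygon_floor_eq)
qed

subsection \<open>Rounding down to a polygon\<close>

text \<open>A point of least positive phase that cannot be rounded down is blocked by the point at
  distance exactly \<open>d\<close> before it, which has the same phase; so the blocked points fill a whole orbit.\<close>

lemma blocking_point_on_orbit:
  assumes q: "0 < q" and a: "a \<in> circle"
    and blocked: "frac (polygon_floor q z - a) \<in> {(real p - phase q z) / real q..<real p / real q}"
    and least: "phase q a \<noteq> 0 \<Longrightarrow> phase q z \<le> phase q a"
  shows "a = frac (z - real p / real q)" "phase q a = phase q z"
proof -
  define \<psi> where "\<psi> = real p - real q * frac (polygon_floor q z - a)"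
  have \<psi>: "0 < \<psi>" "\<psi> \<le> phase q z"
    using blocked q by (auto simp: \<psi>_def field_simps)
  have "frac (- phase q a) = phase q (polygon_floor q z - a)"
    using q by (simp add: phase_diff polygon_floor_def phase_divide)
  also have "\<dots> = frac (real q * frac (polygon_floor q z - a))"
    using phase_frac[of q "polygon_floor q z - a"] by (simp add: phase_def)
  also have "\<dots> = frac (of_int (int p) + - \<psi>)"
    by (simp add: \<psi>_def)
  also have "\<dots> = frac (- \<psi>)"
    by (rule frac_add_of_int_left)
  finally have "frac (phase q a) = frac \<psi>"
    by (simp only: frac_neg_eq_iff)
  then have "phase q a = \<psi>"
    using \<psi> phase_less_1[of q z] phase_nonneg[of q a] phase_less_1[of q a] by simp
  then show "phase q a = phase q z"
    using \<psi> least by simp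
  then have "frac (polygon_floor q z - a) = (real p - phase q z) / real q"
    using q \<open>phase q a = \<psi>\<close> by (simp add: \<psi>_def field_simps)
  then have "real p / real q = frac (polygon_floor q z - a) + phase q z / real q"
    by (simp add: diff_divide_distrib)
  also have "\<dots> = z - a - of_int \<lfloor>polygon_floor q z - a\<rfloor>"
    using q by (simp add: frac_def polygon_floor_eq)
  finally have "z - real p / real q = a + of_int \<lfloor>polygon_floor q z - a\<rfloor>"
    by simp
  then show "a = frac (z - real p / real q)"
    using frac_circle[OF a] by (metis frac_add_of_int_right)
qed

lemma unblocked_point_exists:
  assumes q: "0 < q" and X: "finite X" "X \<subseteq> circle" and N: "X - polygon q \<noteq> {}"
    and orbit: "\<And>y. y \<in> X - polygon q \<Longrightarrow> \<exists>k::nat. frac (y - real k * (real p / real q)) \<notin> X"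
  shows "\<exists>y \<in> X - polygon q. \<forall>a\<in>X.
    frac (polygon_floor q y - a) \<notin> {(real p - phase q y) / real q..<real p / real q}"
proof (rule ccontr)
  assume all_blocked: "\<not> ?thesis"
  let ?d = "real p / real q"
  define \<phi> where "\<phi> = Min (phase q ` (X - polygon q))"
  have "\<phi> \<in> phase q ` (X - polygon q)"
    using X(1) N by (simp add: \<phi>_def)
  then obtain y where y: "y \<in> X - polygon q" "phase q y = \<phi>"
    by blast
  have least: "\<phi> \<le> phase q a" if "a \<in> X" "phase q a \<noteq> 0" for a
    using that X by (auto simp: \<phi>_def mem_coset)
  have step: "frac (z - ?d) \<in> X \<and> phase q (frac (z - ?d)) = \<phi>" if z: "z \<in> X" "phase q z = \<phi>" for z
  proof -
    have "z \<in> X - polygon q"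
      using z y X(2) by (auto simp: mem_coset)
    then obtain a where a: "a \<in> X" "frac (polygon_floor q z - a) \<in> {(real p - phase q z) / real q..<?d}"
      using all_blocked by blast
    from blocking_point_on_orbit[OF q _ a(2)] show ?thesis
      using a(1) X(2) least[OF a(1)] z(2) by auto
  qed
  have "frac (y - real k * ?d) \<in> X \<and> phase q (frac (y - real k * ?d)) = \<phi>" for k :: nat
  proof (induction k)
    case 0
    then show ?case
      using y X(2) frac_circle[of y] by auto
  next
    case (Suc k)
    have "frac (frac (y - real k * ?d) - ?d) = frac (y - real k * ?d - ?d)"
      using frac_add_simps(1)[of _ "- ?d"] by simp
    also have "\<dots> = frac (y - real (Suc k) * ?d)"
      by (simp add: algebra_simps add_divide_distrib)
    finally show ?case
      using step[of "frac (y - real k * ?d)"] Suc by simp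
  qed
  then show False
    using orbit[OF y(1)] by blast
qed

lemma contractible_polygon_rounding:
  fixes p q :: nat
  assumes p: "p < q" and X: "finite X" "X \<subseteq> circle" "polygon_floor q ` X \<subseteq> X"
    and orbit: "\<And>y. y \<in> X - polygon q \<Longrightarrow> \<exists>k::nat. frac (y - real k * (real p / real q)) \<notin> X"
    and base: "contractible_complex (gap_complex (\<lambda>_. real p / real q) (X \<inter> polygon q))"
  shows "contractible_complex (gap_complex (\<lambda>_. real p / real q) X)"
proof (rule contractible_dismantling[OF abstract_complex_gap])
  let ?d = "real p / real q" and ?N = "X - polygon q"
  have q: "0 < q" and d: "?d \<le> 1"
    using p by simp_all
  show "finite ?N"
    using X(1) by simp
  show "contractible_complex {\<sigma> \<in> gap_complex (\<lambda>_. ?d) X. \<sigma> \<inter> ?N = {}}"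
    using base by (simp add: gap_complex_delete Diff_Diff_Int)
  fix M assume M: "M \<subseteq> ?N" "M \<noteq> {}"
  define X' where "X' = X - (?N - M)"
  have X': "finite X'" "X' \<subseteq> circle" "X' - polygon q = M"
    using X M by (auto simp: X'_def)
  have "\<exists>k::nat. frac (z - real k * ?d) \<notin> X'" if "z \<in> X' - polygon q" for z
    using orbit[of z] that by (auto simp: X'_def)
  then obtain y where y: "y \<in> M" and unblocked: "\<And>a. a \<in> X' \<Longrightarrow>
      frac (polygon_floor q y - a) \<notin> {(real p - phase q y) / real q..<?d}"
    using unblocked_point_exists[OF q X'(1,2), of p] X'(3) M(2) by auto
  have floor: "polygon_floor q y \<in> X \<inter> polygon q"
    using y M(1) X polygon_floor_in_polygon[OF q] by blast
  show "\<exists>y\<in>M. \<exists>g. g \<noteq> y \<and> g \<notin> ?N - M \<and>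
      (\<forall>\<sigma>\<in>gap_complex (\<lambda>_. ?d) X. \<sigma> \<inter> (?N - M) = {} \<longrightarrow> y \<in> \<sigma> \<longrightarrow> insert g \<sigma> \<in> gap_complex (\<lambda>_. ?d) X)"
  proof (intro bexI[OF _ y] exI[of _ "polygon_floor q y"] conjI ballI impI)
    show "polygon_floor q y \<noteq> y" "polygon_floor q y \<notin> ?N - M"
      using floor y M(1) by auto
    fix \<sigma> assume \<sigma>: "\<sigma> \<in> gap_complex (\<lambda>_. ?d) X" "\<sigma> \<inter> (?N - M) = {}" "y \<in> \<sigma>"
    show "insert (polygon_floor q y) \<sigma> \<in> gap_complex (\<lambda>_. ?d) X"
    proof (rule insert_gap_face_down[OF d \<sigma>(1) X(2) \<sigma>(3)])
      show "polygon_floor q y \<in> X"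
        using floor by blast
      fix a assume "a \<in> \<sigma>"
      then have "a \<in> X'"
        using \<sigma>(2) gap_complexD(1)[OF \<sigma>(1)] by (auto simp: X'_def)
      then show "frac (polygon_floor q y - a) \<notin> {?d - frac (y - polygon_floor q y)..<?d}"
        using unblocked by (simp add: frac_diff_polygon_floor[OF q] diff_divide_distrib)
    qed
  qed
qed

subsection \<open>A regular value of the gap length\<close>

text \<open>For \<open>d = 2/q\<close> with \<open>q\<close> odd, rounding down retracts the complex onto the proper subsets of the
  \<open>q\<close>-gon: a set of vertices of the \<open>q\<close>-gon has a gap of two steps iff it misses a vertex.\<close>

lemma simplex_boundary_polygon_subset_gap:
  assumes q: "0 < q"
  shows "simplex_boundary (polygon q) \<subseteq> gap_complex (\<lambda>_. 2 / real q) circle"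
proof
  fix \<rho> assume "\<rho> \<in> simplex_boundary (polygon q)"
  then have \<rho>: "\<rho> \<subset> polygon q" "\<rho> \<noteq> {}"
    by (simp_all add: mem_simplex_boundary)
  have one_step: "frac (x - a) = 1 / real q"
    if "a \<in> polygon q" "x \<in> polygon q \<inter> open_arc a (2 / real q)" for a x
  proof -
    have "phase q (x - a) = 0"
      using that by (simp add: phase_diff mem_coset)
    then obtain k :: nat where k: "frac (x - a) = real k / real q"
      using phase_0_imp_steps[OF q] by blast
    then have "0 < real k / real q" "real k / real q < 2 / real q"
      using that by (simp_all add: open_arc_def)
    then have "k = 1"
      using q by (simp add: zero_less_divide_iff divide_less_cancel)
    then show ?thesis
      using k by simp
  qed
  show "\<rho> \<in> gap_complex (\<lambda>_. 2 / real q) circle"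
  proof (rule proper_subset_in_gap_complex[OF finite_coset[OF q] coset_subset_circle \<rho>])
    fix a x y assume axy: "a \<in> polygon q" "x \<in> polygon q \<inter> open_arc a (2 / real q)"
      "y \<in> polygon q \<inter> open_arc a (2 / real q)"
    have "frac (x - y) = frac (x - a) - frac (y - a)"
      using frac_diff_relative[of x y a] one_step[OF axy(1,2)] one_step[OF axy(1,3)] by simp
    also have "\<dots> = 0"
      by (simp add: one_step[OF axy(1,2)] one_step[OF axy(1,3)])
    finally show "x = y"
      using circle_eqI[of x y] axy(2,3) coset_subset_circle by blast
  qed
qed

lemma polygon_floor_image_proper:
  assumes q: "3 \<le> q" and \<sigma>: "\<sigma> \<in> gap_complex (\<lambda>_. 2 / real q) circle"
  shows "polygon_floor q ` \<sigma> \<in> simplex_boundary (polygon q)"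
proof -
  note \<sigma>D = gap_complexD[OF \<sigma>]
  have q0: "0 < q"
    using q by simp
  obtain a where a: "a \<in> \<sigma>" "\<sigma> \<inter> open_arc a (2 / real q) = {}"
    using gap_after_vertex[OF \<sigma>] by blast
  have "frac (polygon_floor q a + 1 / real q) \<notin> polygon_floor q ` \<sigma>"
  proof
    assume "frac (polygon_floor q a + 1 / real q) \<in> polygon_floor q ` \<sigma>"
    then obtain x where x: "x \<in> \<sigma>" "polygon_floor q x = frac (polygon_floor q a + 1 / real q)"
      by force
    define \<eta> where "\<eta> = 1 / real q + phase q x / real q - phase q a / real q"
    have "phase q a / real q < 1 / real q" "phase q x / real q < 1 / real q"
      using q0 phase_less_1 by (simp_all add: divide_strict_right_mono)
    moreover have "0 \<le> phase q a / real q" "0 \<le> phase q x / real q"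
      using q0 phase_nonneg by simp_all
    ultimately have \<eta>: "0 < \<eta>" "\<eta> < 2 / real q"
      by (simp_all add: \<eta>_def)
    have "2 / real q < 1"
      using q by simp
    have "x - a = frac (polygon_floor q a + 1 / real q) + (phase q x / real q - a)"
      using polygon_floor_add_phase[OF q0, of x] x(2) by linarith
    then have "frac (x - a) = frac ((polygon_floor q a + 1 / real q) + (phase q x / real q - a))"
      by (simp only: frac_add_simps)
    also have "(polygon_floor q a + 1 / real q) + (phase q x / real q - a) = \<eta>"
      using polygon_floor_add_phase[OF q0, of a] unfolding \<eta>_def by linarith
    also have "frac \<eta> = \<eta>"
      using \<eta> \<open>2 / real q < 1\<close> by simp
    finally have "x \<in> open_arc a (2 / real q)"
      using \<eta> by (simp add: open_arc_def)
    then show False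
      using a(2) x(1) by blast
  qed
  moreover have "frac (polygon_floor q a + 1 / real q) \<in> polygon q"
    using polygon_floor_in_polygon[OF q0, of a] a(1) \<sigma>D(1) q0
    by (auto simp: mem_coset frac_in_circle phase_frac phase_add phase_divide)
  moreover have "polygon_floor q ` \<sigma> \<subseteq> polygon q"
    using polygon_floor_in_polygon[OF q0] \<sigma>D(1) by blast
  ultimately show ?thesis
    using \<sigma>D(3) by (auto simp: mem_simplex_boundary)
qed

text \<open>Modulo an odd \<open>q\<close>, any number \<open>j\<close> of steps is an even number of steps, since \<open>2 ((q + 1)/2) j \<equiv> j\<close>.\<close>

lemma double_steps:
  assumes "odd q"
  obtains k :: nat where "frac (y - real k * (2 / real q)) = frac (y - of_int j / real q)"
proof -
  have q: "0 < q"
    using assms by (simp add: odd_pos)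
  obtain m where m: "2 * m = q + 1"
    using assms by (metis oddE add.commute dvd_def even_add odd_one)
  define k where "k = nat (j * int m mod int q)"
  define n where "n = 2 * (j * int m div int q) - j"
  have "int k = j * int m - int q * (j * int m div int q)"
    using q by (simp add: k_def minus_mult_div_eq_mod)
  then have "2 * int k = j * (2 * int m) - int q * (2 * (j * int m div int q))"
    by (simp add: algebra_simps)
  also have "2 * int m = int q + 1"
    using m by linarith
  finally have "2 * int k = j - int q * n"
    by (simp add: n_def algebra_simps)
  then have "2 * real k = of_int j - real q * of_int n"
    by (metis of_int_diff of_int_mult of_int_numeral of_int_of_nat_eq)
  then have "y - real k * (2 / real q) = y - of_int j / real q + of_int n"
    using q by (simp add: field_simps)
  then show ?thesis
    using that by (metis frac_add_of_int_right)
qed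

lemma gap_two_steps_orbit:
  assumes q: "odd q" "3 \<le> q" and a: "\<sigma> \<inter> open_arc a (2 / real q) = {}"
  obtains k :: nat where "frac (y - real k * (2 / real q)) \<notin> \<sigma>"
proof -
  define j where "j = \<lceil>real q * (y - a)\<rceil> - 1"
  define \<eta> where "\<eta> = (real q * (y - a) - of_int j) / real q"
  obtain k :: nat where k: "frac (y - real k * (2 / real q)) = frac (y - of_int j / real q)"
    using double_steps[OF q(1)] .
  have "0 < real q * (y - a) - of_int j" "real q * (y - a) - of_int j < 2"
    unfolding j_def by linarith+
  then have \<eta>: "0 < \<eta>" "\<eta> < 2 / real q"
    using q(2) by (simp_all add: \<eta>_def divide_strict_right_mono)
  have "y - of_int j / real q - a = \<eta>"
    using q(2) by (simp add: \<eta>_def field_simps)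
  moreover have "2 / real q < 1"
    using q(2) by simp
  then have "\<eta> < 1"
    using \<eta>(2) by linarith
  ultimately have "frac (y - of_int j / real q) \<in> open_arc a (2 / real q)"
    using \<eta> frac_add_simps(1)[of "y - of_int j / real q" "- a"] by (simp add: open_arc_def)
  then show ?thesis
    using that[of k] a k by auto
qed

lemma contractible_gap_with_polygon_floor:
  assumes q: "odd q" "3 \<le> q" and \<sigma>: "\<sigma> \<in> gap_complex (\<lambda>_. 2 / real q) circle"
  shows "contractible_complex (gap_complex (\<lambda>_. 2 / real q) (\<sigma> \<union> polygon_floor q ` \<sigma>))"
proof -
  let ?X = "\<sigma> \<union> polygon_floor q ` \<sigma>"
  note \<sigma>D = gap_complexD[OF \<sigma>]
  have q0: "0 < q"
    using q by simp
  have floor: "polygon_floor q ` \<sigma> \<subseteq> polygon q"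
    using polygon_floor_in_polygon[OF q0] \<sigma>D(1) by blast
  have "contractible_complex (gap_complex (\<lambda>_. real 2 / real q) ?X)"
  proof (rule contractible_polygon_rounding)
    show "?X \<subseteq> circle"
      using \<sigma>D(1) floor coset_subset_circle by blast
    show "polygon_floor q ` ?X \<subseteq> ?X"
      using floor polygon_floor_polygon[OF q0] by auto
    show "\<exists>k::nat. frac (y - real k * (real 2 / real q)) \<notin> ?X" if y: "y \<in> ?X - polygon q" for y
    proof -
      obtain a where "\<sigma> \<inter> open_arc a (2 / real q) = {}"
        using \<sigma> by (auto simp: gap_complex_def)
      then obtain k :: nat where k: "frac (y - real k * (2 / real q)) \<notin> \<sigma>"
        using gap_two_steps_orbit[OF q] by blast
      have "phase q (real k * (2 / real q)) = frac (of_int (int (2 * k)))"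
        using q0 by (simp add: phase_def mult.commute)
      then have "phase q (real k * (2 / real q)) = 0"
        by (simp only: frac_of_int)
      then have "phase q (frac (y - real k * (2 / real q))) = phase q y"
        using phase_nonneg[of q y] phase_less_1[of q y] by (simp add: phase_frac phase_diff)
      moreover have "phase q y \<noteq> 0"
        using y \<sigma>D(1) floor by (auto simp: mem_coset)
      ultimately have "frac (y - real k * (2 / real q)) \<notin> polygon q"
        by (simp add: mem_coset)
      then show ?thesis
        using k floor by auto
    qed
    have "?X \<inter> polygon q = polygon_floor q ` \<sigma>"
      using floor polygon_floor_polygon[OF q0] by force
    moreover have "polygon_floor q ` \<sigma> \<in> gap_complex (\<lambda>_. 2 / real q) circle"
      using polygon_floor_image_proper[OF q(2) \<sigma>] simplex_boundary_polygon_subset_gap[OF q0] by blast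
    ultimately show "contractible_complex (gap_complex (\<lambda>_. real 2 / real q) (?X \<inter> polygon q))"
      using \<sigma>D(2,3) by (simp add: gap_complex_of_face contractible_all_faces)
  qed (use q \<sigma>D(2) in auto)
  then show ?thesis
    by simp
qed

lemma simplex_boundary_polygon_gap_equivalence:
  assumes q: "odd q" "3 \<le> q"
  shows "homotopy_equivalence_map (realization (simplex_boundary (polygon q)))
           (realization (gap_complex (\<lambda>_. 2 / real q) circle)) id"
proof -
  let ?K = "gap_complex (\<lambda>_. 2 / real q) circle" and ?M = "simplex_boundary (polygon q)"
  define \<Psi> where "\<Psi> \<sigma> = all_faces (polygon_floor q ` \<sigma>)" for \<sigma>
  define \<Theta> where "\<Theta> \<sigma> = gap_complex (\<lambda>_. 2 / real q) (\<sigma> \<union> polygon_floor q ` \<sigma>)" for \<sigma>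
  have q0: "0 < q"
    using q by simp
  have M: "abstract_complex ?M"
    by (rule abstract_complex_simplex_boundary[OF finite_coset[OF q0]])
  note MK = simplex_boundary_polygon_subset_gap[OF q0]
  show ?thesis
  proof (rule inclusion_homotopy_equivalence[OF abstract_complex_gap M MK, of \<Psi> \<Theta>])
    fix \<sigma> assume "\<sigma> \<in> ?K - ?M"
    then have \<sigma>: "\<sigma> \<in> ?K"
      by blast
    note \<sigma>D = gap_complexD[OF \<sigma>]
    have floor: "polygon_floor q ` \<sigma> \<in> ?M"
      by (rule polygon_floor_image_proper[OF q(2) \<sigma>])
    show "contractible_complex (\<Psi> \<sigma>)"
      unfolding \<Psi>_def using \<sigma>D by (intro contractible_all_faces) auto
    show "\<Psi> \<sigma> \<subseteq> ?M"
      unfolding \<Psi>_def by (rule all_faces_subset_complex[OF M floor])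
    show "contractible_complex (\<Theta> \<sigma>)"
      unfolding \<Theta>_def by (rule contractible_gap_with_polygon_floor[OF q \<sigma>])
    show "\<Theta> \<sigma> \<subseteq> ?K"
      unfolding \<Theta>_def using \<sigma>D(1) polygon_floor_in_polygon[OF q0] coset_subset_circle
      by (intro gap_complex_mono) blast
    show "\<sigma> \<in> \<Theta> \<sigma>"
      unfolding \<Theta>_def by (rule gap_complex_restrict[OF \<sigma>]) blast
    show "\<Psi> \<sigma> \<subseteq> \<Theta> \<sigma>"
      unfolding \<Psi>_def \<Theta>_def
      by (intro all_faces_subset_complex[OF abstract_complex_gap] gap_complex_restrict[OF subsetD[OF MK floor]]) simp
    fix \<tau> assume \<tau>: "\<tau> \<subseteq> \<sigma>"
    show "\<Psi> \<tau> \<subseteq> \<Psi> \<sigma>" "\<Theta> \<tau> \<subseteq> \<Theta> \<sigma>"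
      unfolding \<Psi>_def \<Theta>_def using \<tau> by (intro all_faces_mono gap_complex_mono; blast)+
    assume "\<tau> \<in> ?M"
    then have \<tau>M: "\<tau> \<subset> polygon q" "\<tau> \<noteq> {}"
      by (simp_all add: mem_simplex_boundary)
    then have "polygon_floor q x = x" if "x \<in> \<tau>" for x
      using that by (intro polygon_floor_polygon[OF q0]) blast
    then have "polygon_floor q ` \<tau> = \<tau>"
      by simp
    then show "\<tau> \<in> \<Psi> \<sigma>"
      using image_mono[OF \<tau>, of "polygon_floor q"] \<tau>M(2) by (simp add: \<Psi>_def mem_all_faces)
  qed
qed

subsection \<open>Varying the gap length\<close>

text \<open>The gap length is changed from \<open>\<delta>\<close> to \<open>\<delta>'\<close> for the left end points in the arc of length \<open>w\<close> after
  \<open>p\<close>. The end points reached from this arc by \<open>i\<close> gaps form the \<open>i\<close>th zone; the inequalities keep the zones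
  \<open>0, \<dots>, m - 1\<close> disjoint and within one turn, and the \<open>m\<close>th zone inside the gap after the \<open>0\<close>th.\<close>

locale gap_widening =
  fixes m :: nat and \<delta> \<delta>' w p :: real
  assumes m: "2 \<le> m" and \<delta>: "\<delta> \<le> \<delta>'" and w: "0 < w"
    and full_turn: "w + real m * (\<delta>' - \<delta>) < real m * \<delta> - 1"
    and one_turn: "w + real m * (\<delta>' - \<delta>) < 1 - (real m - 1) * \<delta>"
    and separation: "w + real m * (\<delta>' - \<delta>) < \<delta>"
begin

definition pos :: "real \<Rightarrow> real" where
  "pos x = frac (x - p)"

definition zone :: "nat \<Rightarrow> real set" where
  "zone i = {x. real i * \<delta> \<le> pos x \<and> pos x \<le> w + real i * \<delta>'}"

definition zone_top :: "nat \<Rightarrow> real" where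
  "zone_top i = frac (p + w + real i * \<delta>')"

lemma pos_bounds: "0 \<le> pos x" "pos x < 1"
  by (simp_all add: pos_def frac_lt_1)

lemma frac_diff_eq_pos: "frac (x - y) = (if pos y \<le> pos x then pos x - pos y else pos x - pos y + 1)"
  unfolding pos_def by (rule frac_diff_relative)

lemma gap_length_pos: "0 < \<delta>"
proof -
  have "0 \<le> real m * (\<delta>' - \<delta>)"
    using \<delta> by simp
  then show ?thesis
    using separation w by linarith
qed

lemma multiple_split: "real i * \<delta>' = real i * \<delta> + real i * (\<delta>' - \<delta>)"
  by (simp add: algebra_simps)

lemma widening_mono: "i \<le> j \<Longrightarrow> real i * (\<delta>' - \<delta>) \<le> real j * (\<delta>' - \<delta>)"
  using \<delta> by (intro mult_right_mono) auto

lemma zone_top_room: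
  assumes "i < m"
  shows "w + real i * \<delta>' + (\<delta>' - \<delta>) < 1"
proof -
  have "real i * \<delta>' \<le> (real m - 1) * \<delta>'"
    using assms \<delta> gap_length_pos by (intro mult_right_mono) auto
  also have "\<dots> = (real m - 1) * \<delta> + real m * (\<delta>' - \<delta>) - (\<delta>' - \<delta>)"
    by (simp add: algebra_simps)
  finally show ?thesis
    using one_turn by linarith
qed

lemma zone_top_less_1: "i < m \<Longrightarrow> w + real i * \<delta>' < 1"
  using zone_top_room[of i] \<delta> by linarith

lemma zone_top_in_circle: "zone_top i \<in> circle"
  by (simp add: zone_top_def frac_in_circle)

lemma pos_zone_top:
  assumes "i < m"
  shows "pos (zone_top i) = w + real i * \<delta>'"
proof -
  have "pos (zone_top i) = frac (frac (p + w + real i * \<delta>') + - p)"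
    by (simp add: pos_def zone_top_def)
  also have "\<dots> = frac (w + real i * \<delta>')"
    by (simp only: frac_add_simps) simp
  also have "\<dots> = w + real i * \<delta>'"
    using zone_top_less_1[OF assms] w \<delta> gap_length_pos by simp
  finally show ?thesis .
qed

lemma zone_top_in_zone_imp_eq:
  assumes "zone_top j \<in> zone i" "i < m" "j < m"
  shows "i = j"
proof (rule ccontr)
  have bounds: "real i * \<delta> \<le> w + real j * \<delta>'" "real j * \<delta>' \<le> real i * \<delta>'"
    using assms by (simp_all add: zone_def pos_zone_top)
  assume "i \<noteq> j"
  moreover have "\<not> i < j"
    using bounds(2) \<delta> gap_length_pos by (simp add: mult_le_cancel_right)
  ultimately have "real j + 1 \<le> real i"
    by linarith
  then have "(real j + 1) * \<delta> \<le> real i * \<delta>"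
    using gap_length_pos by (intro mult_right_mono) auto
  then have "real j * \<delta> + \<delta> \<le> w + real j * \<delta>'"
    using bounds(1) by (simp add: algebra_simps)
  then show False
    using multiple_split[of j] widening_mono[of j m] assms(3) separation by linarith
qed

lemma pos_outside_gap:
  assumes "x \<in> circle" "a \<in> circle" "pos a < w" "x \<notin> open_arc a \<delta>"
  shows "pos x \<le> w \<or> \<delta> \<le> pos x"
proof (cases "frac (x - a) = 0")
  case True
  then show ?thesis
    using circle_eqI[OF assms(1,2)] assms(3) by simp
next
  case False
  then have "\<delta> \<le> frac (x - a)"
    using assms(4) frac_ge_0[of "x - a"] unfolding open_arc_def mem_Collect_eq by linarith
  then show ?thesis
    using frac_diff_eq_pos[of x a] assms(3) pos_bounds(1)[of a] by (auto split: if_splits)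
qed

lemma gap_widens:
  assumes a: "pos a < w" "X \<inter> open_arc a \<delta> = {}" and X: "X \<inter> zone 1 \<subseteq> {zone_top 1}"
  shows "X \<inter> open_arc a \<delta>' = {}"
proof (intro equals0I)
  fix x assume x: "x \<in> X \<inter> open_arc a \<delta>'"
  then have "x \<notin> open_arc a \<delta>"
    using a(2) by blast
  then have xa: "\<delta> \<le> frac (x - a)" "frac (x - a) < \<delta>'"
    using x by (auto simp: open_arc_def)
  have w\<delta>': "w + \<delta>' < 1"
    using zone_top_less_1[of 1] m by simp
  show False
  proof (cases "pos a \<le> pos x")
    case True
    then have pos_x: "pos x = frac (x - a) + pos a"
      using frac_diff_eq_pos[of x a] by simp
    then have "x \<in> zone 1"
      using xa a(1) pos_bounds(1)[of a] by (simp add: zone_def)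
    then have "pos x = w + \<delta>'"
      using X x pos_zone_top[of 1] m by auto
    then show False
      using pos_x xa(2) a(1) by simp
  next
    case False
    then have "frac (x - a) = pos x - pos a + 1"
      using frac_diff_eq_pos[of x a] by simp
    then show False
      using xa(2) a(1) pos_bounds(1)[of x] w\<delta>' by linarith
  qed
qed

text \<open>The obstruction to pushing a point of the \<open>i\<close>th zone to its top lies in the next zone, or,
  for \<open>i = m - 1\<close>, in the gap.\<close>

lemma no_obstruction_to_zone_top:
  assumes i: "1 \<le> i" "i < m" and y: "y \<in> zone i" and x: "pos x \<le> w \<or> \<delta> \<le> pos x"
    and next_zone: "Suc i < m \<Longrightarrow> x \<in> zone (Suc i) \<Longrightarrow> x = zone_top (Suc i)"
  shows "frac (x - y) \<notin> {\<delta>..<frac (zone_top i - y) + \<delta>'}"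
proof
  assume "frac (x - y) \<in> {\<delta>..<frac (zone_top i - y) + \<delta>'}"
  moreover have "real i * \<delta> \<le> pos y" "pos y \<le> pos (zone_top i)"
    using y pos_zone_top[OF i(2)] by (simp_all add: zone_def)
  moreover have "real (Suc i) * \<delta> = real i * \<delta> + \<delta>" "real (Suc i) * \<delta>' = real i * \<delta>' + \<delta>'"
    by (simp_all add: algebra_simps)
  ultimately have lower: "real (Suc i) * \<delta> \<le> frac (x - y) + pos y"
    and upper: "frac (x - y) + pos y < w + real (Suc i) * \<delta>'"
    using frac_diff_eq_pos[of "zone_top i" y] pos_zone_top[OF i(2)] by auto
  have turn: "frac (x - y) + pos y = (if pos y \<le> pos x then pos x else pos x + 1)"
    using frac_diff_eq_pos[of x y] by simp
  show False
  proof (cases "Suc i < m")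
    case True
    then have "frac (x - y) + pos y < 1"
      using upper zone_top_less_1[of "Suc i"] by linarith
    then have "pos x = frac (x - y) + pos y"
      using turn pos_bounds(1)[of x] by (simp split: if_splits)
    then have "x \<in> zone (Suc i)" "pos x < pos (zone_top (Suc i))"
      using lower upper pos_zone_top[OF True] by (simp_all add: zone_def)
    then show False
      using next_zone[OF True] by auto
  next
    case False
    then have im: "Suc i = m"
      using i by simp
    have "1 + w < frac (x - y) + pos y"
      using lower full_turn widening_mono[of 0 m] w unfolding im by simp
    then have pos_x: "w < pos x" "frac (x - y) + pos y = pos x + 1"
      using turn pos_bounds(2)[of x] w by (auto split: if_splits)
    have "real m * \<delta>' = (real m - 1) * \<delta> + \<delta> + real m * (\<delta>' - \<delta>)"
      by (simp add: algebra_simps)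
    then have "pos x < \<delta>"
      using upper pos_x(2) one_turn unfolding im by linarith
    then show False
      using x pos_x(1) by linarith
  qed
qed

lemma zone_top_dominates:
  assumes e: "\<And>a. a \<in> circle \<Longrightarrow> \<delta> \<le> e a \<and> e a \<le> \<delta>'"
    and i: "1 \<le> i" "i < m" and y: "y \<in> \<rho>" "y \<in> zone i"
    and \<rho>: "\<rho> \<in> gap_complex e X" "zone_top i \<in> X" and gap: "\<And>x. x \<in> \<rho> \<Longrightarrow> pos x \<le> w \<or> \<delta> \<le> pos x"
    and next_zone: "\<And>x. Suc i < m \<Longrightarrow> x \<in> \<rho> \<inter> zone (Suc i) \<Longrightarrow> x = zone_top (Suc i)"
  shows "insert (zone_top i) \<rho> \<in> gap_complex e X"
proof (rule insert_gap_face_up[OF e \<rho>(1) y(1) \<rho>(2) zone_top_in_circle])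
  have "real 1 * \<delta> \<le> real i * \<delta>"
    using i gap_length_pos by (intro mult_right_mono) auto
  then have "\<delta> \<le> pos y"
    using y(2) by (simp add: zone_def)
  moreover have "frac (zone_top i - y) = pos (zone_top i) - pos y"
    using frac_diff_eq_pos[of "zone_top i" y] y(2) pos_zone_top[OF i(2)] by (simp add: zone_def)
  ultimately show "frac (zone_top i - y) \<le> 1 - \<delta>'"
    using zone_top_room[OF i(2)] pos_zone_top[OF i(2)] by linarith
  fix x assume "x \<in> \<rho>"
  then show "frac (x - y) \<notin> {\<delta>..<frac (zone_top i - y) + \<delta>'}"
    using next_zone by (intro no_obstruction_to_zone_top[OF i y(2) gap]) auto
qed

definition below_top :: "real set \<Rightarrow> real set" where
  "below_top X = {x \<in> X. \<exists>i\<in>{1..<m}. x \<in> zone i \<and> x \<noteq> zone_top i}"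

lemma zone_top_notin_below_top: "i < m \<Longrightarrow> zone_top i \<notin> below_top X"
  by (auto simp: below_top_def dest!: zone_top_in_zone_imp_eq)

context
  fixes e :: "real \<Rightarrow> real" and X :: "real set" and a :: real
  assumes e: "\<And>a. a \<in> circle \<Longrightarrow> \<delta> \<le> e a \<and> e a \<le> \<delta>'"
    and X: "finite X" "X \<noteq> {}" "X \<subseteq> circle"
    and closed: "\<And>i. 1 \<le> i \<Longrightarrow> i < m \<Longrightarrow> X \<inter> zone i \<noteq> {} \<Longrightarrow> zone_top i \<in> X"
    and a: "a \<in> circle" "pos a < w" "X \<inter> open_arc a \<delta> = {}"
begin

lemma contractible_delete_below_top: "contractible_complex {\<sigma> \<in> gap_complex e X. \<sigma> \<inter> below_top X = {}}"
proof -
  have "\<exists>i<m. zone_top i \<in> X - below_top X" if x: "x \<in> below_top X" for x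
  proof -
    obtain i where "1 \<le> i" "i < m" "x \<in> X \<inter> zone i"
      using x by (auto simp: below_top_def)
    then show ?thesis
      using closed[of i] zone_top_notin_below_top[of i] by blast
  qed
  then have nonempty: "X - below_top X \<noteq> {}"
    using X(2) by blast
  have "(X - below_top X) \<inter> open_arc a \<delta>' = {}"
    using a(3) m by (intro gap_widens[OF a(2)]) (auto simp: below_top_def)
  then have "(X - below_top X) \<inter> open_arc a (e a) = {}"
    using open_arc_mono[of "e a" \<delta>' a] e[OF a(1)] by blast
  then have "X - below_top X \<in> gap_complex e X"
    using X(1) nonempty by (intro gap_complexI[OF _ _ _ a(1)]) auto
  then show ?thesis
    unfolding gap_complex_delete
    using X(1) nonempty by (simp add: gap_complex_of_face contractible_all_faces)
qed

lemma highest_zone_dominated: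
  assumes M: "M \<subseteq> below_top X" "M \<noteq> {}"
  obtains y i where "y \<in> M" "i < m" "y \<noteq> zone_top i"
    "\<And>\<rho>. \<rho> \<in> gap_complex e X \<Longrightarrow> \<rho> \<inter> (below_top X - M) = {} \<Longrightarrow> y \<in> \<rho> \<Longrightarrow>
      insert (zone_top i) \<rho> \<in> gap_complex e X"
proof -
  define J where "J = {i \<in> {1..<m}. \<exists>x\<in>M. x \<in> zone i \<and> x \<noteq> zone_top i}"
  have J: "finite J" "J \<noteq> {}"
    using M by (auto simp: J_def below_top_def)
  define i where "i = Max J"
  have "i \<in> J"
    using J by (simp add: i_def)
  then obtain y where i: "1 \<le> i" "i < m" and y: "y \<in> M" "y \<in> zone i" "y \<noteq> zone_top i"
    by (auto simp: J_def)
  have top: "zone_top i \<in> X"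
    using closed[OF i] y M(1) by (auto simp: below_top_def)
  have last: "Suc i \<notin> J"
    using Max_ge[OF J(1), of "Suc i"] by (auto simp: i_def)
  show ?thesis
  proof (rule that[OF y(1) i(2) y(3)])
    fix \<rho> assume \<rho>: "\<rho> \<in> gap_complex e X" "\<rho> \<inter> (below_top X - M) = {}" "y \<in> \<rho>"
    note \<rho>X = gap_complexD(1)[OF \<rho>(1)]
    show "insert (zone_top i) \<rho> \<in> gap_complex e X"
    proof (rule zone_top_dominates[OF e i \<rho>(3) y(2) \<rho>(1) top])
      show "pos x \<le> w \<or> \<delta> \<le> pos x" if "x \<in> \<rho>" for x
        using that \<rho>X X(3) a(3) by (intro pos_outside_gap[OF _ a(1,2)]) auto
      show "x = zone_top (Suc i)" if "Suc i < m" "x \<in> \<rho> \<inter> zone (Suc i)" for x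
      proof (rule ccontr)
        assume "x \<noteq> zone_top (Suc i)"
        moreover from this have "x \<in> below_top X"
          using that \<rho>X by (auto simp: below_top_def)
        ultimately show False
          using that last \<rho>(2) by (auto simp: J_def)
      qed
    qed
  qed
qed

lemma contractible_zone_closed: "contractible_complex (gap_complex e X)"
proof (rule contractible_dismantling[OF abstract_complex_gap _ contractible_delete_below_top])
  show "finite (below_top X)"
    using X(1) by (simp add: below_top_def)
  fix M assume "M \<subseteq> below_top X" "M \<noteq> {}"
  then obtain y i where "y \<in> M" "i < m" "y \<noteq> zone_top i"
    "\<And>\<rho>. \<rho> \<in> gap_complex e X \<Longrightarrow> \<rho> \<inter> (below_top X - M) = {} \<Longrightarrow> y \<in> \<rho> \<Longrightarrow>
      insert (zone_top i) \<rho> \<in> gap_complex e X"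
    by (rule highest_zone_dominated) blast
  then show "\<exists>y\<in>M. \<exists>g. g \<noteq> y \<and> g \<notin> below_top X - M \<and>
      (\<forall>\<rho>\<in>gap_complex e X. \<rho> \<inter> (below_top X - M) = {} \<longrightarrow> y \<in> \<rho> \<longrightarrow> insert g \<rho> \<in> gap_complex e X)"
    using zone_top_notin_below_top by (intro bexI[of _ y] exI[of _ "zone_top i"]) auto
qed

end

definition zone_closure :: "real set \<Rightarrow> real set" where
  "zone_closure \<sigma> = \<sigma> \<union> zone_top ` {i \<in> {1..<m}. \<sigma> \<inter> zone i \<noteq> {}}"

lemma subset_zone_closure: "\<sigma> \<subseteq> zone_closure \<sigma>"
  by (simp add: zone_closure_def)

lemma zone_closure_mono: "\<tau> \<subseteq> \<sigma> \<Longrightarrow> zone_closure \<tau> \<subseteq> zone_closure \<sigma>"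
  by (auto simp: zone_closure_def)

lemma zone_closure_subset_circle: "\<sigma> \<subseteq> circle \<Longrightarrow> zone_closure \<sigma> \<subseteq> circle"
  by (auto simp: zone_closure_def zone_top_in_circle)

lemma zone_top_not_in_gap:
  assumes "pos a < w" "1 \<le> i" "i < m"
  shows "zone_top i \<notin> open_arc a \<delta>"
proof -
  have "real 1 * \<delta>' \<le> real i * \<delta>'"
    using assms(2) \<delta> gap_length_pos by (intro mult_right_mono) auto
  then have "pos a + \<delta> \<le> pos (zone_top i)"
    using pos_zone_top[OF assms(3)] assms(1) \<delta> by simp
  then show ?thesis
    using frac_diff_eq_pos[of "zone_top i" a] gap_length_pos by (simp add: open_arc_def)
qed

lemma contractible_zone_closure:
  assumes e: "\<And>a. a \<in> circle \<Longrightarrow> \<delta> \<le> e a \<and> e a \<le> \<delta>'"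
    and \<sigma>: "finite \<sigma>" "\<sigma> \<noteq> {}" "\<sigma> \<subseteq> circle" and a: "a \<in> circle" "pos a < w" "\<sigma> \<inter> open_arc a \<delta> = {}"
  shows "contractible_complex (gap_complex e (zone_closure \<sigma>))"
proof (rule contractible_zone_closed[OF e _ _ _ _ a(1,2)])
  show "zone_top i \<in> zone_closure \<sigma>" if "1 \<le> i" "i < m" "zone_closure \<sigma> \<inter> zone i \<noteq> {}" for i
    using that zone_top_in_zone_imp_eq by (auto simp: zone_closure_def)
  show "zone_closure \<sigma> \<inter> open_arc a \<delta> = {}"
    using a(3) zone_top_not_in_gap[OF a(2)] by (auto simp: zone_closure_def)
qed (use \<sigma> zone_closure_subset_circle in \<open>auto simp: zone_closure_def\<close>)

definition widened :: "real set \<Rightarrow> real \<Rightarrow> real" where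
  "widened S a = (if a \<in> S then \<delta>' else \<delta>)"

lemma widened_bounds: "\<delta> \<le> widened S a \<and> widened S a \<le> \<delta>'"
  using \<delta> by (simp add: widened_def)

lemma gap_lost_by_widening:
  assumes "\<sigma> \<in> gap_complex (widened S) circle - gap_complex (widened (S \<union> I)) circle"
  obtains a where "a \<in> I" "a \<in> circle" "\<sigma> \<inter> open_arc a \<delta> = {}"
proof -
  obtain a where \<sigma>: "\<sigma> \<subseteq> circle" "finite \<sigma>" "\<sigma> \<noteq> {}" and a: "a \<in> circle" "\<sigma> \<inter> open_arc a (widened S a) = {}"
    using assms by (auto simp: gap_complex_def)
  then have "widened (S \<union> I) a \<noteq> widened S a"
    using assms gap_complexI[OF \<sigma> a(1)] by auto
  then show ?thesis
    using that[of a] a by (auto simp: widened_def split: if_splits)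
qed

lemma widening_equivalence:
  defines "I \<equiv> {a \<in> circle. pos a < w}"
  shows "homotopy_equivalence_map (realization (gap_complex (widened (S \<union> I)) circle))
           (realization (gap_complex (widened S) circle)) id"
proof -
  let ?K = "gap_complex (widened S) circle" and ?M = "gap_complex (widened (S \<union> I)) circle"
  define \<Psi> where "\<Psi> \<sigma> = gap_complex (widened (S \<union> I)) (zone_closure \<sigma>)" for \<sigma>
  define \<Theta> where "\<Theta> \<sigma> = gap_complex (widened S) (zone_closure \<sigma>)" for \<sigma>
  have antimono: "gap_complex (widened (S \<union> I)) X \<subseteq> gap_complex (widened S) X" for X
    using \<delta> by (intro gap_complex_antimono) (simp add: widened_def)
  show ?thesis
  proof (rule inclusion_homotopy_equivalence[OF abstract_complex_gap abstract_complex_gap antimono,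
        where \<Psi> = \<Psi> and \<Theta> = \<Theta>])
    fix \<sigma> assume \<sigma>: "\<sigma> \<in> ?K - ?M"
    then have \<sigma>K: "\<sigma> \<in> ?K"
      by blast
    note \<sigma>D = gap_complexD[OF \<sigma>K]
    obtain a where a: "a \<in> circle" "pos a < w" "\<sigma> \<inter> open_arc a \<delta> = {}"
      using gap_lost_by_widening[OF \<sigma>] by (auto simp: I_def)
    show "contractible_complex (\<Psi> \<sigma>)" "contractible_complex (\<Theta> \<sigma>)"
      unfolding \<Psi>_def \<Theta>_def by (rule contractible_zone_closure[OF widened_bounds \<sigma>D(2,3,1) a])+
    show "\<Psi> \<sigma> \<subseteq> ?M" "\<Theta> \<sigma> \<subseteq> ?K"
      unfolding \<Psi>_def \<Theta>_def by (intro gap_complex_mono zone_closure_subset_circle \<sigma>D(1))+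
    show "\<Psi> \<sigma> \<subseteq> \<Theta> \<sigma>"
      unfolding \<Psi>_def \<Theta>_def by (rule antimono)
    show "\<sigma> \<in> \<Theta> \<sigma>"
      unfolding \<Theta>_def by (rule gap_complex_restrict[OF \<sigma>K subset_zone_closure])
    fix \<tau> assume \<tau>: "\<tau> \<subseteq> \<sigma>"
    show "\<Psi> \<tau> \<subseteq> \<Psi> \<sigma>" "\<Theta> \<tau> \<subseteq> \<Theta> \<sigma>"
      unfolding \<Psi>_def \<Theta>_def by (intro gap_complex_mono zone_closure_mono \<tau>)+
    assume "\<tau> \<in> ?M"
    then show "\<tau> \<in> \<Psi> \<sigma>"
      unfolding \<Psi>_def by (rule gap_complex_restrict[OF _ order_trans[OF \<tau> subset_zone_closure]])
  qed
qed

end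

lemma homotopy_equivalence_map_id_chain:
  fixes X :: "nat \<Rightarrow> 'a topology"
  assumes "\<And>k. k < N \<Longrightarrow> homotopy_equivalence_map (X (Suc k)) (X k) id"
  shows "homotopy_equivalence_map (X N) (X 0) id"
  using assms
proof (induction N)
  case (Suc N)
  have last: "homotopy_equivalence_map (X (Suc N)) (X N) id"
    by (rule Suc.prems) simp
  have "homotopy_equivalence_map (X N) (X 0) id"
    by (rule Suc.IH, rule Suc.prems) simp
  from homotopy_equivalence_map_compose[OF last this] show ?case
    by (simp only: comp_id)
qed (rule homotopy_equivalence_map_id)

lemma circle_covered_by_arcs:
  assumes w: "0 < w" "1 < w * real N" and a: "a \<in> circle"
  shows "\<exists>j<N. frac (a - real j * w) < w"
proof -
  define j where "j = nat \<lfloor>a / w\<rfloor>"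
  have a01: "0 \<le> a" "a < 1"
    using a by (simp_all add: circle_def)
  then have "real j \<le> a / w" "a / w < real j + 1"
    using w by (simp_all add: j_def)
  then have j: "0 \<le> a - real j * w" "a - real j * w < w"
    using w by (simp_all add: field_simps)
  moreover have "a - real j * w < 1"
    using a01 w mult_nonneg_nonneg[of "real j" w] by linarith
  ultimately have "frac (a - real j * w) < w"
    by simp
  moreover have "w * real j < w * real N"
    using j(1) a01 w(2) by (simp add: mult.commute)
  then have "j < N"
    using w(1) by simp
  ultimately show ?thesis
    by blast
qed

lemma gap_complex_small_inclusion_equivalence:
  fixes m :: nat and \<delta> \<delta>' :: real
  assumes m: "2 \<le> m" and \<delta>: "\<delta> \<le> \<delta>'"
    and small: "real m * (\<delta>' - \<delta>) < min (real m * \<delta> - 1) (min (1 - (real m - 1) * \<delta>) \<delta>)" (is "?width < ?slack")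
  shows "homotopy_equivalence_map (realization (gap_complex (\<lambda>_. \<delta>') circle))
           (realization (gap_complex (\<lambda>_. \<delta>) circle)) id"
proof -
  obtain s where s: "?width < s" "s < ?slack"
    using dense[OF small] by blast
  define w where "w = s - ?width"
  have w: "0 < w" "w + ?width < ?slack"
    using s by (simp_all add: w_def)
  then have widening: "gap_widening m \<delta> \<delta>' w"
    using m \<delta> by unfold_locales auto
  define I where "I j = {a \<in> circle. frac (a - real j * w) < w}" for j
  define e where "e n a = (if a \<in> (\<Union>j<n. I j) then \<delta>' else \<delta>)" for n :: nat and a
  obtain N :: nat where N: "1 / w < real N"
    using reals_Archimedean2 by blast
  have "homotopy_equivalence_map (realization (gap_complex (e N) circle)) (realization (gap_complex (e 0) circle)) id"
  proof (rule homotopy_equivalence_map_id_chain[of N "\<lambda>n. realization (gap_complex (e n) circle)"])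
    fix n
    interpret gap_widening m \<delta> \<delta>' w "real n * w"
      by (rule widening)
    have "e n = widened (\<Union>j<n. I j)" "e (Suc n) = widened ((\<Union>j<n. I j) \<union> {a \<in> circle. pos a < w})"
      by (auto simp: fun_eq_iff e_def widened_def I_def pos_def less_Suc_eq)
    then show "homotopy_equivalence_map (realization (gap_complex (e (Suc n)) circle))
        (realization (gap_complex (e n) circle)) id"
      by (simp add: widening_equivalence)
  qed
  moreover have "e 0 = (\<lambda>_. \<delta>)"
    by (simp add: fun_eq_iff e_def)
  moreover have "gap_complex (e N) circle = gap_complex (\<lambda>_. \<delta>') circle"
  proof -
    have "e N a = \<delta>'" if "a \<in> circle" for a
      using circle_covered_by_arcs[OF w(1) _ that, of N] N w(1) that by (auto simp: e_def I_def field_simps)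
    then show ?thesis
      by (auto simp: gap_complex_def)
  qed
  ultimately show ?thesis
    by simp
qed

lemma gap_complex_inclusion_equivalence:
  fixes m :: nat and \<delta> \<delta>' :: real
  assumes m: "2 \<le> m" and \<delta>: "1 < real m * \<delta>" "\<delta> \<le> \<delta>'" "(real m - 1) * \<delta>' < 1"
  shows "homotopy_equivalence_map (realization (gap_complex (\<lambda>_. \<delta>') circle))
           (realization (gap_complex (\<lambda>_. \<delta>) circle)) id"
proof -
  define \<mu> where "\<mu> = min (real m * \<delta> - 1) (min (1 - (real m - 1) * \<delta>') \<delta>)"
  have "0 < \<delta>"
    using \<delta>(1) m zero_less_mult_pos[of "real m" \<delta>] by linarith
  then have \<mu>: "0 < \<mu>"
    using \<delta> by (simp add: \<mu>_def)
  obtain N :: nat where N: "real m * (\<delta>' - \<delta>) / \<mu> < real N"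
    using reals_Archimedean2 by blast
  have "0 \<le> real m * (\<delta>' - \<delta>) / \<mu>"
    using \<delta> \<mu> by simp
  then have N_pos: "0 < real N"
    using N by linarith
  define D where "D = (\<delta>' - \<delta>) / real N"
  have D: "0 \<le> D" "real m * D < \<mu>" "\<delta> + real N * D = \<delta>'"
    using \<delta> N_pos N \<mu> by (auto simp: D_def field_simps)
  have "homotopy_equivalence_map (realization (gap_complex (\<lambda>_. \<delta> + real N * D) circle))
           (realization (gap_complex (\<lambda>_. \<delta> + real 0 * D) circle)) id"
  proof (rule homotopy_equivalence_map_id_chain[of N "\<lambda>k. realization (gap_complex (\<lambda>_. \<delta> + real k * D) circle)"])
    fix k assume "k < N"
    let ?\<delta>\<^sub>k = "\<delta> + real k * D"
    have step: "\<delta> + real (Suc k) * D - ?\<delta>\<^sub>k = D"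
      by (simp add: algebra_simps)
    have "real k * D \<le> real N * D"
      using \<open>k < N\<close> D by (intro mult_right_mono) auto
    then have between: "\<delta> \<le> ?\<delta>\<^sub>k" "?\<delta>\<^sub>k \<le> \<delta>'"
      using D by auto
    have "real m * \<delta> \<le> real m * ?\<delta>\<^sub>k" "(real m - 1) * ?\<delta>\<^sub>k \<le> (real m - 1) * \<delta>'"
      using between m by (auto intro!: mult_left_mono)
    then have "real m * D < min (real m * ?\<delta>\<^sub>k - 1) (min (1 - (real m - 1) * ?\<delta>\<^sub>k) ?\<delta>\<^sub>k)"
      using D(2) between by (simp add: \<mu>_def)
    then have "real m * (\<delta> + real (Suc k) * D - ?\<delta>\<^sub>k) < min (real m * ?\<delta>\<^sub>k - 1) (min (1 - (real m - 1) * ?\<delta>\<^sub>k) ?\<delta>\<^sub>k)"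
      by (simp only: step)
    moreover have "?\<delta>\<^sub>k \<le> \<delta> + real (Suc k) * D"
      using D(1) step by linarith
    ultimately show "homotopy_equivalence_map (realization (gap_complex (\<lambda>_. \<delta> + real (Suc k) * D) circle))
        (realization (gap_complex (\<lambda>_. ?\<delta>\<^sub>k) circle)) id"
      by (intro gap_complex_small_inclusion_equivalence[OF m])
  qed
  then show ?thesis
    using D(3) by simp
qed

subsection \<open>Critical gap lengths\<close>

text \<open>For \<open>d = 1/m\<close> a face contains at most one coset of the \<open>m\<close>-gon \<open>polygon m\<close>, apart from the
  \<open>m\<close>-gon itself. The complex deforms onto the spheres formed by the proper subsets of
  \<open>coset m s \<union> polygon m\<close>, which share the simplex on \<open>polygon m\<close>.\<close>

definition coset_free :: "nat \<Rightarrow> real set \<Rightarrow> bool" where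
  "coset_free m \<rho> \<longleftrightarrow> (\<forall>s\<in>{0<..<1}. \<not> coset m s \<subseteq> \<rho>)"

definition sphere_bouquet :: "nat \<Rightarrow> real set set" where
  "sphere_bouquet m = (\<Union>s\<in>{0<..<1}. simplex_boundary (coset m s \<union> polygon m))"

abbreviation critical_complex :: "nat \<Rightarrow> real set set" where
  "critical_complex m \<equiv> gap_complex (\<lambda>_. 1 / real m) circle"

lemma coset_free_subset: "coset_free m \<sigma> \<Longrightarrow> \<tau> \<subseteq> \<sigma> \<Longrightarrow> coset_free m \<tau>"
  unfolding coset_free_def by blast

lemma mem_sphere_bouquet:
  "\<rho> \<in> sphere_bouquet m \<longleftrightarrow> \<rho> \<noteq> {} \<and> (\<exists>s. 0 < s \<and> s < 1 \<and> \<rho> \<subset> coset m s \<union> polygon m)"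
  by (auto simp: sphere_bouquet_def mem_simplex_boundary)

lemma coset_polygon_disjoint: "0 < s \<Longrightarrow> coset m s \<inter> polygon m = {}"
  by (rule coset_disjoint) simp

lemma coset_free_insert_polygon:
  assumes "coset_free m \<rho>" "z \<in> polygon m"
  shows "coset_free m (insert z \<rho>)"
  using assms coset_polygon_disjoint unfolding coset_free_def by fastforce

context
  fixes m :: nat
  assumes m: "2 \<le> m"
begin

lemma m_pos: "0 < m"
  using m by simp

lemma abstract_complex_sphere_bouquet: "abstract_complex (sphere_bouquet m)"
  unfolding sphere_bouquet_def
  using finite_coset[OF m_pos] by (auto intro!: abstract_complex_Union abstract_complex_simplex_boundary)

lemma sphere_bouquet_subset_critical: "sphere_bouquet m \<subseteq> critical_complex m"
proof
  fix \<rho> assume "\<rho> \<in> sphere_bouquet m"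
  then obtain s where s: "0 < s" "s < 1" and \<rho>: "\<rho> \<subset> coset m s \<union> polygon m" "\<rho> \<noteq> {}"
    unfolding mem_sphere_bouquet by blast
  let ?V = "coset m s \<union> polygon m"
  have distance: "real m * frac (x - a) = (if phase m a = 0 then s else 1 - s)"
    if "a \<in> ?V" "x \<in> ?V \<inter> open_arc a (1 / real m)" for a x
  proof -
    have "0 < frac (x - a)" "frac (x - a) < 1 / real m"
      using that(2) by (simp_all add: open_arc_def)
    then have "real m * frac (x - a) = frac (phase m x - phase m a)" "0 < real m * frac (x - a)"
      using m_pos phase_of_short_arc[of m "x - a"] by (simp_all add: phase_diff)
    moreover have "phase m x \<in> {0, s}" "phase m a \<in> {0, s}"
      using that by (auto simp: mem_coset)
    moreover have "frac (- s) = 1 - s"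
      using frac_non_zero[of s] s by simp
    ultimately show ?thesis
      using s by auto
  qed
  show "\<rho> \<in> critical_complex m"
  proof (rule proper_subset_in_gap_complex[OF _ _ \<rho>])
    fix a x y assume axy: "a \<in> ?V" "x \<in> ?V \<inter> open_arc a (1 / real m)" "y \<in> ?V \<inter> open_arc a (1 / real m)"
    have "real m * frac (x - a) = real m * frac (y - a)"
      using distance[OF axy(1,2)] distance[OF axy(1,3)] by simp
    then have "frac (x - y) = 0"
      using frac_diff_relative[of x y a] m_pos by simp
    then show "x = y"
      using circle_eqI[of x y] axy(2,3) coset_subset_circle by blast
  qed (use finite_coset[OF m_pos] coset_subset_circle in auto)
qed

subsubsection \<open>The coset contained in a face\<close>

lemma next_in_coset:
  assumes "0 \<le> s" "s < 1"
  obtains z where "z \<in> coset m s" "frac (z - a) < 1 / real m"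
proof
  let ?step = "frac (s - phase m a) / real m"
  have "phase m (frac (a + ?step)) = frac s"
    using m_pos by (simp add: phase_frac phase_add phase_divide)
  then show "frac (a + ?step) \<in> coset m s"
    using assms by (simp add: mem_coset frac_in_circle)
  have "?step < 1 / real m" "1 / real m \<le> 1"
    using m_pos frac_lt_1[of "s - phase m a"] by (simp_all add: divide_strict_right_mono)
  then have "0 \<le> ?step" "?step < 1"
    by (simp, linarith)
  then have "frac ?step = ?step"
    by (simp only: frac_eq)
  moreover have "frac (frac (a + ?step) - a) = frac ?step"
    using frac_add_simps(1)[of "a + ?step" "- a"] by simp
  ultimately show "frac (frac (a + ?step) - a) < 1 / real m"
    using \<open>?step < 1 / real m\<close> by simp
qed

lemma gap_start_in_coset:
  assumes s: "0 \<le> s" "s < 1" and a: "a \<in> circle" "\<sigma> \<inter> open_arc a (1 / real m) = {}" and "coset m s \<subseteq> \<sigma>"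
  shows "a \<in> coset m s"
proof -
  obtain z where z: "z \<in> coset m s" "frac (z - a) < 1 / real m"
    using next_in_coset[OF s, of a] .
  then have "\<not> 0 < frac (z - a)"
    using a(2) assms(5) by (auto simp: open_arc_def)
  then have "frac (z - a) = 0"
    using frac_ge_0[of "z - a"] by linarith
  then have "z = a"
    using circle_eqI[of z a] z(1) a(1) coset_subset_circle by blast
  then show ?thesis
    using z(1) by simp
qed

lemma coset_in_face_unique:
  assumes \<sigma>: "\<sigma> \<in> critical_complex m"
    and "0 \<le> s" "s < 1" "coset m s \<subseteq> \<sigma>" "0 \<le> s'" "s' < 1" "coset m s' \<subseteq> \<sigma>"
  shows "s = s'"
proof -
  obtain a where a: "a \<in> circle" "\<sigma> \<inter> open_arc a (1 / real m) = {}"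
    using \<sigma> by (auto simp: gap_complex_def)
  show ?thesis
    using gap_start_in_coset[OF assms(2,3) a assms(4)] gap_start_in_coset[OF assms(5,6) a assms(7)]
    by (simp add: mem_coset)
qed

definition coset_phase :: "real set \<Rightarrow> real" where
  "coset_phase \<sigma> = (SOME s. 0 < s \<and> s < 1 \<and> coset m s \<subseteq> \<sigma>)"

lemma coset_phase:
  assumes "\<not> coset_free m \<sigma>"
  shows "0 < coset_phase \<sigma>" "coset_phase \<sigma> < 1" "coset m (coset_phase \<sigma>) \<subseteq> \<sigma>"
proof -
  have "\<exists>s. 0 < s \<and> s < 1 \<and> coset m s \<subseteq> \<sigma>"
    using assms by (auto simp: coset_free_def)
  from someI_ex[OF this] show "0 < coset_phase \<sigma>" "coset_phase \<sigma> < 1" "coset m (coset_phase \<sigma>) \<subseteq> \<sigma>"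
    by (auto simp: coset_phase_def)
qed

lemma coset_phase_face:
  assumes "\<sigma> \<in> critical_complex m" "\<not> coset_free m \<tau>" "\<tau> \<subseteq> \<sigma>"
  shows "coset_phase \<tau> = coset_phase \<sigma>"
proof -
  have "\<not> coset_free m \<sigma>"
    using assms(2,3) coset_free_subset by blast
  then show ?thesis
    using coset_phase[of \<sigma>] coset_phase[OF assms(2)] assms(3)
    by (intro coset_in_face_unique[OF assms(1)]) auto
qed

subsubsection \<open>Pushing a face to the polygon between consecutive points of its coset\<close>

text \<open>The vertex of \<open>polygon m\<close> in the open arc between neighbours of \<open>coset m s\<close> that contains \<open>x\<close>.\<close>

definition arc_vertex :: "real \<Rightarrow> real \<Rightarrow> real" where
  "arc_vertex s x = frac (x - frac (phase m x - s) / real m + (1 - s) / real m)"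

definition shadow :: "real set \<Rightarrow> real set" where
  "shadow \<sigma> = arc_vertex (coset_phase \<sigma>) ` (\<sigma> - coset m (coset_phase \<sigma>))"

lemma arc_vertex_in_polygon: "arc_vertex s x \<in> polygon m"
proof -
  have "phase m (arc_vertex s x) = frac (frac (phase m x - frac (phase m x - s)) + (1 - s))"
    using m_pos by (simp add: arc_vertex_def phase_frac phase_add phase_diff phase_divide frac_diff_simp)
  also have "\<dots> = frac (frac s + (1 - s))"
    by (simp add: frac_diff_simp)
  also have "\<dots> = 0"
    by (simp only: frac_add_simps) simp
  finally show ?thesis
    by (simp add: mem_coset arc_vertex_def frac_in_circle)
qed

lemma arc_vertex_of_polygon:
  assumes "x \<in> polygon m" "0 < s" "s < 1"
  shows "arc_vertex s x = x"
proof -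
  have "frac (- s) = 1 - s"
    using frac_non_zero[of s] assms(2,3) by simp
  then show ?thesis
    using assms(1) by (simp add: arc_vertex_def mem_coset frac_circle)
qed

lemma arc_vertex_beyond_gap:
  assumes a: "a \<in> coset m s" and s: "0 < s" "s < 1"
    and x: "x \<in> circle" "x \<notin> coset m s" "x \<notin> open_arc a (1 / real m)"
  shows "1 / real m \<le> frac (arc_vertex s x - a)"
proof -
  let ?u = "real m * frac (x - a)"
  define n where "n = \<lfloor>?u\<rfloor>"
  have u_split: "?u = of_int n + frac ?u"
    by (simp add: n_def frac_def)
  have phase_u: "frac (phase m x - s) = frac ?u"
  proof -
    have "frac (phase m x - s) = phase m (x - a)"
      using a by (simp add: phase_diff mem_coset)
    then show ?thesis
      using phase_frac[of m "x - a"] by (simp add: phase_def)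
  qed
  have "frac (x - a) \<noteq> 0"
    using circle_eqI[OF x(1), of a] a x(2) coset_subset_circle by blast
  then have "1 / real m \<le> frac (x - a)"
    using x(3) frac_ge_0[of "x - a"] unfolding open_arc_def mem_Collect_eq by linarith
  then have "1 \<le> ?u"
    using m_pos by (simp add: field_simps)
  then have n_lower: "1 \<le> n"
    unfolding n_def by linarith
  have "?u < real m"
    using m_pos frac_lt_1[of "x - a"] by simp
  then have "n < int m"
    unfolding n_def by linarith
  then have n_upper: "real_of_int n + 1 \<le> real m"
    by linarith
  have "arc_vertex s x - a = frac (x - frac ?u / real m + (1 - s) / real m) - a"
    by (simp only: arc_vertex_def phase_u)
  then have "frac (arc_vertex s x - a) = frac (x - frac ?u / real m + (1 - s) / real m - a)"
    using frac_add_simps(1)[of _ "- a"] by simp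
  also have "x - frac ?u / real m + (1 - s) / real m - a = (of_int n + 1 - s) / real m + of_int \<lfloor>x - a\<rfloor>"
    using u_split m_pos by (simp add: frac_def field_simps)
  also have "frac \<dots> = frac ((of_int n + 1 - s) / real m)"
    by (rule frac_add_of_int_right)
  also have "\<dots> = (of_int n + 1 - s) / real m"
    using n_lower n_upper s m_pos by (simp add: frac_eq field_simps)
  finally show ?thesis
    using n_lower s by (simp add: divide_right_mono)
qed

lemma shadow_subset_polygon: "shadow \<sigma> \<subseteq> polygon m"
  using arc_vertex_in_polygon by (auto simp: shadow_def)

lemma finite_shadow: "finite \<sigma> \<Longrightarrow> finite (shadow \<sigma>)"
  by (simp add: shadow_def)

context
  fixes \<sigma>
  assumes \<sigma>: "\<sigma> \<in> critical_complex m" "\<not> coset_free m \<sigma>"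
begin

lemma gap_before_shadow:
  obtains a where "a \<in> circle" "\<sigma> \<inter> open_arc a (1 / real m) = {}" "\<And>x. x \<in> shadow \<sigma> \<Longrightarrow> 1 / real m \<le> frac (x - a)"
proof -
  obtain a where a: "a \<in> circle" "\<sigma> \<inter> open_arc a (1 / real m) = {}"
    using \<sigma>(1) by (auto simp: gap_complex_def)
  note s = coset_phase[OF \<sigma>(2)]
  have start: "a \<in> coset m (coset_phase \<sigma>)"
    using s by (intro gap_start_in_coset[OF _ _ a]) auto
  have "1 / real m \<le> frac (x - a)" if x: "x \<in> shadow \<sigma>" for x
  proof -
    obtain y where "x = arc_vertex (coset_phase \<sigma>) y" "y \<in> \<sigma>" "y \<notin> coset m (coset_phase \<sigma>)"
      using x by (auto simp: shadow_def)
    then show ?thesis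
      using arc_vertex_beyond_gap[OF start s(1,2), of y] gap_complexD(1)[OF \<sigma>(1)] a(2) by blast
  qed
  then show ?thesis
    using that a by blast
qed

lemma union_shadow_in_critical: "\<sigma> \<union> shadow \<sigma> \<in> critical_complex m"
proof -
  obtain a where a: "a \<in> circle" "\<sigma> \<inter> open_arc a (1 / real m) = {}"
    and beyond: "\<And>x. x \<in> shadow \<sigma> \<Longrightarrow> 1 / real m \<le> frac (x - a)"
    using gap_before_shadow by metis
  have "shadow \<sigma> \<subseteq> circle"
    using shadow_subset_polygon coset_subset_circle by blast
  moreover have "shadow \<sigma> \<inter> open_arc a (1 / real m) = {}"
    using beyond by (force simp: open_arc_def)
  ultimately show ?thesis
    using a gap_complexD[OF \<sigma>(1)] finite_shadow by (intro gap_complexI[of _ _ a]) auto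
qed

lemma shadow_misses_polygon_vertex: "\<not> polygon m \<subseteq> shadow \<sigma>"
proof -
  obtain a where beyond: "\<And>x. x \<in> shadow \<sigma> \<Longrightarrow> 1 / real m \<le> frac (x - a)"
    using gap_before_shadow by metis
  obtain z where "z \<in> polygon m" "frac (z - a) < 1 / real m"
    using next_in_coset[of 0 a] by auto
  then show ?thesis
    using beyond[of z] by auto
qed

lemma coset_union_shadow_in_bouquet: "coset m (coset_phase \<sigma>) \<union> shadow \<sigma> \<in> sphere_bouquet m"
proof -
  note s = coset_phase[OF \<sigma>(2)]
  have "coset m (coset_phase \<sigma>) \<union> shadow \<sigma> \<subset> coset m (coset_phase \<sigma>) \<union> polygon m"
    using shadow_subset_polygon shadow_misses_polygon_vertex coset_polygon_disjoint[OF s(1)] by blast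
  then show ?thesis
    using s coset_nonempty[OF m_pos, of "coset_phase \<sigma>"] by (auto simp: mem_sphere_bouquet)
qed

lemma shadow_nonempty:
  assumes "\<sigma> \<notin> sphere_bouquet m"
  shows "shadow \<sigma> \<noteq> {}"
proof
  assume empty: "shadow \<sigma> = {}"
  then have "\<sigma> = coset m (coset_phase \<sigma>)"
    using coset_phase(3)[OF \<sigma>(2)] by (auto simp: shadow_def)
  then show False
    using coset_union_shadow_in_bouquet empty assms by simp
qed

lemma shadow_mono:
  assumes "\<tau> \<subseteq> \<sigma>" "\<not> coset_free m \<tau>"
  shows "shadow \<tau> \<subseteq> shadow \<sigma>"
  using assms coset_phase_face[OF \<sigma>(1) assms(2,1)] unfolding shadow_def by auto

lemma polygon_part_in_shadow: "\<sigma> \<inter> polygon m \<subseteq> shadow \<sigma>"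
proof
  fix x assume x: "x \<in> \<sigma> \<inter> polygon m"
  note s = coset_phase[OF \<sigma>(2)]
  have "x = arc_vertex (coset_phase \<sigma>) x"
    using x arc_vertex_of_polygon s(1,2) by simp
  moreover have "x \<in> \<sigma> - coset m (coset_phase \<sigma>)"
    using x coset_polygon_disjoint[OF s(1)] by blast
  ultimately show "x \<in> shadow \<sigma>"
    unfolding shadow_def by blast
qed

end

subsubsection \<open>Faces without full cosets\<close>

lemma contractible_gap_with_polygon:
  assumes X: "finite X" "X \<subseteq> circle" "polygon m \<subseteq> X" and free: "coset_free m X"
  shows "contractible_complex (gap_complex (\<lambda>_. 1 / real m) X)"
proof -
  have "contractible_complex (gap_complex (\<lambda>_. real 1 / real m) X)"
  proof (rule contractible_polygon_rounding)
    show "polygon_floor m ` X \<subseteq> X"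
      using polygon_floor_in_polygon[OF m_pos] X by blast
    show "\<exists>k::nat. frac (y - real k * (real 1 / real m)) \<notin> X" if y: "y \<in> X - polygon m" for y
    proof -
      have yc: "y \<in> coset m (phase m y)" "phase m y \<noteq> 0"
        using y X(2) by (auto simp: mem_coset)
      then have "phase m y \<in> {0<..<1}"
        using phase_nonneg[of m y] phase_less_1[of m y] by simp
      then obtain z where z: "z \<in> coset m (phase m y)" "z \<notin> X"
        using free unfolding coset_free_def by blast
      obtain k :: nat where k: "y = frac (z + real k / real m)"
        using coset_eq_orbit[OF m_pos z(1) yc(1)] .
      have "frac (y - real k / real m) = frac (z + real k / real m + - (real k / real m))"
        unfolding k using frac_add_simps(1)[of _ "- (real k / real m)"] by simp
      also have "\<dots> = z"
        using z(1) coset_subset_circle frac_circle by auto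
      finally show ?thesis
        using z(2) by auto
    qed
    have "X \<inter> polygon m = polygon m"
      using X(3) by blast
    moreover have "polygon m \<in> critical_complex m"
    proof -
      have "polygon m \<subset> coset m (1/2) \<union> polygon m"
        using coset_nonempty[OF m_pos, of "1/2"] coset_polygon_disjoint[of "1/2" m] by auto
      then have "polygon m \<in> sphere_bouquet m"
        using zero_in_polygon by (auto simp: mem_sphere_bouquet intro!: exI[of _ "1/2"])
      then show ?thesis
        using sphere_bouquet_subset_critical by blast
    qed
    ultimately show "contractible_complex (gap_complex (\<lambda>_. real 1 / real m) (X \<inter> polygon m))"
      using finite_coset[OF m_pos] zero_in_polygon by (auto simp: gap_complex_of_face intro!: contractible_all_faces)
  qed (use X m in auto)
  then show ?thesis
    by simp
qed

lemma singleton_in_gap: "x \<in> X \<Longrightarrow> x \<in> circle \<Longrightarrow> {x} \<in> gap_complex e X"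
  by (rule gap_complexI[of _ _ x]) (auto simp: open_arc_def)

lemma coset_free_singleton: "coset_free m {z}"
proof -
  have "\<not> coset m s \<subseteq> {z}" if "s \<in> {0<..<1}" for s
    using card_mono[of "{z}" "coset m s"] card_coset[OF m_pos, of s] that m by auto
  then show ?thesis
    by (simp add: coset_free_def)
qed

definition trim_cosets :: "real set \<Rightarrow> real set \<Rightarrow> real set" where
  "trim_cosets X \<rho> = X - (\<Union>{coset m s | s. s \<in> {0<..<1} \<and> coset m s \<subseteq> X} - \<rho>)"

lemma trim_cosets_subset: "trim_cosets X \<rho> \<subseteq> X"
  by (auto simp: trim_cosets_def)

lemma polygon_subset_trim_cosets: "polygon m \<subseteq> X \<Longrightarrow> polygon m \<subseteq> trim_cosets X \<rho>"
  using coset_polygon_disjoint by (fastforce simp: trim_cosets_def)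

lemma coset_free_trim_cosets:
  assumes "coset_free m \<rho>"
  shows "coset_free m (trim_cosets X \<rho>)"
  unfolding coset_free_def
proof (intro ballI notI)
  fix s :: real assume s: "s \<in> {0<..<1}" "coset m s \<subseteq> trim_cosets X \<rho>"
  then have "coset m s \<subseteq> \<Union>{coset m s | s. s \<in> {0<..<1} \<and> coset m s \<subseteq> X}"
    using trim_cosets_subset by blast
  then have "coset m s \<subseteq> \<rho>"
    using s(2) by (auto simp: trim_cosets_def)
  then show False
    using assms s(1) by (simp add: coset_free_def)
qed

lemma contractible_coset_free_faces:
  assumes X: "finite X" "X \<subseteq> circle" "polygon m \<subseteq> X"
  shows "contractible_complex {\<rho> \<in> gap_complex (\<lambda>_. 1 / real m) X. coset_free m \<rho>}"
    (is "contractible_complex ?L")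
proof -
  define \<Phi> where "\<Phi> \<rho> = gap_complex (\<lambda>_. 1 / real m) (trim_cosets X \<rho>)" for \<rho>
  have "contractible_carrier ?L \<Phi>"
  proof unfold_locales
    show "abstract_complex ?L"
      by (rule abstract_complex_filter[OF abstract_complex_gap]) (rule coset_free_subset)
    fix \<rho> assume "\<rho> \<in> ?L"
    then show "contractible_complex (\<Phi> \<rho>)"
      unfolding \<Phi>_def using X finite_subset[OF trim_cosets_subset]
      by (intro contractible_gap_with_polygon polygon_subset_trim_cosets coset_free_trim_cosets
          order_trans[OF trim_cosets_subset]) simp_all
    show "\<Phi> \<tau> \<subseteq> \<Phi> \<rho>" if "\<tau> \<subseteq> \<rho>" for \<tau>
      unfolding \<Phi>_def using that by (intro gap_complex_mono) (auto simp: trim_cosets_def)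
  qed
  then show ?thesis
  proof (rule contractible_complex_if_self_carried[where v = 0])
    have "{0} \<in> ?L"
      using X zero_in_polygon coset_free_singleton by (auto intro!: singleton_in_gap)
    then show "?L \<noteq> {}"
      by blast
    show "{0} \<in> \<Phi> \<rho>" for \<rho>
      unfolding \<Phi>_def using polygon_subset_trim_cosets[OF X(3)] zero_in_polygon coset_subset_circle
      by (intro singleton_in_gap) blast+
    fix \<rho> assume \<rho>: "\<rho> \<in> ?L"
    then have "\<rho> \<subseteq> trim_cosets X \<rho>"
      using gap_complexD(1) by (fastforce simp: trim_cosets_def)
    then show "\<rho> \<in> \<Phi> \<rho>"
      unfolding \<Phi>_def using \<rho> gap_complex_restrict by blast
    show "\<Phi> \<rho> \<subseteq> ?L"
    proof
      fix \<tau> assume \<tau>: "\<tau> \<in> \<Phi> \<rho>"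
      have "coset_free m \<tau>"
        using coset_free_trim_cosets[of \<rho> X] \<rho> gap_complexD(1)[OF \<tau>[unfolded \<Phi>_def]] coset_free_subset by blast
      then show "\<tau> \<in> ?L"
        using subsetD[OF gap_complex_mono[OF trim_cosets_subset] \<tau>[unfolded \<Phi>_def]] by simp
    qed
  qed
qed

definition coset_free_part :: "real set set \<Rightarrow> real set \<Rightarrow> real set set" where
  "coset_free_part L \<sigma> = {\<rho> \<in> L. \<rho> \<subseteq> \<sigma> \<union> polygon m \<and> coset_free m \<rho>}"

lemma coset_free_part_mono: "\<tau> \<subseteq> \<sigma> \<Longrightarrow> coset_free_part L \<tau> \<subseteq> coset_free_part L \<sigma>"
  by (auto simp: coset_free_part_def)

lemma contractible_coset_free_part_critical:
  assumes \<sigma>: "\<sigma> \<in> critical_complex m"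
  shows "contractible_complex (coset_free_part (critical_complex m) \<sigma>)"
proof -
  note \<sigma>D = gap_complexD[OF \<sigma>]
  have X: "\<sigma> \<union> polygon m \<subseteq> circle"
    using \<sigma>D(1) coset_subset_circle by blast
  have "coset_free_part (critical_complex m) \<sigma> =
      {\<rho> \<in> gap_complex (\<lambda>_. 1 / real m) (\<sigma> \<union> polygon m). coset_free m \<rho>}"
    using X by (auto simp: coset_free_part_def gap_complex_def)
  then show ?thesis
    using contractible_coset_free_faces[OF _ X] \<sigma>D(2) finite_coset[OF m_pos] by simp
qed

lemma singleton_in_bouquet_part:
  assumes "z \<in> polygon m"
  shows "{z} \<in> coset_free_part (sphere_bouquet m) \<sigma>"
proof -
  have "z \<notin> coset m (1/2)"
    using assms coset_polygon_disjoint[of "1/2" m] by auto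
  then have "{z} \<subset> coset m (1/2) \<union> polygon m"
    using assms coset_nonempty[OF m_pos, of "1/2"] by auto
  then show ?thesis
    using assms coset_free_singleton by (auto simp: coset_free_part_def mem_sphere_bouquet intro!: exI[of _ "1/2"])
qed

lemma insert_in_bouquet_part:
  assumes \<rho>: "\<rho> \<in> coset_free_part (sphere_bouquet m) \<sigma>" and z: "z \<in> polygon m"
  shows "insert z \<rho> \<in> coset_free_part (sphere_bouquet m) \<sigma>"
proof -
  have free: "coset_free m (insert z \<rho>)"
    using \<rho> coset_free_insert_polygon[OF _ z] by (simp add: coset_free_part_def)
  obtain s where s: "0 < s" "s < 1" "\<rho> \<subset> coset m s \<union> polygon m"
    using \<rho> by (auto simp: coset_free_part_def mem_sphere_bouquet)
  have "\<not> coset m s \<subseteq> insert z \<rho>"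
    using free s by (simp add: coset_free_def)
  then have "insert z \<rho> \<subset> coset m s \<union> polygon m"
    using s(3) z by blast
  then show ?thesis
    using \<rho> free s z by (auto simp: coset_free_part_def mem_sphere_bouquet)
qed

lemma contractible_coset_free_part_bouquet: "contractible_complex (coset_free_part (sphere_bouquet m) \<sigma>)"
proof (rule contractible_cone[where v = 0])
  show "abstract_complex (coset_free_part (sphere_bouquet m) \<sigma>)"
    unfolding coset_free_part_def using coset_free_subset
    by (intro abstract_complex_filter[OF abstract_complex_sphere_bouquet]) blast
  show "coset_free_part (sphere_bouquet m) \<sigma> \<noteq> {}"
    using singleton_in_bouquet_part[OF zero_in_polygon] by blast
qed (rule insert_in_bouquet_part[OF _ zero_in_polygon])

subsubsection \<open>The deformation onto the bouquet\<close>

definition bouquet_carrier :: "real set \<Rightarrow> real set set" where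
  "bouquet_carrier \<sigma> = coset_free_part (sphere_bouquet m) \<sigma> \<union>
     (if coset_free m \<sigma> then {} else all_faces (coset m (coset_phase \<sigma>) \<union> shadow \<sigma>))"

definition critical_carrier :: "real set \<Rightarrow> real set set" where
  "critical_carrier \<sigma> = coset_free_part (critical_complex m) \<sigma> \<union>
     (if coset_free m \<sigma> then {} else all_faces (\<sigma> \<union> shadow \<sigma>))"

lemma contractible_bouquet_carrier:
  assumes \<sigma>: "\<sigma> \<in> critical_complex m - sphere_bouquet m"
  shows "contractible_complex (bouquet_carrier \<sigma>)"
proof (cases "coset_free m \<sigma>")
  case True
  then show ?thesis
    using contractible_coset_free_part_bouquet by (simp add: bouquet_carrier_def)
next
  case False
  then obtain z where z: "z \<in> shadow \<sigma>"
    using \<sigma> shadow_nonempty by blast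
  then have "z \<in> polygon m"
    using shadow_subset_polygon by blast
  moreover have "finite (coset m (coset_phase \<sigma>) \<union> shadow \<sigma>)"
    using \<sigma> finite_coset[OF m_pos] by (auto intro: finite_shadow dest: gap_complexD(2))
  ultimately show ?thesis
    using False z contractible_union_all_faces[OF contractible_coset_free_part_bouquet, of _ z]
      singleton_in_bouquet_part insert_in_bouquet_part by (simp add: bouquet_carrier_def)
qed

lemma contractible_critical_carrier:
  assumes \<sigma>: "\<sigma> \<in> critical_complex m - sphere_bouquet m"
  shows "contractible_complex (critical_carrier \<sigma>)"
proof (cases "coset_free m \<sigma>")
  case True
  then show ?thesis
    using contractible_coset_free_part_critical \<sigma> by (simp add: critical_carrier_def)
next
  case False
  have \<sigma>C: "\<sigma> \<in> critical_complex m"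
    using \<sigma> by blast
  obtain z where z: "z \<in> shadow \<sigma>"
    using \<sigma> False shadow_nonempty by blast
  then have zp: "z \<in> polygon m"
    using shadow_subset_polygon by blast
  have "contractible_complex (coset_free_part (critical_complex m) \<sigma> \<union> all_faces (\<sigma> \<union> shadow \<sigma>))"
  proof (rule contractible_union_all_faces[OF contractible_coset_free_part_critical[OF \<sigma>C]])
    show "finite (\<sigma> \<union> shadow \<sigma>)"
      using gap_complexD(2)[OF \<sigma>C] finite_shadow by simp
    show "{z} \<in> coset_free_part (critical_complex m) \<sigma>"
      using zp coset_free_singleton coset_subset_circle by (auto simp: coset_free_part_def intro!: singleton_in_gap)
    fix \<rho> assume \<rho>: "\<rho> \<in> coset_free_part (critical_complex m) \<sigma>" "\<rho> \<subseteq> \<sigma> \<union> shadow \<sigma>"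
    then have "insert z \<rho> \<in> critical_complex m"
      using z by (intro abstract_complexD(3)[OF abstract_complex_gap union_shadow_in_critical[OF \<sigma>C False]]) auto
    then show "insert z \<rho> \<in> coset_free_part (critical_complex m) \<sigma>"
      using \<rho> zp coset_free_insert_polygon by (auto simp: coset_free_part_def)
  qed (use z in blast)
  then show ?thesis
    using False by (simp add: critical_carrier_def)
qed

lemma bouquet_face_in_carrier:
  assumes \<sigma>: "\<sigma> \<in> critical_complex m" and \<tau>: "\<tau> \<in> sphere_bouquet m" "\<tau> \<subseteq> \<sigma>"
  shows "\<tau> \<in> bouquet_carrier \<sigma>"
proof (cases "coset_free m \<tau>")
  case True
  then show ?thesis
    using \<tau> by (auto simp: bouquet_carrier_def coset_free_part_def)
next
  case False
  then have nonfree: "\<not> coset_free m \<sigma>"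
    using \<tau>(2) coset_free_subset by blast
  note same = coset_phase_face[OF \<sigma> False \<tau>(2)]
  obtain s where s: "\<tau> \<subseteq> coset m s \<union> polygon m" "\<tau> \<noteq> {}"
    using \<tau>(1) by (auto simp: mem_sphere_bouquet)
  obtain x where "x \<in> coset m (coset_phase \<sigma>)" "x \<in> coset m s"
    using coset_phase[OF False] s(1) same coset_nonempty[OF m_pos, of "coset_phase \<tau>"]
      coset_polygon_disjoint[of "coset_phase \<tau>" m] by fastforce
  then have "s = coset_phase \<sigma>"
    by (simp add: mem_coset)
  then have "\<tau> \<subseteq> coset m (coset_phase \<sigma>) \<union> shadow \<sigma>"
    using s(1) \<tau>(2) polygon_part_in_shadow[OF \<sigma> nonfree] by blast
  then show ?thesis
    using nonfree s(2) by (simp add: bouquet_carrier_def mem_all_faces)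
qed

lemma
  assumes \<sigma>: "\<sigma> \<in> critical_complex m" and \<tau>: "\<tau> \<subseteq> \<sigma>"
  shows bouquet_carrier_mono: "bouquet_carrier \<tau> \<subseteq> bouquet_carrier \<sigma>"
    and critical_carrier_mono: "critical_carrier \<tau> \<subseteq> critical_carrier \<sigma>"
proof -
  have nonfree: "\<not> coset_free m \<sigma> \<and> coset_phase \<tau> = coset_phase \<sigma> \<and> shadow \<tau> \<subseteq> shadow \<sigma>" if "\<not> coset_free m \<tau>"
    using that coset_free_subset[OF _ \<tau>] coset_phase_face[OF \<sigma> that \<tau>] shadow_mono[OF \<sigma> _ \<tau> that] by blast
  have bouquet_faces: "all_faces (coset m (coset_phase \<tau>) \<union> shadow \<tau>)
      \<subseteq> all_faces (coset m (coset_phase \<sigma>) \<union> shadow \<sigma>)"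
    if "\<not> coset_free m \<tau>"
    using nonfree[OF that] by (intro all_faces_mono) auto
  show "bouquet_carrier \<tau> \<subseteq> bouquet_carrier \<sigma>"
    unfolding bouquet_carrier_def
    by (intro Un_mono coset_free_part_mono[OF \<tau>]) (use nonfree bouquet_faces in \<open>simp split: if_splits\<close>)
  have critical_faces: "all_faces (\<tau> \<union> shadow \<tau>) \<subseteq> all_faces (\<sigma> \<union> shadow \<sigma>)" if "\<not> coset_free m \<tau>"
    using nonfree[OF that] \<tau> by (intro all_faces_mono) blast
  show "critical_carrier \<tau> \<subseteq> critical_carrier \<sigma>"
    unfolding critical_carrier_def
    by (intro Un_mono coset_free_part_mono[OF \<tau>]) (use nonfree critical_faces in \<open>simp split: if_splits\<close>)
qed

theorem bouquet_critical_equivalence: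
  "homotopy_equivalence_map (realization (sphere_bouquet m)) (realization (critical_complex m)) id"
proof (rule inclusion_homotopy_equivalence[OF abstract_complex_gap abstract_complex_sphere_bouquet
      sphere_bouquet_subset_critical, of bouquet_carrier critical_carrier])
  fix \<sigma> assume \<sigma>: "\<sigma> \<in> critical_complex m - sphere_bouquet m"
  then have \<sigma>C: "\<sigma> \<in> critical_complex m"
    by blast
  show "contractible_complex (bouquet_carrier \<sigma>)" "contractible_complex (critical_carrier \<sigma>)"
    using contractible_bouquet_carrier[OF \<sigma>] contractible_critical_carrier[OF \<sigma>] .
  show "bouquet_carrier \<sigma> \<subseteq> sphere_bouquet m"
    using all_faces_subset_complex[OF abstract_complex_sphere_bouquet coset_union_shadow_in_bouquet[OF \<sigma>C]]
    by (auto simp: bouquet_carrier_def coset_free_part_def)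
  show "critical_carrier \<sigma> \<subseteq> critical_complex m"
    using all_faces_subset_complex[OF abstract_complex_gap union_shadow_in_critical[OF \<sigma>C]]
    by (auto simp: critical_carrier_def coset_free_part_def)
  show "\<sigma> \<in> critical_carrier \<sigma>"
    using \<sigma>C gap_complexD(3)[OF \<sigma>C] by (auto simp: critical_carrier_def coset_free_part_def mem_all_faces)
  have parts: "coset_free_part (sphere_bouquet m) \<sigma> \<subseteq> coset_free_part (critical_complex m) \<sigma>"
    using sphere_bouquet_subset_critical by (auto simp: coset_free_part_def)
  have faces: "all_faces (coset m (coset_phase \<sigma>) \<union> shadow \<sigma>) \<subseteq> all_faces (\<sigma> \<union> shadow \<sigma>)" if "\<not> coset_free m \<sigma>"
    using coset_phase(3)[OF that] by (intro all_faces_mono) blast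
  show "bouquet_carrier \<sigma> \<subseteq> critical_carrier \<sigma>"
    using parts faces by (auto simp: bouquet_carrier_def critical_carrier_def)
  fix \<tau> assume \<tau>: "\<tau> \<subseteq> \<sigma>"
  show "\<tau> \<in> bouquet_carrier \<sigma>" if "\<tau> \<in> sphere_bouquet m"
    by (rule bouquet_face_in_carrier[OF \<sigma>C that \<tau>])
  show "bouquet_carrier \<tau> \<subseteq> bouquet_carrier \<sigma>" "critical_carrier \<tau> \<subseteq> critical_carrier \<sigma>"
    using bouquet_carrier_mono[OF \<sigma>C \<tau>] critical_carrier_mono[OF \<sigma>C \<tau>] .
qed

end

section \<open>Spheres as boundaries of simplices\<close>

lemma realization_set_simplex_boundary:
  assumes "finite V"
  shows "realization_set (simplex_boundary V) = {\<alpha> \<in> closed_simplex V. \<exists>x\<in>V. \<alpha> x = 0}"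
    (is "_ = ?facets")
proof -
  have "realization_set (simplex_boundary V) = (\<Union>\<sigma>\<in>simplex_boundary V. closed_simplex \<sigma>)"
    by (rule realization_set_eq[OF abstract_complex_simplex_boundary[OF assms]])
  also have "\<dots> = ?facets"
  proof (intro subset_antisym subsetI)
    fix \<alpha> assume "\<alpha> \<in> (\<Union>\<sigma>\<in>simplex_boundary V. closed_simplex \<sigma>)"
    then obtain \<sigma> x where \<sigma>: "\<sigma> \<subseteq> V" "\<alpha> \<in> closed_simplex \<sigma>" and x: "x \<in> V" "x \<notin> \<sigma>"
      by (auto simp: mem_simplex_boundary)
    then show "\<alpha> \<in> ?facets"
      using closed_simplex_mono[OF assms \<sigma>(1)] closed_simplexD(2)[OF \<sigma>(2) x(2)] by blast
  next
    fix \<alpha> assume "\<alpha> \<in> ?facets"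
    then obtain x where \<alpha>: "\<alpha> \<in> closed_simplex V" and x: "x \<in> V" "\<alpha> x = 0"
      by blast
    note supp = closed_simplex_support[OF assms \<alpha>]
    have "support \<alpha> \<in> simplex_boundary V"
      using supp(1,2) x by (auto simp: mem_simplex_boundary)
    then show "\<alpha> \<in> (\<Union>\<sigma>\<in>simplex_boundary V. closed_simplex \<sigma>)"
      using supp(3) by blast
  qed
  finally show ?thesis .
qed

lemma topspace_simplex_boundary:
  "finite V \<Longrightarrow> topspace (realization (simplex_boundary V)) = {\<alpha> \<in> closed_simplex V. \<exists>x\<in>V. \<alpha> x = 0}"
  by (simp add: topspace_realization abstract_complex_simplex_boundary realization_set_simplex_boundary)

lemma continuous_map_into_simplex_boundary:
  assumes V: "finite V"
  shows "continuous_map X (realization (simplex_boundary V)) f \<longleftrightarrow>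
    (\<forall>x. continuous_map X euclideanreal (\<lambda>p. f p x)) \<and> f \<in> topspace X \<rightarrow> topspace (realization (simplex_boundary V))"
proof -
  have "finite (simplex_boundary V)"
    by (rule finite_subset[of _ "Pow V"]) (auto simp: mem_simplex_boundary V)
  then show ?thesis
    using realization_finite[OF abstract_complex_simplex_boundary[OF V]]
    by (auto simp: continuous_map_in_subtopology continuous_map_componentwise_UNIV)
qed

lemma continuous_map_simplex_boundary_coord:
  assumes "finite V"
  shows "continuous_map (realization (simplex_boundary V)) euclideanreal (\<lambda>\<alpha>. \<alpha> x)"
  using continuous_map_into_simplex_boundary[OF assms, of "realization (simplex_boundary V)" id]
  by simp

subsection \<open>Radial projection from the barycentre\<close>

definition boundary_proj :: "'a set \<Rightarrow> ('a \<Rightarrow> real) \<Rightarrow> 'a \<Rightarrow> real" where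
  "boundary_proj V z = (\<lambda>x. if x \<in> V then (z x - Min (z ` V)) / (\<Sum>y\<in>V. z y - Min (z ` V)) else 0)"

lemma boundary_proj_denominator_pos:
  fixes z :: "'a \<Rightarrow> real"
  assumes V: "finite V" and z: "\<not> z constant_on V"
  shows "0 < (\<Sum>y\<in>V. z y - Min (z ` V))"
proof -
  obtain u where u: "u \<in> V" "z u \<noteq> Min (z ` V)"
    using z unfolding constant_on_def by blast
  have least: "Min (z ` V) \<le> z y" if "y \<in> V" for y
    using V that by simp
  show ?thesis
    by (rule sum_pos2[OF V u(1)]) (use u least in \<open>auto simp: less_le\<close>)
qed

lemma boundary_proj_in_boundary:
  assumes V: "finite V" and z: "\<not> z constant_on V"
  shows "boundary_proj V z \<in> topspace (realization (simplex_boundary V))"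
proof -
  note pos = boundary_proj_denominator_pos[OF assms]
  have "V \<noteq> {}"
    using z by (auto simp: constant_on_def)
  then have "Min (z ` V) \<in> z ` V"
    using V by simp
  then obtain u where u: "u \<in> V" "Min (z ` V) = z u"
    by blast
  have "sum (boundary_proj V z) V = 1"
    using pos by (simp add: boundary_proj_def flip: sum_divide_distrib)
  then have "boundary_proj V z \<in> closed_simplex V"
    using pos V by (auto simp: closed_simplex_def boundary_proj_def intro!: divide_nonneg_nonneg)
  moreover have "boundary_proj V z u = 0"
    using u by (simp add: boundary_proj_def)
  ultimately show ?thesis
    using u(1) V by (auto simp: topspace_simplex_boundary)
qed

lemma boundary_proj_id:
  assumes V: "finite V" and \<alpha>: "\<alpha> \<in> topspace (realization (simplex_boundary V))"
  shows "boundary_proj V \<alpha> = \<alpha>"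
proof -
  obtain x where x: "\<alpha> \<in> closed_simplex V" "x \<in> V" "\<alpha> x = 0"
    using \<alpha> V by (auto simp: topspace_simplex_boundary)
  then have "Min (\<alpha> ` V) = 0"
    using V by (intro Min_eqI) (auto simp: closed_simplexD(1) intro!: image_eqI[of _ _ x])
  then show ?thesis
    using closed_simplexD[OF x(1)] by (auto simp: boundary_proj_def)
qed

lemma boundary_proj_affine:
  assumes V: "finite V" "V \<noteq> {}" and c: "0 < c" and z': "\<And>x. x \<in> V \<Longrightarrow> z' x = c * (z x - b)"
  shows "boundary_proj V z' = boundary_proj V z"
proof -
  have "z' ` V = (\<lambda>t. c * (t - b)) ` (z ` V)"
    using z' by (auto simp: image_image)
  moreover have "mono (\<lambda>t. c * (t - b))"
    using c by (auto intro!: monoI mult_left_mono)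
  ultimately have "Min (z' ` V) = c * (Min (z ` V) - b)"
    using mono_Min_commute[of "\<lambda>t. c * (t - b)" "z ` V"] V by simp
  then have scaled: "z' x - Min (z' ` V) = c * (z x - Min (z ` V))" if "x \<in> V" for x
    using z'[OF that] by (simp add: algebra_simps)
  then have "(\<Sum>y\<in>V. z' y - Min (z' ` V)) = c * (\<Sum>y\<in>V. z y - Min (z ` V))"
    by (simp add: sum_distrib_left)
  then show ?thesis
    using scaled c by (auto simp: boundary_proj_def)
qed

lemma continuous_map_boundary_proj:
  assumes V: "finite V" and z: "\<And>x. x \<in> V \<Longrightarrow> continuous_map X euclideanreal (\<lambda>p. z p x)"
    and nonconstant: "\<And>p. p \<in> topspace X \<Longrightarrow> \<not> z p constant_on V"
  shows "continuous_map X (realization (simplex_boundary V)) (\<lambda>p. boundary_proj V (z p))"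
  unfolding continuous_map_into_simplex_boundary[OF V]
proof (intro conjI allI)
  show "(\<lambda>p. boundary_proj V (z p)) \<in> topspace X \<rightarrow> topspace (realization (simplex_boundary V))"
    using boundary_proj_in_boundary[OF V] nonconstant by blast
  fix x
  show "continuous_map X euclideanreal (\<lambda>p. boundary_proj V (z p) x)"
  proof (cases "x \<in> V")
    case True
    then have Min: "continuous_map X euclideanreal (\<lambda>p. Min (z p ` V))"
      using z V by (intro continuous_map_Min) auto
    have "(\<Sum>y\<in>V. z p y - Min (z p ` V)) \<noteq> 0" if "p \<in> topspace X" for p
      using boundary_proj_denominator_pos[OF V nonconstant[OF that]] by simp
    then have "continuous_map X euclideanreal (\<lambda>p. (z p x - Min (z p ` V)) / (\<Sum>y\<in>V. z p y - Min (z p ` V)))"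
      by (intro continuous_intros z[OF True] Min V z)
    then show ?thesis
      using True by (simp add: boundary_proj_def)
  qed (simp add: boundary_proj_def)
qed

subsection \<open>The homeomorphism with the sphere\<close>

definition edge_norm :: "nat \<Rightarrow> (nat \<Rightarrow> 'a) \<Rightarrow> ('a \<Rightarrow> real) \<Rightarrow> real" where
  "edge_norm n v \<alpha> = sqrt (\<Sum>j\<le>n. (\<alpha> (v j) - \<alpha> (v (Suc n)))\<^sup>2)"

definition to_sphere :: "nat \<Rightarrow> (nat \<Rightarrow> 'a) \<Rightarrow> ('a \<Rightarrow> real) \<Rightarrow> nat \<Rightarrow> real" where
  "to_sphere n v \<alpha> = (\<lambda>i. if i \<le> n then (\<alpha> (v i) - \<alpha> (v (Suc n))) / edge_norm n v \<alpha> else 0)"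

definition from_sphere :: "nat \<Rightarrow> (nat \<Rightarrow> 'a) \<Rightarrow> (nat \<Rightarrow> real) \<Rightarrow> 'a \<Rightarrow> real" where
  "from_sphere n v y = boundary_proj (v ` {..Suc n}) (\<lambda>x. y (inv_into {..Suc n} v x))"

lemma topspace_nsphere: "topspace (nsphere n) = {x. (\<Sum>i\<le>n. (x i)\<^sup>2) = 1 \<and> (\<forall>i>n. x i = 0)}"
  by (simp add: nsphere)

context
  fixes n :: nat and v :: "nat \<Rightarrow> 'a"
  assumes v: "inj_on v {..Suc n}"
begin

abbreviation vertices :: "'a set" where
  "vertices \<equiv> v ` {..Suc n}"

lemma inv_into_vertices: "i \<le> Suc n \<Longrightarrow> inv_into {..Suc n} v (v i) = i"
  using v by (simp add: inv_into_f_f)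

lemma edge_norm_pos:
  assumes \<alpha>: "\<alpha> \<in> topspace (realization (simplex_boundary vertices))"
  shows "0 < edge_norm n v \<alpha>"
proof (rule ccontr)
  assume "\<not> ?thesis"
  then have "(\<Sum>j\<le>n. (\<alpha> (v j) - \<alpha> (v (Suc n)))\<^sup>2) = 0"
    unfolding edge_norm_def using sum_nonneg[of "{..n}" "\<lambda>j. (\<alpha> (v j) - \<alpha> (v (Suc n)))\<^sup>2"] by force
  then have "\<alpha> (v j) = \<alpha> (v (Suc n))" if "j \<le> Suc n" for j
    using that by (cases "j = Suc n") (auto simp: sum_nonneg_eq_0_iff)
  then have all_equal: "\<alpha> x = \<alpha> (v (Suc n))" if "x \<in> vertices" for x
    using that by (metis imageE atMost_iff)
  obtain x where x: "\<alpha> \<in> closed_simplex vertices" "x \<in> vertices" "\<alpha> x = 0"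
    using \<alpha> by (auto simp: topspace_simplex_boundary)
  have "\<alpha> y = 0" if "y \<in> vertices" for y
    using all_equal[OF that] all_equal[OF x(2)] x(3) by simp
  then have "sum \<alpha> vertices = 0"
    by (intro sum.neutral) blast
  then show False
    using closed_simplexD(3)[OF x(1)] by simp
qed

lemma sphere_coordinates_nonconstant:
  assumes y: "y \<in> topspace (nsphere n)"
  shows "\<not> (\<lambda>x. y (inv_into {..Suc n} v x)) constant_on vertices"
proof
  assume "(\<lambda>x. y (inv_into {..Suc n} v x)) constant_on vertices"
  then obtain c where c: "\<And>x. x \<in> vertices \<Longrightarrow> y (inv_into {..Suc n} v x) = c"
    unfolding constant_on_def by blast
  have "y i = c" if "i \<le> Suc n" for i
    using c[of "v i"] that by (simp add: inv_into_vertices)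
  moreover from this have "c = 0"
    using y by (force simp: topspace_nsphere)
  ultimately have "(\<Sum>i\<le>n. (y i)\<^sup>2) = 0"
    by simp
  then show False
    using y by (simp add: topspace_nsphere)
qed

lemma continuous_map_to_sphere:
  "continuous_map (realization (simplex_boundary vertices)) (nsphere n) (to_sphere n v)"
proof -
  let ?R = "realization (simplex_boundary vertices)"
  have "continuous_map ?R euclideanreal (edge_norm n v)"
    unfolding edge_norm_def by (intro continuous_intros continuous_map_simplex_boundary_coord) auto
  moreover have "edge_norm n v \<alpha> \<noteq> 0" if "\<alpha> \<in> topspace ?R" for \<alpha>
    using edge_norm_pos[OF that] by simp
  ultimately have "continuous_map ?R euclideanreal (\<lambda>\<alpha>. to_sphere n v \<alpha> i)" for i
    unfolding to_sphere_def
    by (cases "i \<le> n") (auto intro!: continuous_intros continuous_map_simplex_boundary_coord)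
  moreover have "to_sphere n v \<alpha> \<in> topspace (nsphere n)" if \<alpha>: "\<alpha> \<in> topspace ?R" for \<alpha>
  proof -
    have "(\<Sum>j\<le>n. (\<alpha> (v j) - \<alpha> (v (Suc n)))\<^sup>2) = (edge_norm n v \<alpha>)\<^sup>2"
      by (simp add: edge_norm_def sum_nonneg)
    then have "(\<Sum>i\<le>n. (to_sphere n v \<alpha> i)\<^sup>2) = 1"
      using edge_norm_pos[OF \<alpha>] by (simp add: to_sphere_def power_divide flip: sum_divide_distrib)
    then show ?thesis
      by (simp add: topspace_nsphere to_sphere_def)
  qed
  ultimately show ?thesis
    by (auto simp: nsphere continuous_map_in_subtopology continuous_map_componentwise_UNIV topspace_nsphere)
qed

lemma continuous_map_from_sphere:
  "continuous_map (nsphere n) (realization (simplex_boundary vertices)) (from_sphere n v)"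
  unfolding from_sphere_def
  by (intro continuous_map_boundary_proj continuous_map_nsphere_projection sphere_coordinates_nonconstant) auto

lemma from_sphere_to_sphere:
  assumes \<alpha>: "\<alpha> \<in> topspace (realization (simplex_boundary vertices))"
  shows "from_sphere n v (to_sphere n v \<alpha>) = \<alpha>"
proof -
  have "from_sphere n v (to_sphere n v \<alpha>) = boundary_proj vertices \<alpha>"
    unfolding from_sphere_def
  proof (rule boundary_proj_affine[of _ "1 / edge_norm n v \<alpha>" _ _ "\<alpha> (v (Suc n))"])
    show "0 < 1 / edge_norm n v \<alpha>"
      using edge_norm_pos[OF \<alpha>] by simp
    fix x assume "x \<in> vertices"
    then obtain i where i: "i \<le> Suc n" "x = v i"
      by auto
    then show "to_sphere n v \<alpha> (inv_into {..Suc n} v x) = 1 / edge_norm n v \<alpha> * (\<alpha> x - \<alpha> (v (Suc n)))"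
      by (cases "i = Suc n") (auto simp: to_sphere_def inv_into_vertices)
  qed auto
  then show ?thesis
    using boundary_proj_id[OF _ \<alpha>] by simp
qed

lemma to_sphere_from_sphere:
  assumes y: "y \<in> topspace (nsphere n)"
  shows "to_sphere n v (from_sphere n v y) = y"
proof -
  define z where "z = (\<lambda>x. y (inv_into {..Suc n} v x))"
  define s where "s = (\<Sum>x\<in>vertices. z x - Min (z ` vertices))"
  have s: "0 < s"
    unfolding s_def z_def by (rule boundary_proj_denominator_pos[OF _ sphere_coordinates_nonconstant[OF y]]) simp
  have "from_sphere n v y (v i) = (y i - Min (z ` vertices)) / s" if "i \<le> Suc n" for i
    using that by (simp add: from_sphere_def boundary_proj_def inv_into_vertices z_def s_def)
  moreover have "y (Suc n) = 0"
    using y by (simp add: topspace_nsphere)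
  ultimately have edge: "from_sphere n v y (v i) - from_sphere n v y (v (Suc n)) = y i / s" if "i \<le> n" for i
    using that by (simp add: diff_divide_distrib)
  have "edge_norm n v (from_sphere n v y) = sqrt ((\<Sum>j\<le>n. (y j)\<^sup>2) / s\<^sup>2)"
    unfolding edge_norm_def by (simp add: edge power_divide sum_divide_distrib)
  also have "\<dots> = 1 / s"
    using y s by (simp add: topspace_nsphere real_sqrt_divide)
  finally show ?thesis
    using edge s y by (auto simp: to_sphere_def topspace_nsphere)
qed

lemma homeomorphic_maps_to_sphere:
  "homeomorphic_maps (realization (simplex_boundary vertices)) (nsphere n) (to_sphere n v) (from_sphere n v)"
  unfolding homeomorphic_maps_def
  using continuous_map_to_sphere continuous_map_from_sphere from_sphere_to_sphere to_sphere_from_sphere by blast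

lemma to_sphere_vertex: "to_sphere n v (vertex (v 0)) = sphere_base"
proof -
  have vertex: "vertex (v 0) (v i) = (if i = 0 then 1 else 0 :: real)" if "i \<le> Suc n" for i
    using that inj_on_eq_iff[OF v, of i 0] by (auto simp: indicator_def)
  have "(\<Sum>j\<le>n. (vertex (v 0) (v j) - vertex (v 0) (v (Suc n)))\<^sup>2) = (\<Sum>j\<le>n. if j = 0 then 1 else 0 :: real)"
    using vertex by (intro sum.cong) auto
  then have "edge_norm n v (vertex (v 0)) = 1"
    by (simp add: edge_norm_def)
  then show ?thesis
    using vertex by (auto simp: to_sphere_def sphere_base_def)
qed

end

lemma enumeration_starting_at:
  assumes "finite V" "card V = Suc (Suc n)" "p \<in> V"
  obtains v :: "nat \<Rightarrow> 'a" where "inj_on v {..Suc n}" "v ` {..Suc n} = V" "v 0 = p"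
proof -
  have "card (V - {p}) = Suc n"
    using assms by simp
  then obtain u where u: "bij_betw u {1..Suc n} (V - {p})"
    using finite_same_card_bij[of "{1..Suc n}" "V - {p}"] assms(1) by auto
  have "bij_betw (u(0 := p)) {1..Suc n} (V - {p})"
    by (rule bij_betw_cong[THEN iffD1, OF _ u]) simp
  moreover have "bij_betw (u(0 := p)) {0} {p}"
    by simp
  moreover have "{0} \<union> {1..Suc n} = {..Suc n}" "{p} \<union> (V - {p}) = V"
    using assms(3) by auto
  ultimately have "bij_betw (u(0 := p)) {..Suc n} V"
    using bij_betw_combine[of "u(0 := p)" "{0}" "{p}" "{1..Suc n}" "V - {p}"] by auto
  then show ?thesis
    using that[of "u(0 := p)"] by (simp add: bij_betw_def)
qed

lemma simplex_boundary_homeomorphic_sphere: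
  assumes "finite V" "card V = Suc (Suc n)"
  shows "realization (simplex_boundary V) homeomorphic_space nsphere n"
proof -
  obtain p where "p \<in> V"
    using assms(2) by fastforce
  then obtain v :: "nat \<Rightarrow> 'a" where "inj_on v {..Suc n}" "v ` {..Suc n} = V"
    using enumeration_starting_at[OF assms] by metis
  then show ?thesis
    using homeomorphic_maps_to_sphere[of v n] homeomorphic_space_def by metis
qed

section \<open>The bouquet of spheres\<close>

subsection \<open>Maps out of the wedge\<close>

lemma quotient_map_quotient_topology: "quotient_map X (quotient_topology X f) f"
proof -
  have Int: "{x \<in> topspace X. f x \<in> S \<inter> T} = {x \<in> topspace X. f x \<in> S} \<inter> {x \<in> topspace X. f x \<in> T}" for S T
    by auto
  have Union: "{x \<in> topspace X. f x \<in> \<Union>\<K>} = (\<Union>U\<in>\<K>. {x \<in> topspace X. f x \<in> U})" for \<K>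
    by auto
  have "istopology (\<lambda>U. U \<subseteq> f ` topspace X \<and> openin X {x \<in> topspace X. f x \<in> U})"
    unfolding istopology_def Int Union by blast
  then have openin_iff: "openin (quotient_topology X f) U \<longleftrightarrow>
      U \<subseteq> f ` topspace X \<and> openin X {x \<in> topspace X. f x \<in> U}" for U
    by (simp add: quotient_topology_def)
  have "{x \<in> topspace X. f x \<in> f ` topspace X} = topspace X"
    by auto
  then have "openin (quotient_topology X f) (f ` topspace X)"
    using openin_iff by simp
  then have "topspace (quotient_topology X f) = f ` topspace X"
    using openin_iff by (meson openin_subset openin_topspace subset_antisym)
  then show ?thesis
    unfolding quotient_map_def using openin_iff by auto
qed

lemma quotient_map_wedge:
  "quotient_map (sum_topology (\<lambda>_::real. nsphere n) UNIV) (continuum_wedge_spheres n) wedge_collapse"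
  unfolding continuum_wedge_spheres_def by (rule quotient_map_quotient_topology)

lemma wedge_collapse_base: "wedge_collapse (i, sphere_base) = (0, sphere_base)"
  by (simp add: wedge_collapse_def)

lemma wedge_cases:
  assumes "x \<in> topspace (continuum_wedge_spheres n)"
  obtains i y where "x = wedge_collapse (i, y)" "y \<in> topspace (nsphere n)"
  using assms quotient_imp_surjective_map[OF quotient_map_wedge, of n] that by auto

lemma continuous_map_into_wedge: "continuous_map (nsphere n) (continuum_wedge_spheres n) (\<lambda>y. wedge_collapse (i, y))"
  using continuous_map_compose[OF continuous_map_component_injection
      quotient_imp_continuous_map[OF quotient_map_wedge]]
  by (simp add: o_def)

lemma continuous_map_from_wedge:
  assumes "\<And>i. continuous_map (nsphere n) Z (\<lambda>y. g (wedge_collapse (i, y)))"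
  shows "continuous_map (continuum_wedge_spheres n) Z g"
  using assms
  by (intro continuous_compose_quotient_map[OF quotient_map_wedge] continuous_map_from_sum) (simp add: o_def)

lemma homotopic_with_wedgeI:
  assumes h: "\<And>i. continuous_map (prod_topology unit_interval (nsphere n)) Z (\<lambda>(t, y). h (t, wedge_collapse (i, y)))"
  shows "homotopic_with (\<lambda>x. True) (continuum_wedge_spheres n) Z (\<lambda>x. h (0, x)) (\<lambda>x. h (1, x))"
proof -
  let ?S = "sum_topology (\<lambda>_::real. nsphere n) UNIV"
  have "continuous_map (prod_topology unit_interval ?S) Z (h \<circ> (\<lambda>(t, x). (t, wedge_collapse x)))"
    using h by (intro continuous_map_from_prod_sum) (simp add: o_def case_prod_unfold)
  then have "continuous_map (prod_topology unit_interval (continuum_wedge_spheres n)) Z h"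
    by (rule continuous_compose_quotient_map[OF quotient_map_prod_unit_interval[OF quotient_map_wedge]])
  then show ?thesis
    unfolding homotopic_with_def by auto
qed

subsection \<open>Contracting a face of the boundary of a simplex\<close>

text \<open>A homotopy of the boundary of the simplex \<open>C \<union> G\<close> that contracts the face \<open>G\<close> to its vertex \<open>p\<close>.
  The straight push of the mass on \<open>G\<close> towards \<open>p\<close> could only meet the barycentre where \<open>C\<close> carries
  its barycentric share of the mass, so it is switched off there.\<close>

definition squeeze_rate :: "'a set \<Rightarrow> 'a set \<Rightarrow> ('a \<Rightarrow> real) \<Rightarrow> real" where
  "squeeze_rate C G \<alpha> = max 0 (1 - real (card (C \<union> G)) / real (card C) * sum \<alpha> C)"

definition squeeze :: "'a set \<Rightarrow> 'a set \<Rightarrow> 'a \<Rightarrow> real \<Rightarrow> ('a \<Rightarrow> real) \<Rightarrow> 'a \<Rightarrow> real" where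
  "squeeze C G p t \<alpha> = (\<lambda>x. if x \<in> G then (1 - t * squeeze_rate C G \<alpha>) * \<alpha> x
      + t * squeeze_rate C G \<alpha> * (1 - sum \<alpha> C) * vertex p x else \<alpha> x)"

definition squash :: "'a set \<Rightarrow> 'a set \<Rightarrow> 'a \<Rightarrow> real \<Rightarrow> ('a \<Rightarrow> real) \<Rightarrow> 'a \<Rightarrow> real" where
  "squash C G p t \<alpha> = boundary_proj (C \<union> G) (squeeze C G p t \<alpha>)"

locale simplex_face =
  fixes C G :: "'a set" and p :: 'a
  assumes finite: "finite C" "finite G" and disjoint: "C \<inter> G = {}" and nonempty: "C \<noteq> {}" and p: "p \<in> G"
begin

abbreviation boundary :: "('a \<Rightarrow> real) topology" where
  "boundary \<equiv> realization (simplex_boundary (C \<union> G))"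

lemma finite_union: "finite (C \<union> G)"
  using finite by simp

lemma sum_squeeze:
  assumes "\<alpha> \<in> closed_simplex (C \<union> G)"
  shows "sum (squeeze C G p t \<alpha>) G = 1 - sum \<alpha> C"
proof -
  have "sum \<alpha> C + sum \<alpha> G = 1"
    using closed_simplexD(3)[OF assms] sum.union_disjoint[OF finite disjoint, of \<alpha>] by simp
  then have G: "sum \<alpha> G = 1 - sum \<alpha> C"
    by simp
  have "sum (vertex p) G = (1 :: real)"
    using finite(2) p by (simp add: indicator_def)
  then have "sum (squeeze C G p t \<alpha>) G =
      (1 - t * squeeze_rate C G \<alpha>) * sum \<alpha> G + t * squeeze_rate C G \<alpha> * (1 - sum \<alpha> C)"
    by (simp add: squeeze_def sum.distrib flip: sum_distrib_left)
  then show ?thesis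
    by (simp add: G algebra_simps)
qed

lemma squeeze_nonconstant:
  assumes \<alpha>: "\<alpha> \<in> topspace boundary"
  shows "\<not> squeeze C G p t \<alpha> constant_on C \<union> G"
proof
  assume "squeeze C G p t \<alpha> constant_on C \<union> G"
  then obtain \<kappa> where \<kappa>: "\<And>x. x \<in> C \<union> G \<Longrightarrow> squeeze C G p t \<alpha> x = \<kappa>"
    unfolding constant_on_def by blast
  obtain x where x: "\<alpha> \<in> closed_simplex (C \<union> G)" "x \<in> C \<union> G" "\<alpha> x = 0"
    using \<alpha> finite_union by (auto simp: topspace_simplex_boundary)
  have "\<alpha> y = \<kappa>" if "y \<in> C" for y
    using \<kappa>[of y] that disjoint by (auto simp: squeeze_def)
  then have share: "sum \<alpha> C = real (card C) * \<kappa>"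
    by simp
  have "1 - sum \<alpha> C = real (card G) * \<kappa>"
    using sum_squeeze[OF x(1), of t] \<kappa> by simp
  then have total: "real (card (C \<union> G)) * \<kappa> = 1"
    using share card_Un_disjoint[OF finite disjoint] by (simp add: algebra_simps)
  have "card C \<noteq> 0"
    using finite(1) nonempty by simp
  then have "squeeze_rate C G \<alpha> = 0"
    using share total by (simp add: squeeze_rate_def)
  then have "\<alpha> x = \<kappa>"
    using \<kappa>[OF x(2)] by (simp add: squeeze_def split: if_splits)
  then show False
    using total x(3) by simp
qed

lemma squash_in_boundary: "\<alpha> \<in> topspace boundary \<Longrightarrow> squash C G p t \<alpha> \<in> topspace boundary"
  unfolding squash_def by (rule boundary_proj_in_boundary[OF finite_union squeeze_nonconstant])

lemma continuous_map_squash: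
  assumes \<tau>: "continuous_map X euclideanreal \<tau>" and a: "continuous_map X boundary a"
  shows "continuous_map X boundary (\<lambda>q. squash C G p (\<tau> q) (a q))"
  unfolding squash_def
proof (rule continuous_map_boundary_proj[OF finite_union])
  note coord = continuous_map_into_simplex_boundary[OF finite_union, THEN iffD1, OF a, THEN conjunct1, rule_format]
  have sum: "continuous_map X euclideanreal (\<lambda>q. sum (a q) C)"
    by (intro continuous_map_sum finite(1) coord)
  then have rate: "continuous_map X euclideanreal (\<lambda>q. squeeze_rate C G (a q))"
    unfolding squeeze_rate_def
    by (intro continuous_map_real_max continuous_map_diff continuous_map_real_mult sum) simp_all
  fix x
  show "continuous_map X euclideanreal (\<lambda>q. squeeze C G p (\<tau> q) (a q) x)"
    unfolding squeeze_def by (cases "x \<in> G") (auto intro!: continuous_intros \<tau> rate sum coord)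
qed (use a squeeze_nonconstant in \<open>auto simp: continuous_map_def\<close>)

lemma squash_0:
  assumes "\<alpha> \<in> topspace boundary"
  shows "squash C G p 0 \<alpha> = \<alpha>"
proof -
  have "squeeze C G p 0 \<alpha> = \<alpha>"
    by (auto simp: squeeze_def)
  then show ?thesis
    using boundary_proj_id[OF finite_union assms] by (simp add: squash_def)
qed

lemma face_in_boundary:
  assumes "\<alpha> \<in> closed_simplex G"
  shows "\<alpha> \<in> topspace boundary"
proof -
  obtain x where x: "x \<in> C" "x \<notin> G"
    using nonempty disjoint by blast
  then show ?thesis
    using assms closed_simplexD(2)[OF assms x(2)] closed_simplex_mono[OF finite_union, of G]
    by (auto simp: topspace_simplex_boundary finite)
qed

lemma squash_on_face:
  assumes \<alpha>: "\<alpha> \<in> closed_simplex G" and t: "0 \<le> t" "t \<le> 1"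
  shows "squash C G p t \<alpha> = (\<lambda>x. (1 - t) * \<alpha> x + t * vertex p x)"
proof -
  note outside = closed_simplexD(2)[OF \<alpha>]
  have "sum \<alpha> C = 0"
    using disjoint outside by (intro sum.neutral) auto
  then have "squeeze C G p t \<alpha> = (\<lambda>x. (1 - t) * \<alpha> x + t * vertex p x)"
    using outside p by (auto simp: squeeze_def squeeze_rate_def indicator_def)
  moreover have "(\<lambda>x. (1 - t) * \<alpha> x + t * vertex p x) \<in> topspace boundary"
    using closed_simplex_convex[OF \<alpha> vertex_in_closed_simplex[OF finite(2) p] t] by (rule face_in_boundary)
  ultimately show ?thesis
    using boundary_proj_id[OF finite_union] by (simp add: squash_def)
qed

end

subsection \<open>Spheres glued along a common face\<close>

locale simplex_bouquet =
  fixes C :: "real \<Rightarrow> 'a set" and G :: "'a set" and p :: 'a and n :: nat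
  assumes face: "\<And>i. simplex_face (C i) G p"
    and disjoint: "\<And>i j. i \<noteq> j \<Longrightarrow> C i \<inter> C j = {}"
    and card: "\<And>i. card (C i \<union> G) = Suc (Suc n)"
begin

definition bouquet :: "'a set set" where
  "bouquet = (\<Union>i. simplex_boundary (C i \<union> G))"

abbreviation piece :: "real \<Rightarrow> ('a \<Rightarrow> real) topology" where
  "piece i \<equiv> realization (simplex_boundary (C i \<union> G))"

definition piece_enum :: "real \<Rightarrow> nat \<Rightarrow> 'a" where
  "piece_enum i = (SOME v. inj_on v {..Suc n} \<and> v ` {..Suc n} = C i \<union> G \<and> v 0 = p)"

abbreviation to_piece_sphere :: "real \<Rightarrow> ('a \<Rightarrow> real) \<Rightarrow> nat \<Rightarrow> real" where
  "to_piece_sphere i \<equiv> to_sphere n (piece_enum i)"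

abbreviation from_piece_sphere :: "real \<Rightarrow> (nat \<Rightarrow> real) \<Rightarrow> 'a \<Rightarrow> real" where
  "from_piece_sphere i \<equiv> from_sphere n (piece_enum i)"

abbreviation squash_piece :: "real \<Rightarrow> real \<Rightarrow> ('a \<Rightarrow> real) \<Rightarrow> 'a \<Rightarrow> real" where
  "squash_piece i \<equiv> squash (C i) G p"

definition index :: "('a \<Rightarrow> real) \<Rightarrow> real" where
  "index \<alpha> = (SOME i. \<alpha> \<in> topspace (piece i))"

lemma finite_piece: "finite (C i \<union> G)"
  using simplex_face.finite_union[OF face] .

lemma finite_G: "finite G" and p: "p \<in> G"
  using simplex_face.finite(2)[OF face] simplex_face.p[OF face] .

lemma piece_enum: "inj_on (piece_enum i) {..Suc n}" "piece_enum i ` {..Suc n} = C i \<union> G" "piece_enum i 0 = p"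
proof -
  have "p \<in> C i \<union> G"
    using p by blast
  from enumeration_starting_at[OF finite_piece card this]
  have "\<exists>v. inj_on v {..Suc n} \<and> v ` {..Suc n} = C i \<union> G \<and> v 0 = p"
    by metis
  from someI_ex[OF this]
  show "inj_on (piece_enum i) {..Suc n}" "piece_enum i ` {..Suc n} = C i \<union> G" "piece_enum i 0 = p"
    by (simp_all add: piece_enum_def)
qed

lemma homeomorphic_maps_piece_sphere:
  "homeomorphic_maps (piece i) (nsphere n) (to_piece_sphere i) (from_piece_sphere i)"
  using homeomorphic_maps_to_sphere[OF piece_enum(1)] by (simp add: piece_enum(2))

lemma continuous_piece_sphere:
  "continuous_map (piece i) (nsphere n) (to_piece_sphere i)"
  "continuous_map (nsphere n) (piece i) (from_piece_sphere i)"
  using homeomorphic_maps_piece_sphere by (auto simp: homeomorphic_maps_def)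

lemma from_piece_sphere_in_piece: "y \<in> topspace (nsphere n) \<Longrightarrow> from_piece_sphere i y \<in> topspace (piece i)"
  using continuous_piece_sphere(2) by (auto simp: continuous_map_def)

lemma piece_sphere_inverse:
  "\<alpha> \<in> topspace (piece i) \<Longrightarrow> from_piece_sphere i (to_piece_sphere i \<alpha>) = \<alpha>"
  "y \<in> topspace (nsphere n) \<Longrightarrow> to_piece_sphere i (from_piece_sphere i y) = y"
  using homeomorphic_maps_piece_sphere by (auto simp: homeomorphic_maps_def)

lemma common_vertex: "vertex p \<in> closed_simplex G"
  by (rule vertex_in_closed_simplex[OF finite_G p])

lemma to_piece_sphere_vertex: "to_piece_sphere i (vertex p) = sphere_base"
  using to_sphere_vertex[OF piece_enum(1)] by (simp add: piece_enum(3))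

lemma from_piece_sphere_base: "from_piece_sphere i sphere_base = vertex p"
  using piece_sphere_inverse(1)[OF simplex_face.face_in_boundary[OF face common_vertex]]
    to_piece_sphere_vertex by metis

lemma squash_common_vertex: "0 \<le> t \<Longrightarrow> t \<le> 1 \<Longrightarrow> squash_piece i t (vertex p) = vertex p"
  by (simp add: simplex_face.squash_on_face[OF face common_vertex] algebra_simps)

lemma pieces_overlap:
  assumes "\<alpha> \<in> topspace (piece i)" "\<alpha> \<in> topspace (piece j)" "i \<noteq> j"
  shows "\<alpha> \<in> closed_simplex G"
proof -
  have simplices: "\<alpha> \<in> closed_simplex (C i \<union> G)" "\<alpha> \<in> closed_simplex (C j \<union> G)"
    using assms(1,2) finite_piece by (auto simp: topspace_simplex_boundary)
  then have "support \<alpha> \<subseteq> (C i \<union> G) \<inter> (C j \<union> G)"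
    using closed_simplex_support(1)[OF finite_piece] by blast
  then show ?thesis
    using disjoint[OF assms(3)] by (intro closed_simplex_restrict[OF finite_piece simplices(1)]) auto
qed

lemma in_indexed_piece: "\<alpha> \<in> topspace (piece i) \<Longrightarrow> \<alpha> \<in> topspace (piece (index \<alpha>))"
  unfolding index_def by (rule someI)

lemma squash_indexed_piece:
  assumes "\<alpha> \<in> topspace (piece i)" "0 \<le> t" "t \<le> 1"
  shows "squash_piece (index \<alpha>) t \<alpha> = squash_piece i t \<alpha>"
proof (cases "index \<alpha> = i")
  case False
  then have "\<alpha> \<in> closed_simplex G"
    using pieces_overlap in_indexed_piece assms(1) by blast
  then show ?thesis
    using simplex_face.squash_on_face[OF face _ assms(2,3)] by simp
qed simp

definition to_wedge :: "('a \<Rightarrow> real) \<Rightarrow> real \<times> (nat \<Rightarrow> real)" where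
  "to_wedge \<alpha> = wedge_collapse (index \<alpha>, to_piece_sphere (index \<alpha>) (squash_piece (index \<alpha>) 1 \<alpha>))"

definition from_wedge :: "real \<times> (nat \<Rightarrow> real) \<Rightarrow> 'a \<Rightarrow> real" where
  "from_wedge = (\<lambda>(i, y). from_piece_sphere i y)"

lemma to_wedge_eq:
  assumes "\<alpha> \<in> topspace (piece i)"
  shows "to_wedge \<alpha> = wedge_collapse (i, to_piece_sphere i (squash_piece i 1 \<alpha>))"
proof (cases "index \<alpha> = i")
  case False
  then have "\<alpha> \<in> closed_simplex G"
    using pieces_overlap in_indexed_piece assms by blast
  then have "squash_piece j 1 \<alpha> = vertex p" for j
    using simplex_face.squash_on_face[OF face, of \<alpha> 1] by simp
  then show ?thesis
    by (simp add: to_wedge_def to_piece_sphere_vertex wedge_collapse_base)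
qed (simp add: to_wedge_def)

lemma from_wedge_collapse: "from_wedge (wedge_collapse (i, y)) = from_piece_sphere i y"
  by (simp add: from_wedge_def wedge_collapse_def from_piece_sphere_base)

lemma abstract_complex_bouquet: "abstract_complex bouquet"
  unfolding bouquet_def using finite_piece by (auto intro!: abstract_complex_Union abstract_complex_simplex_boundary)

lemma continuous_map_piece_bouquet:
  assumes "continuous_map X (piece i) f"
  shows "continuous_map X (realization bouquet) f"
  by (rule continuous_map_realization_mono[OF abstract_complex_simplex_boundary[OF finite_piece]
        abstract_complex_bouquet _ assms]) (auto simp: bouquet_def)

lemma bouquet_simplexE:
  assumes "\<sigma> \<in> bouquet"
  obtains i where "continuous_map (simplex_space \<sigma>) (piece i) (\<lambda>x. x)" "closed_simplex \<sigma> \<subseteq> topspace (piece i)"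
proof -
  obtain i where i: "\<sigma> \<in> simplex_boundary (C i \<union> G)"
    using assms by (auto simp: bouquet_def)
  note complex = abstract_complex_simplex_boundary[OF finite_piece]
  show ?thesis
    by (rule that[OF continuous_map_simplex_realization[OF complex i] simplex_subset_realization[OF complex i]])
qed

lemma bouquet_pointE:
  assumes "\<alpha> \<in> topspace (realization bouquet)"
  obtains i where "\<alpha> \<in> topspace (piece i)"
proof -
  obtain \<sigma> where "\<sigma> \<in> bouquet" "\<alpha> \<in> closed_simplex \<sigma>"
    using assms by (auto simp: topspace_realization[OF abstract_complex_bouquet]
        realization_set_eq[OF abstract_complex_bouquet])
  then show ?thesis
    using bouquet_simplexE that by (metis subsetD)
qed

lemma continuous_map_to_wedge: "continuous_map (realization bouquet) (continuum_wedge_spheres n) to_wedge"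
  unfolding continuous_map_from_realization[OF abstract_complex_bouquet]
proof
  fix \<sigma> assume "\<sigma> \<in> bouquet"
  then obtain i where i: "continuous_map (simplex_space \<sigma>) (piece i) (\<lambda>x. x)" "closed_simplex \<sigma> \<subseteq> topspace (piece i)"
    by (rule bouquet_simplexE)
  have "continuous_map (simplex_space \<sigma>) (piece i) (\<lambda>\<alpha>. squash_piece i 1 \<alpha>)"
    by (intro simplex_face.continuous_map_squash[OF face] i(1)) simp
  from continuous_map_compose[OF continuous_map_compose[OF this continuous_piece_sphere(1)]
      continuous_map_into_wedge[of n i]]
  show "continuous_map (simplex_space \<sigma>) (continuum_wedge_spheres n) to_wedge"
    by (rule continuous_map_eq) (use to_wedge_eq i(2) in auto)
qed

lemma continuous_map_from_wedge_bouquet: "continuous_map (continuum_wedge_spheres n) (realization bouquet) from_wedge"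
proof (rule continuous_map_from_wedge)
  fix i
  show "continuous_map (nsphere n) (realization bouquet) (\<lambda>y. from_wedge (wedge_collapse (i, y)))"
    unfolding from_wedge_collapse by (rule continuous_map_piece_bouquet[OF continuous_piece_sphere(2)])
qed

lemma from_wedge_to_wedge:
  assumes "\<alpha> \<in> topspace (piece i)"
  shows "from_wedge (to_wedge \<alpha>) = squash_piece i 1 \<alpha>"
  using piece_sphere_inverse(1)[OF simplex_face.squash_in_boundary[OF face assms]]
  by (simp add: to_wedge_eq[OF assms] from_wedge_collapse)

lemma bouquet_homotopy:
  "homotopic_with (\<lambda>x. True) (realization bouquet) (realization bouquet) id (from_wedge \<circ> to_wedge)"
proof (rule homotopic_with_realizationI[OF abstract_complex_bouquet, where h = "\<lambda>(t, \<alpha>). squash_piece (index \<alpha>) t \<alpha>"])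
  fix \<sigma> assume "\<sigma> \<in> bouquet"
  then obtain i where i: "continuous_map (simplex_space \<sigma>) (piece i) (\<lambda>x. x)" "closed_simplex \<sigma> \<subseteq> topspace (piece i)"
    by (rule bouquet_simplexE)
  have "continuous_map (prism \<sigma>) (piece i) snd"
    using continuous_map_compose[OF continuous_map_snd i(1), of unit_interval] by (simp add: o_def)
  then have "continuous_map (prism \<sigma>) (piece i) (\<lambda>q. squash_piece i (fst q) (snd q))"
    by (intro simplex_face.continuous_map_squash[OF face] continuous_map_prism_coords(1))
  then have "continuous_map (prism \<sigma>) (realization bouquet) (\<lambda>q. squash_piece i (fst q) (snd q))"
    by (rule continuous_map_piece_bouquet)
  then show "continuous_map (prism \<sigma>) (realization bouquet) (\<lambda>(t, \<alpha>). squash_piece (index \<alpha>) t \<alpha>)"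
    by (rule continuous_map_eq) (use squash_indexed_piece i(2) in auto)
next
  fix \<alpha> assume "\<alpha> \<in> topspace (realization bouquet)"
  then obtain i where i: "\<alpha> \<in> topspace (piece i)"
    by (rule bouquet_pointE)
  show "(\<lambda>(t, \<alpha>). squash_piece (index \<alpha>) t \<alpha>) (0, \<alpha>) = id \<alpha>"
    using simplex_face.squash_0[OF face in_indexed_piece[OF i]] by simp
  show "(\<lambda>(t, \<alpha>). squash_piece (index \<alpha>) t \<alpha>) (1, \<alpha>) = (from_wedge \<circ> to_wedge) \<alpha>"
    using from_wedge_to_wedge[OF in_indexed_piece[OF i]] by simp
qed

lemma wedge_homotopy:
  "homotopic_with (\<lambda>x. True) (continuum_wedge_spheres n) (continuum_wedge_spheres n) id (to_wedge \<circ> from_wedge)"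
proof -
  define h where "h = (\<lambda>(t, i, y). wedge_collapse (i, to_piece_sphere i (squash_piece i t (from_piece_sphere i y))))"
  have h_collapse: "h (t, wedge_collapse (i, y)) = h (t, i, y)" if "0 \<le> t" "t \<le> 1" for t i y
  proof (cases "y = sphere_base")
    case True
    have "h (t, j, sphere_base) = (0, sphere_base)" for j
      by (simp add: h_def from_piece_sphere_base squash_common_vertex[OF that] to_piece_sphere_vertex
          wedge_collapse_base)
    then show ?thesis
      using True by (simp add: wedge_collapse_base)
  qed (simp add: wedge_collapse_def)
  have "homotopic_with (\<lambda>x. True) (continuum_wedge_spheres n) (continuum_wedge_spheres n)
      (\<lambda>x. h (0, x)) (\<lambda>x. h (1, x))"
  proof (rule homotopic_with_wedgeI)
    fix i
    let ?X = "prod_topology unit_interval (nsphere n)"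
    have "continuous_map ?X euclideanreal fst"
      using continuous_map_fst[of unit_interval "nsphere n"] by (simp add: continuous_map_in_subtopology)
    then have "continuous_map ?X (piece i) (\<lambda>q. squash_piece i (fst q) ((from_piece_sphere i \<circ> snd) q))"
      by (rule simplex_face.continuous_map_squash[OF face _
            continuous_map_compose[OF continuous_map_snd continuous_piece_sphere(2)]])
    from continuous_map_compose[OF continuous_map_compose[OF this continuous_piece_sphere(1)]
      continuous_map_into_wedge[of n i]]
    show "continuous_map ?X (continuum_wedge_spheres n) (\<lambda>(t, y). h (t, wedge_collapse (i, y)))"
      by (rule continuous_map_eq) (auto simp: h_collapse, simp add: h_def)
  qed
  then show ?thesis
  proof (rule homotopic_with_eq)
    fix x assume "x \<in> topspace (continuum_wedge_spheres n)"
    then obtain i y where x: "x = wedge_collapse (i, y)" and y: "y \<in> topspace (nsphere n)"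
      by (rule wedge_cases)
    note piece = from_piece_sphere_in_piece[OF y, of i]
    show "id x = h (0, x)"
      using piece_sphere_inverse(2)[OF y] simplex_face.squash_0[OF face piece]
      by (simp add: x h_collapse) (simp add: h_def)
    show "(to_wedge \<circ> from_wedge) x = h (1, x)"
      by (simp add: x h_collapse from_wedge_collapse to_wedge_eq[OF piece]) (simp add: h_def)
  qed simp
qed

theorem bouquet_equivalent_wedge: "realization bouquet homotopy_equivalent_space continuum_wedge_spheres n"
  unfolding homotopy_equivalent_space_def
  using continuous_map_to_wedge continuous_map_from_wedge_bouquet
    homotopic_with_symD[OF bouquet_homotopy] homotopic_with_symD[OF wedge_homotopy] by blast

end

lemma bij_betw_real_unit_interval: "bij_betw (\<lambda>x. arctan x / pi + 1/2) UNIV {0<..<1}"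
proof (rule bij_betw_byWitness[where f' = "\<lambda>s. tan (pi * (s - 1/2))"])
  show "(\<lambda>x. arctan x / pi + 1/2) ` UNIV \<subseteq> {0<..<1}"
  proof
    fix s :: real assume "s \<in> (\<lambda>x. arctan x / pi + 1/2) ` UNIV"
    then obtain x where x: "s = arctan x / pi + 1/2"
      by blast
    have "- (1/2) < arctan x / pi" "arctan x / pi < 1/2"
      using arctan_lbound[of x] arctan_ubound[of x] by (simp_all add: field_simps)
    then have "0 < s" "s < 1"
      unfolding x by linarith+
    then show "s \<in> {0<..<1}"
      by simp
  qed
  show "\<forall>s\<in>{0<..<1}. arctan (tan (pi * (s - 1/2))) / pi + 1/2 = s"
  proof
    fix s :: real assume "s \<in> {0<..<1}"
    then have "0 < s" "s < 1"
      by simp_all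
    then have "- (1/2) < s - 1/2" "s - 1/2 < 1/2"
      by linarith+
    then have "pi * - (1/2) < pi * (s - 1/2)" "pi * (s - 1/2) < pi * (1/2)"
      by (intro mult_strict_left_mono; simp)+
    then have "arctan (tan (pi * (s - 1/2))) = pi * (s - 1/2)"
      by (intro arctan_tan) simp_all
    then show "arctan (tan (pi * (s - 1/2))) / pi + 1/2 = s"
      by simp
  qed
qed (auto simp: tan_arctan)

lemma sphere_bouquet_equivalent_wedge:
  assumes m: "2 \<le> m"
  shows "realization (sphere_bouquet m) homotopy_equivalent_space continuum_wedge_spheres (2 * m - 2)"
proof -
  have m_pos: "0 < m"
    using m by simp
  obtain \<theta> :: "real \<Rightarrow> real" where bij: "bij_betw \<theta> UNIV {0<..<1}"
    using bij_betw_real_unit_interval by blast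
  then have \<theta>: "0 < \<theta> i" "\<theta> i < 1" for i
    using bij_betwE[OF bij] by auto
  interpret simplex_bouquet "\<lambda>i. coset m (\<theta> i)" "polygon m" 0 "2 * m - 2"
  proof unfold_locales
    fix i
    show "finite (coset m (\<theta> i))" "finite (polygon m)"
      by (rule finite_coset[OF m_pos])+
    show disj: "coset m (\<theta> i) \<inter> polygon m = {}"
      by (rule coset_polygon_disjoint[OF \<theta>(1)])
    show "coset m (\<theta> i) \<noteq> {}"
      using coset_nonempty[OF m_pos] \<theta>[of i] by simp
    show "card (coset m (\<theta> i) \<union> polygon m) = Suc (Suc (2 * m - 2))"
      using card_Un_disjoint[OF finite_coset[OF m_pos] finite_coset[OF m_pos] disj] card_coset[OF m_pos] \<theta>[of i] m
      by simp
    show "coset m (\<theta> i) \<inter> coset m (\<theta> j) = {}" if "i \<noteq> j" for j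
      using bij that by (intro coset_disjoint) (auto simp: bij_betw_def dest: injD)
  qed (rule zero_in_polygon)
  have "bouquet = sphere_bouquet m"
    unfolding bouquet_def sphere_bouquet_def bij_betw_imp_surj_on[OF bij, symmetric] by simp
  then show ?thesis
    using bouquet_equivalent_wedge by simp
qed

section \<open>The homotopy types of the Cech complexes\<close>

lemma gap_complex_equivalent_sphere:
  fixes m :: nat and \<delta> :: real
  assumes m: "2 \<le> m" and \<delta>: "1 < real m * \<delta>" "(real m - 1) * \<delta> < 1"
  shows "realization (gap_complex (\<lambda>_. \<delta>) circle) homotopy_equivalent_space nsphere (2 * m - 3)"
proof -
  define q where "q = 2 * m - 1"
  define d where "d = 2 / real q"
  have q: "odd q" "3 \<le> q" "0 < q"
    using m by (auto simp: q_def)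
  have real_q: "real q = 2 * real m - 1"
    using m by (simp add: q_def of_nat_diff)
  then have d: "1 < real m * d" "(real m - 1) * d < 1"
    using q(3) by (auto simp: d_def field_simps)
  have finite: "finite (polygon q)" and card: "card (polygon q) = Suc (Suc (2 * m - 3))"
    using finite_coset[OF q(3)] card_coset[OF q(3)] m by (simp_all add: q_def)
  have "realization (gap_complex (\<lambda>_. \<delta>) circle) homotopy_equivalent_space
      realization (gap_complex (\<lambda>_. d) circle)"
  proof (cases "\<delta> \<le> d")
    case True
    then show ?thesis
      using gap_complex_inclusion_equivalence[OF m \<delta>(1) True d(2)] homotopy_equivalence_map_imp_equivalent
        homotopy_equivalent_space_sym by blast
  next
    case False
    then have "d \<le> \<delta>"
      by simp
    then show ?thesis
      using gap_complex_inclusion_equivalence[OF m d(1) _ \<delta>(2)] homotopy_equivalence_map_imp_equivalent by blast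
  qed
  also have "\<dots> homotopy_equivalent_space realization (simplex_boundary (polygon q))"
    using simplex_boundary_polygon_gap_equivalence[OF q(1,2)] homotopy_equivalence_map_imp_equivalent
      homotopy_equivalent_space_sym unfolding d_def by blast
  also have "\<dots> homotopy_equivalent_space nsphere (2 * m - 3)"
    by (intro homeomorphic_imp_homotopy_equivalent_space simplex_boundary_homeomorphic_sphere finite card)
  finally show ?thesis .
qed

lemma gap_bounds_of_radius_bounds:
  fixes l :: nat and r :: real
  shows "real l / (2 * (real l + 1)) < r \<Longrightarrow> (real (l + 2) - 1) * (1 - 2 * r) < 1"
    and "r < (real l + 1) / (2 * (real l + 2)) \<Longrightarrow> 1 < real (l + 2) * (1 - 2 * r)"
  by (simp_all add: field_simps)

lemma cech_equivalent_sphere: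
  fixes l :: nat and r :: real
  assumes r: "0 < r" "r < 1/2" and l: "real l / (2 * (real l + 1)) < r" "r < (real l + 1) / (2 * (real l + 2))"
  shows "realization (cech_le circle r) homotopy_equivalent_space nsphere (2 * l + 1)"
proof -
  have "realization (gap_complex (\<lambda>_. 1 - 2 * r) circle) homotopy_equivalent_space nsphere (2 * (l + 2) - 3)"
    by (rule gap_complex_equivalent_sphere[OF _ gap_bounds_of_radius_bounds(2)[OF l(2)]
          gap_bounds_of_radius_bounds(1)[OF l(1)]]) simp
  moreover have "2 * (l + 2) - 3 = 2 * l + 1"
    by simp
  ultimately show ?thesis
    by (simp add: cech_le_eq_gap_complex[OF r])
qed

lemma cech_equivalent_wedge:
  fixes l :: nat and r :: real
  assumes r: "0 < r" "r < 1/2" and l: "r = real l / (2 * (real l + 1))"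
  shows "realization (cech_le circle r) homotopy_equivalent_space continuum_wedge_spheres (2 * l)"
proof -
  have "l \<noteq> 0"
    using r(1) l by (intro notI) simp
  then have m: "2 \<le> l + 1"
    by simp
  have "1 - 2 * r = 1 / real (l + 1)"
    unfolding l by (simp add: field_simps)
  then have "realization (cech_le circle r) = realization (critical_complex (l + 1))"
    by (simp add: cech_le_eq_gap_complex[OF r])
  also have "\<dots> homotopy_equivalent_space realization (sphere_bouquet (l + 1))"
    using bouquet_critical_equivalence[OF m] homotopy_equivalence_map_imp_equivalent
      homotopy_equivalent_space_sym by blast
  also have "\<dots> homotopy_equivalent_space continuum_wedge_spheres (2 * (l + 1) - 2)"
    by (rule sphere_bouquet_equivalent_wedge[OF m])
  finally show ?thesis
    by simp
qed

lemma cech_inclusion_equivalence: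
  fixes l :: nat and r r' :: real
  assumes "0 < r" "real l / (2 * (real l + 1)) < r" "r \<le> r'" "r' < (real l + 1) / (2 * (real l + 2))"
  shows "homotopy_equivalence_map (realization (cech_le circle r)) (realization (cech_le circle r')) id"
proof -
  have "(real l + 1) / (2 * (real l + 2)) < 1/2"
    by (simp add: field_simps)
  then have "r' < 1/2" "r < 1/2" "0 < r'"
    using assms by linarith+
  then have "cech_le circle r = gap_complex (\<lambda>_. 1 - 2 * r) circle"
    "cech_le circle r' = gap_complex (\<lambda>_. 1 - 2 * r') circle"
    using assms(1) by (simp_all add: cech_le_eq_gap_complex)
  then show ?thesis
    using gap_complex_inclusion_equivalence[of "l + 2" "1 - 2 * r'" "1 - 2 * r",
        OF _ gap_bounds_of_radius_bounds(2) _ gap_bounds_of_radius_bounds(1)] assms by simp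
qed

theorem theorem9p7:
  fixes r :: real
  assumes "0 < r" and "r < 1/2"
  shows "(\<forall>l::nat. real l / (2 * (real l + 1)) < r \<and> r < (real l + 1) / (2 * (real l + 2))
            \<longrightarrow> realization (cech_le circle r) homotopy_equivalent_space nsphere (2 * l + 1))
       \<and> (\<forall>l::nat. r = real l / (2 * (real l + 1))
            \<longrightarrow> realization (cech_le circle r) homotopy_equivalent_space continuum_wedge_spheres (2 * l))
       \<and> (\<forall>l::nat. \<forall>r'. real l / (2 * (real l + 1)) < r \<and> r \<le> r' \<and> r' < (real l + 1) / (2 * (real l + 2))
            \<longrightarrow> homotopy_equivalence_map (realization (cech_le circle r))
                   (realization (cech_le circle r')) id)"
proof (intro conjI allI impI)
  fix l :: nat
  show "realization (cech_le circle r) homotopy_equivalent_space nsphere (2 * l + 1)"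
    if "real l / (2 * (real l + 1)) < r \<and> r < (real l + 1) / (2 * (real l + 2))"
    using cech_equivalent_sphere[OF assms] that by blast
  show "realization (cech_le circle r) homotopy_equivalent_space continuum_wedge_spheres (2 * l)"
    if "r = real l / (2 * (real l + 1))"
    using cech_equivalent_wedge[OF assms that] .
  show "homotopy_equivalence_map (realization (cech_le circle r)) (realization (cech_le circle r')) id"
    if "real l / (2 * (real l + 1)) < r \<and> r \<le> r' \<and> r' < (real l + 1) / (2 * (real l + 2))" for r'
    using cech_inclusion_equivalence[OF assms(1)] that by blast
qed

end
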